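(* Let $f(t)=\sum_{k=0}^\infty a_k t^k$ with $\{a_k\}_{k\ge 0}$ i.i.d. real standard Gaussian random variables. For every $n\ge 1$ and every sequence $\boldsymbol{t}=(t_1,\dots,t_n)$ of $n$ distinct real numbers in $(-1,1)$, $$E[|f(t_1)f(t_2)\cdots f(t_n)|]=\left(\frac{2}{\pi}\right)^{n/2}(\det\Sigma(\boldsymbol{t}))^{-1/2}\,\mathrm{Pf}\,(\mathbb{K}(t_i,t_j))_{i,j=1}^n .$$
   Context: $\Sigma(\boldsymbol{t})=\left(\frac{1}{1-t_it_j}\right)_{i,j=1}^n$ is the covariance matrix of $(f(t_1),\dots,f(t_n))$; it is positive definite for distinct $t_i$. The $2\times2$ matrix kernel $\mathbb{K}(s,t)=\begin{pmatrix}\mathbb{K}_{11}(s,t)&\mathbb{K}_{12}(s,t)\\ \mathbb{K}_{21}(s,t)&\mathbb{K}_{22}(s,t)\end{pmatrix}$, $-1<s,t<1$, is given by $\mathbb{K}_{11}(s,t)=\frac{s-t}{\sqrt{(1-s^2)(1-t^2)}\,(1-st)^2}$, $\mathbb{K}_{12}(s,t)=\sqrt{\frac{1-t^2}{1-s^2}}\,\frac{1}{1-st}$, $\mathbb{K}_{21}(s,t)=-\sqrt{\frac{1-s^2}{1-t^2}}\,\frac{1}{1-st}$, $\mathbb{K}_{22}(s,t)=\mathrm{sgn}(t-s)\arcsin c(s,t)$, where $c(s,t)=\frac{\sqrt{(1-s^2)(1-t^2)}}{1-st}$, $\mathrm{sgn}(x)=x/|x|$ for $x\ne0$ and $\mathrm{sgn}(0)=0$.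 The matrix $(\mathbb{K}(t_i,t_j))_{i,j=1}^n$ is the $2n\times 2n$ skew-symmetric matrix whose $(i,j)$ block of size $2\times 2$ is $\mathbb{K}(t_i,t_j)$. The Pfaffian of a $2n\times2n$ skew-symmetric matrix $B=(b_{ij})$ is $\mathrm{Pf}(B)=\sum_\eta\epsilon(\eta)\,b_{\eta(1)\eta(2)}\cdots b_{\eta(2n-1)\eta(2n)}$, summed over permutations $\eta$ of $\{1,\dots,2n\}$ with $\eta(2i-1)<\eta(2i)$ for all $i$ and $\eta(1)<\eta(3)<\cdots<\eta(2n-1)$, where $\epsilon(\eta)$ is the signature. *)

theory Defs
  imports
    "HOL-Probability.Probability"
    "Jordan_Normal_Form.Determinant"
begin

text \<open>All indices start at 0: the sequence is \<open>t 0, \<dots>, t (n - 1)\<close>, and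
  matrices are those of \<open>Jordan_Normal_Form.Matrix\<close>.\<close>

text \<open>For i.i.d. standard Gaussian coefficients and \<open>\<bar>t\<bar> < 1\<close> the series converges
  almost surely; the value of \<open>suminf\<close> on the exceptional null set is irrelevant to expectations.\<close>

definition random_power_series :: "(nat \<Rightarrow> 'w \<Rightarrow> real) \<Rightarrow> real \<Rightarrow> 'w \<Rightarrow> real" where
  "random_power_series a t \<omega> = (\<Sum>k. a k \<omega> * t ^ k)"

definition Sigma_mat :: "nat \<Rightarrow> (nat \<Rightarrow> real) \<Rightarrow> real mat" where
  "Sigma_mat n t = mat n n (\<lambda>(i, j). 1 / (1 - t i * t j))"

definition c_kernel :: "real \<Rightarrow> real \<Rightarrow> real" where
  "c_kernel s t = sqrt ((1 - s\<^sup>2) * (1 - t\<^sup>2)) / (1 - s * t)"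

definition K_kernel :: "real \<Rightarrow> real \<Rightarrow> real mat" where
  "K_kernel s t = mat_of_rows_list 2
    [[(s - t) / (sqrt ((1 - s\<^sup>2) * (1 - t\<^sup>2)) * (1 - s * t)\<^sup>2),
      sqrt ((1 - t\<^sup>2) / (1 - s\<^sup>2)) * (1 / (1 - s * t))],
     [- sqrt ((1 - s\<^sup>2) / (1 - t\<^sup>2)) * (1 / (1 - s * t)),
      sgn (t - s) * arcsin (c_kernel s t)]]"

definition K_mat :: "nat \<Rightarrow> (nat \<Rightarrow> real) \<Rightarrow> real mat" where
  "K_mat n t = mat (2 * n) (2 * n)
    (\<lambda>(i, j). K_kernel (t (i div 2)) (t (j div 2)) $$ (i mod 2, j mod 2))"

text \<open>With 0-based indices the conditions on the permutations become
  \<open>\<eta>(2i) < \<eta>(2i+1)\<close> and \<open>\<eta>(0) < \<eta>(2) < \<dots>\<close>. The definition is meaningful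
  for skew-symmetric matrices of even dimension.\<close>

definition pfaffian :: "'a :: comm_ring_1 mat \<Rightarrow> 'a" where
  "pfaffian B = (let n = dim_row B div 2 in
    \<Sum>p | p permutes {0..<2 * n} \<and>
          (\<forall>i<n. p (2 * i) < p (2 * i + 1)) \<and>
          (\<forall>i j. i < j \<and> j < n \<longrightarrow> p (2 * i) < p (2 * j)).
      of_int (sign p) * (\<Prod>i<n. B $$ (p (2 * i), p (2 * i + 1))))"

end

theory Submission
  imports Defs
begin

text \<open>Conditionally on \<open>f s = 0\<close> the process \<open>f\<close> has the law of \<open>t \<mapsto> (t - s) / (1 - s t) * f t\<close>,
  because the covariance \<open>1 / (1 - s t)\<close> is the Szego kernel. Hence differentiating an expectation in the
  point \<open>s\<close> of a factor \<open>sgn (f s)\<close> produces the same expectation with \<open>sgn (f s)\<close> replaced by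
  \<open>f s\<close> and every other \<open>f t\<close> multiplied by its Blaschke factor.
  For increasing points, one such derivative followed by Gaussian integration by parts shows that
  \<open>E [\<Prod> sgn (f x\<^sub>i)]\<close> obeys the expansion of a Pfaffian along its first row; both sides vanish
  as \<open>x\<^sub>0\<close> tends to \<open>-1\<close>, so \<open>E [\<Prod> sgn (f x\<^sub>i)] = (2 / \<pi>)^N Pf (arcsin c)\<close>.
  Taking the points \<open>t\<^sub>0 < s\<^sub>0 < t\<^sub>1 < s\<^sub>1 < \<dots>\<close> and differentiating in every \<open>t\<^sub>i\<close> turns the entries
  \<open>K\<^sub>2\<^sub>2\<close> into \<open>K\<^sub>1\<^sub>2\<close> and \<open>K\<^sub>1\<^sub>1\<close>, while the Blaschke factors accumulate to the square root of the
  Cauchy determinant \<open>det \<Sigma>\<close>. Letting \<open>s\<^sub>i\<close> tend to \<open>t\<^sub>i\<close> gives the absolute moment.\<close>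

section \<open>Pfaffians along lists\<close>

text \<open>No joint density of the values of \<open>f\<close> is used. Conditioning is encoded as
  an identity of laws in which an independent standard normal variable \<open>z\<close> carries the
  randomness at \<open>s\<close>. Characteristic functions verify it; afterwards \<open>f s\<close>
  is a multiple of \<open>z\<close> alone, and each derivative of an expectation becomes a
  one-dimensional integral in \<open>z\<close>. The constant
  \<open>sqrt (2 / pi) / sqrt (1 - s\<^sup>2)\<close> is a product of three: the jump 2 of
  \<open>sgn\<close>, the density \<open>sqrt (1 - s\<^sup>2) / sqrt (2 * pi)\<close> of
  \<open>f s\<close> at 0, and the slope \<open>1 / (1 - s\<^sup>2)\<close> at \<open>s\<close> of
  the Blaschke factor, by which the derivative of \<open>f\<close> at \<open>s\<close>, given
  \<open>f s = 0\<close>, has the law of a multiple of \<open>f s\<close>. The obstacle is that the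
  absolute value of \<open>f t\<close> joins \<open>f t\<close> and its sign at one point, where the
  arcsine entry of the kernel jumps. Separate points for values and signs keep all arguments
  distinct, and the last limit merges only pairs whose kernel entry is continuous. The signs of
  Blaschke factors are read off the order of the points. The analysis therefore needs increasing
  points, and the invariance of both sides under permutations is proved algebraically.\<close>

definition remove_nth :: "nat \<Rightarrow> 'a list \<Rightarrow> 'a list" where
  "remove_nth j ys = take j ys @ drop (Suc j) ys"

lemma length_remove_nth [simp]: "j < length ys \<Longrightarrow> length (remove_nth j ys) = length ys - 1"
  by (simp add: remove_nth_def)

lemma nth_remove_nth:
  "j < length ys \<Longrightarrow> i < length ys - 1 \<Longrightarrow> remove_nth j ys ! i = ys ! insert_index j i"
  by (auto simp: remove_nth_def nth_append insert_index_def min_def)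

lemma set_remove_nth_subset: "set (remove_nth j ys) \<subseteq> set ys"
  by (auto simp: remove_nth_def dest: in_set_takeD in_set_dropD)

lemma distinct_remove_nth: "distinct ys \<Longrightarrow> distinct (remove_nth j ys)"
  by (simp add: remove_nth_def set_take_disj_set_drop_if_distinct)

lemma set_remove_nth:
  assumes "distinct ys" "j < length ys"
  shows "set (remove_nth j ys) = set ys - {ys ! j}"
proof -
  have "ys = take j ys @ ys ! j # drop (Suc j) ys" using assms(2) by (simp add: id_take_nth_drop)
  then have "set ys = set (remove_nth j ys) \<union> {ys ! j}"
    unfolding remove_nth_def by (metis Un_insert_right list.simps(15) set_append sup_bot_right)
  moreover have "ys ! j \<notin> set (remove_nth j ys)"
    using assms unfolding remove_nth_def
    by (metis \<open>ys = take j ys @ ys ! j # drop (Suc j) ys\<close> not_distinct_conv_prefix distinct_append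
        Un_iff set_append distinct.simps(2))
  ultimately show ?thesis by auto
qed

lemma remove_nth_append:
  "remove_nth j (us @ ys) = (if j < length us then remove_nth j us @ ys else us @ remove_nth (j - length us) ys)"
  by (auto simp: remove_nth_def Suc_diff_le)

lemma remove_nth_simps [simp]:
  "remove_nth 0 (y # ys) = ys" "remove_nth (Suc j) (y # ys) = y # remove_nth j ys"
  by (auto simp: remove_nth_def)

lemma remove_nth_remove_nth:
  assumes "l < j" "j < length ys"
  shows "remove_nth l (remove_nth j ys) = remove_nth (j - 1) (remove_nth l ys)"
proof (rule nth_equalityI)
  show "length (remove_nth l (remove_nth j ys)) = length (remove_nth (j - 1) (remove_nth l ys))"
    using assms by simp
next
  fix i assume "i < length (remove_nth l (remove_nth j ys))"
  then have "i < length ys - 2" using assms by simp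
  then show "remove_nth l (remove_nth j ys) ! i = remove_nth (j - 1) (remove_nth l ys) ! i"
    using assms by (subst nth_remove_nth; (subst nth_remove_nth)?; auto simp: insert_index_def nth_remove_nth)
qed

text \<open>This is the expansion of a Pfaffian along its first row, with the index set kept as a
  list. An entry \<open>B x y\<close> is read only for \<open>x\<close> standing before
  \<open>y\<close>, so a distinct list never reads the diagonal. Lists of odd length give 0.\<close>

function pf_list :: "('e \<Rightarrow> 'e \<Rightarrow> 'a::comm_ring_1) \<Rightarrow> 'e list \<Rightarrow> 'a" where
  "pf_list B [] = 1"
| "pf_list B (x # ys) = (\<Sum>j<length ys. (-1) ^ j * B x (ys ! j) * pf_list B (remove_nth j ys))"
  by pat_completeness auto
termination by (relation "Wellfounded.measure (length \<circ> snd)") (auto simp: remove_nth_def)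

lemma pf_cong:
  assumes "\<And>x y. x \<in> set xs \<Longrightarrow> y \<in> set xs \<Longrightarrow> B x y = C x y"
  shows "pf_list B xs = pf_list C xs"
  using assms
proof (induction "length xs" arbitrary: xs rule: less_induct)
  case less
  show ?case
  proof (cases xs)
    case (Cons x ys)
    have "pf_list B (remove_nth j ys) = pf_list C (remove_nth j ys)" if "j < length ys" for j
      using that less.prems set_remove_nth_subset[of j ys] Cons
      by (intro less.hyps) (auto simp: subset_iff)
    then show ?thesis using less.prems Cons by auto
  qed simp
qed

lemma pf_map: "pf_list B (map g xs) = pf_list (\<lambda>a b. B (g a) (g b)) xs"
proof (induction "length xs" arbitrary: xs rule: less_induct)
  case less
  show ?case
  proof (cases xs)
    case (Cons x ys)
    have "remove_nth j (map g ys) = map g (remove_nth j ys)" for j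
      by (simp add: remove_nth_def take_map drop_map)
    moreover have "pf_list B (map g (remove_nth j ys)) = pf_list (\<lambda>a b. B (g a) (g b)) (remove_nth j ys)"
      if "j < length ys" for j
      using that Cons by (intro less) auto
    ultimately show ?thesis using Cons by simp
  qed simp
qed

text \<open>Expanding along both leading rows leaves the term pairing \<open>a\<close> with
  \<open>b\<close>, which changes sign by skewness, and a double sum over ordered pairs of partners.
  Exchanging the order in which the two partners are removed maps one double sum to the negative of
  the other.\<close>

lemma pf_swap_first:
  assumes skew: "\<And>x y. B y x = - B x y"
  shows "pf_list B (a # b # ys) = - pf_list B (b # a # ys)"
proof -
  define n where "n = length ys"
  \<comment> \<open>Here \<open>a\<close> is matched with \<open>ys ! j\<close> and \<open>b\<close>
    with the entry at position \<open>l\<close> of what remains. The extra 1 in the exponent counts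
    \<open>b\<close>, which stands in front of \<open>ys\<close>.\<close>
  define f where "f a b = (\<lambda>(j, l). (-1) ^ (j + 1 + l) * B a (ys ! j) * B b (remove_nth j ys ! l)
     * pf_list B (remove_nth l (remove_nth j ys)))" for a b
  have exp: "pf_list B (a # b # ys) = B a b * pf_list B ys + sum (f a b) ({..<n} \<times> {..<n-1})" for a b
  proof -
    have "pf_list B (a # b # ys) = B a b * pf_list B ys
      + (\<Sum>j<n. (-1) ^ Suc j * B a (ys ! j) * pf_list B (b # remove_nth j ys))"
      by (subst pf_list.simps(2)) (simp add: sum.lessThan_Suc_shift n_def del: pf_list.simps(2) sum.lessThan_Suc)
    also have "(\<Sum>j<n. (-1) ^ Suc j * B a (ys ! j) * pf_list B (b # remove_nth j ys))
      = (\<Sum>j<n. \<Sum>l<n-1. f a b (j, l))"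
      by (intro sum.cong refl)
        (auto simp: f_def n_def sum_distrib_left power_add algebra_simps sum_negf)
    also have "\<dots> = sum (f a b) ({..<n} \<times> {..<n-1})"
      by (simp add: sum.cartesian_product)
    finally show ?thesis .
  qed
  \<comment> \<open>The same two positions of \<open>ys\<close>, removed in the opposite order. The
    second position is counted in the shortened list, hence the shift by one, which also flips the
    parity of \<open>j + l\<close>.\<close>
  define i :: "nat \<times> nat \<Rightarrow> nat \<times> nat" where "i = (\<lambda>(j, l). if l < j then (l, j - 1) else (l + 1, j))"
  have "sum (f a b) ({..<n} \<times> {..<n-1}) = (\<Sum>p\<in>{..<n} \<times> {..<n-1}. - f b a p)"
  proof (rule sum.reindex_bij_witness[of _ i i])
    fix p assume p: "p \<in> {..<n} \<times> {..<n-1}"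
    obtain j l where pjl: "p = (j, l)" by force
    then have jl: "j < n" "l < n - 1" using p by auto
    show "i (i p) = p" by (auto simp: i_def pjl)
    show "i (i p) = p" by (auto simp: i_def pjl)
    show "i p \<in> {..<n} \<times> {..<n-1}" using jl by (auto simp: i_def pjl)
    show "i p \<in> {..<n} \<times> {..<n-1}" using jl by (auto simp: i_def pjl)
    show "- f b a (i p) = f a b p"
    proof (cases "l < j")
      case True
      then obtain k where k: "j = Suc k" by (cases j) auto
      have "remove_nth l (remove_nth j ys) = remove_nth k (remove_nth l ys)"
        using True jl remove_nth_remove_nth[of l j ys] k by (simp add: n_def)
      moreover have "remove_nth j ys ! l = ys ! l" "remove_nth l ys ! k = ys ! j"
        using True jl k by (auto simp: nth_remove_nth n_def)
      ultimately show ?thesis using True k by (simp add: i_def pjl f_def algebra_simps)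
    next
      case False
      then have "remove_nth l (remove_nth j ys) = remove_nth j (remove_nth (Suc l) ys)"
        using jl remove_nth_remove_nth[of j "Suc l" ys] by (simp add: n_def)
      moreover have "remove_nth j ys ! l = ys ! Suc l" "remove_nth (Suc l) ys ! j = ys ! j"
        using False jl by (auto simp: nth_remove_nth n_def)
      ultimately show ?thesis using False by (simp add: i_def pjl f_def algebra_simps)
    qed
  qed
  then show ?thesis unfolding exp skew[of b a] by (simp add: sum_negf)
qed

text \<open>With an element \<open>x\<close> in front, the row expansion is reindexed by the
  transposition of the two swapped positions. If \<open>x\<close> is matched with \<open>a\<close>
  or \<open>b\<close>, the remaining lists coincide and the sign comes from the shifted position;
  otherwise the induction hypothesis applies to the remaining list.\<close>

lemma pf_swap:
  assumes skew: "\<And>x y. B y x = - B x y"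
  shows "pf_list B (us @ a # b # ys) = - pf_list B (us @ b # a # ys)"
proof (induction "length us + length ys" arbitrary: us ys rule: less_induct)
  case less
  show ?case
  proof (cases us)
    case Nil
    then show ?thesis unfolding Nil append_Nil by (intro pf_swap_first skew)
  next
    case (Cons x vs)
    define m where "m = length vs"
    define \<sigma> where "\<sigma> = Transposition.transpose m (Suc m)"
    have "pf_list B (x # vs @ a # b # ys) = (\<Sum>j<length (vs @ a # b # ys). (-1) ^ j *
        B x ((vs @ a # b # ys) ! j) * pf_list B (remove_nth j (vs @ a # b # ys)))" by simp
    also have "\<dots> = (\<Sum>j<length (vs @ b # a # ys). - ((-1) ^ j *
        B x ((vs @ b # a # ys) ! j) * pf_list B (remove_nth j (vs @ b # a # ys))))"
    proof (rule sum.reindex_bij_witness[of _ \<sigma> \<sigma>])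
      fix j assume j: "j \<in> {..<length (vs @ a # b # ys)}"
      show "\<sigma> (\<sigma> j) = j" by (simp add: \<sigma>_def)
      show "\<sigma> j \<in> {..<length (vs @ b # a # ys)}" using j by (auto simp: \<sigma>_def Transposition.transpose_def m_def)
      consider "j < m" | "j = m" | "j = Suc m" | "j > Suc m" by linarith
      then show "- ((-1) ^ \<sigma> j * B x ((vs @ b # a # ys) ! \<sigma> j) * pf_list B (remove_nth (\<sigma> j) (vs @ b # a # ys)))
        = (-1) ^ j * B x ((vs @ a # b # ys) ! j) * pf_list B (remove_nth j (vs @ a # b # ys))"
      proof cases
        case 1
        then show ?thesis using less.hyps[of "remove_nth j vs" ys] Cons
          by (auto simp: \<sigma>_def Transposition.transpose_def m_def nth_append remove_nth_append)
      next
        case 2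
        then show ?thesis by (auto simp: \<sigma>_def Transposition.transpose_def m_def nth_append remove_nth_append)
      next
        case 3
        then show ?thesis by (auto simp: \<sigma>_def Transposition.transpose_def m_def nth_append remove_nth_append)
      next
        case 4
        then obtain k where k: "j = Suc (Suc (m + k))" using less_iff_Suc_add by auto
        then have "k < length ys" using j by (auto simp: m_def)
        then have "pf_list B (vs @ a # b # remove_nth k ys) = - pf_list B (vs @ b # a # remove_nth k ys)"
          using less.hyps[of vs "remove_nth k ys"] Cons by auto
        then show ?thesis using k
          by (auto simp: \<sigma>_def Transposition.transpose_def m_def nth_append remove_nth_append Suc_diff_le)
      qed
    next
      fix j assume j: "j \<in> {..<length (vs @ b # a # ys)}"
      show "\<sigma> (\<sigma> j) = j" by (simp add: \<sigma>_def)
      show "\<sigma> j \<in> {..<length (vs @ a # b # ys)}" using j by (auto simp: \<sigma>_def Transposition.transpose_def m_def)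
    qed
    finally show ?thesis using Cons by (simp add: sum_negf)
  qed
qed

text \<open>Moving two entries past two others takes four adjacent transpositions, an even number.
  This is why the Pfaffian of a matrix made of 2 by 2 blocks does not depend on the order of the
  points.\<close>

lemma pf_swap_blocks:
  assumes skew: "\<And>x y. B y x = - B x y"
  shows "pf_list B (us @ a # a' # b # b' # ys) = pf_list B (us @ b # b' # a # a' # ys)"
proof -
  note sw = pf_swap[of B, OF skew]
  have "pf_list B (us @ a # a' # b # b' # ys) = - pf_list B (us @ a # b # a' # b' # ys)"
    using sw[of "us @ [a]" a' b "b' # ys"] by simp
  also have "\<dots> = pf_list B (us @ b # a # a' # b' # ys)"
    using sw[of us a b "a' # b' # ys"] by simp
  also have "\<dots> = - pf_list B (us @ b # a # b' # a' # ys)"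
    using sw[of "us @ [b, a]" a' b' ys] by simp
  also have "\<dots> = pf_list B (us @ b # b' # a # a' # ys)"
    using sw[of "us @ [b]" a b' "a' # ys"] by simp
  finally show ?thesis .
qed

text \<open>The tag tells the first row of a 2 by 2 block (0) from the second (1), so that one
  function of tagged points can serve as the whole block matrix.\<close>

definition blocks :: "'t list \<Rightarrow> (nat \<times> 't) list" where
  "blocks ts = concat (map (\<lambda>t. [(0, t), (1, t)]) ts)"

lemma blocks_simps [simp]:
  "blocks [] = []" "blocks (t # ts) = (0, t) # (1, t) # blocks ts" "blocks (us @ ts) = blocks us @ blocks ts"
  by (simp_all add: blocks_def)

lemma pf_blocks_insort:
  assumes skew: "\<And>x y. B y x = - B x y"
  shows "pf_list B (blocks (us @ insort x ts)) = pf_list B (blocks (us @ x # ts))"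
proof (induction ts arbitrary: us)
  case (Cons y ts)
  show ?case
  proof (cases "x \<le> y")
    case False
    have "pf_list B (blocks (us @ insort x (y # ts))) = pf_list B (blocks (us @ y # x # ts))"
      using False Cons[of "us @ [y]"] by simp
    also have "\<dots> = pf_list B (blocks (us @ x # y # ts))"
      using pf_swap_blocks[of B, OF skew] by simp
    finally show ?thesis .
  qed simp
qed simp

text \<open>Insertion sort only exchanges neighbouring blocks. The prefix \<open>us\<close> collects
  the points already passed.\<close>

lemma pf_blocks_sort:
  assumes skew: "\<And>x y. B y x = - B x y"
  shows "pf_list B (blocks (us @ sort ts)) = pf_list B (blocks (us @ ts))"
proof (induction ts arbitrary: us)
  case (Cons x ts)
  then show ?case
    using pf_blocks_insort[of B, OF skew] Cons[of "us @ [x]"] by simp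
qed simp

section \<open>The permutation sum and its expansion along the first row\<close>

definition matching_perms :: "nat \<Rightarrow> (nat \<Rightarrow> nat) set" where
  "matching_perms n = {p. p permutes {0..<2 * n} \<and> (\<forall>i<n. p (2 * i) < p (2 * i + 1)) \<and>
     (\<forall>i j. i < j \<and> j < n \<longrightarrow> p (2 * i) < p (2 * j))}"

text \<open>Adds the pair consisting of \<open>0\<close> and \<open>Suc j\<close> in front of the
  matching \<open>q\<close>, whose values are relabelled to avoid these two.\<close>

abbreviation perm_ins :: "nat \<Rightarrow> (nat \<Rightarrow> nat) \<Rightarrow> nat \<Rightarrow> nat" where
  "perm_ins j q \<equiv> permutation_insert 0 0 (permutation_insert 0 j q)"

lemma perm_ins_simps:
  "perm_ins j q 0 = 0" "perm_ins j q (Suc 0) = Suc j"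
  "perm_ins j q (Suc (Suc i)) = Suc (insert_index j (q i))"
  by (simp_all add: permutation_insert_def insert_dom_def insert_ran_def)

lemma insert_index_less_iff [simp]: "insert_index j a < insert_index j b \<longleftrightarrow> a < b"
  by (auto simp: insert_index_def)

lemma perm_ins_in_matching_perms_iff:
  assumes "q permutes {0..<2 * n}" "j < 2 * n + 1"
  shows "perm_ins j q \<in> matching_perms (Suc n) \<longleftrightarrow> q \<in> matching_perms n"
proof -
  let ?p = "perm_ins j q"
  have perm: "?p permutes {0..<2 * Suc n}"
    using permutation_insert_permutes[OF permutation_insert_permutes[OF assms(1), of 0 j], of 0 0] assms(2)
    by simp
  have even: "?p (2 * Suc i) = Suc (insert_index j (q (2 * i)))" for i
    using perm_ins_simps(3)[of j q "2 * i"] by simp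
  have odd: "?p (2 * Suc i + 1) = Suc (insert_index j (q (2 * i + 1)))" for i
    using perm_ins_simps(3)[of j q "2 * i + 1"] by simp
  have "(\<forall>i<Suc n. ?p (2 * i) < ?p (2 * i + 1)) \<longleftrightarrow> (\<forall>i<n. q (2 * i) < q (2 * i + 1))"
    unfolding All_less_Suc2 even odd by (simp add: perm_ins_simps)
  moreover have "(\<forall>k i. i < k \<and> k < Suc n \<longrightarrow> ?p (2 * i) < ?p (2 * k)) \<longleftrightarrow>
    (\<forall>k i. i < k \<and> k < n \<longrightarrow> q (2 * i) < q (2 * k))"
  proof safe
    fix i k assume "\<forall>k i. i < k \<and> k < Suc n \<longrightarrow> ?p (2 * i) < ?p (2 * k)" "i < k" "k < n"
    then have "?p (2 * Suc i) < ?p (2 * Suc k)" by (metis Suc_less_eq)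
    then show "q (2 * i) < q (2 * k)" unfolding even by simp
  next
    fix i k assume *: "\<forall>k i. i < k \<and> k < n \<longrightarrow> q (2 * i) < q (2 * k)" and ik: "i < k" "k < Suc n"
    then obtain k' where k': "k = Suc k'" by (cases k) auto
    show "?p (2 * i) < ?p (2 * k)"
    proof (cases i)
      case 0
      then show ?thesis unfolding k' even by (simp add: perm_ins_simps)
    next
      case (Suc i')
      then show ?thesis unfolding k' Suc even using * ik k' Suc by simp
    qed
  qed
  ultimately show ?thesis using assms(1) perm unfolding matching_perms_def by blast
qed

text \<open>The value \<open>0\<close> has to be the smaller element of its pair, so it sits at an
  even position, and it has to be the least of the first elements, so that position is the
  first.\<close>

lemma matching_perms_first:
  assumes "p \<in> matching_perms (Suc n)" shows "p 0 = 0"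
proof -
  have p: "p permutes {0..<2 * Suc n}" using assms by (simp add: matching_perms_def)
  then obtain m where m: "m < 2 * Suc n" "p m = 0"
    by (metis atLeastLessThan_iff less_nat_zero_code nat_less_le permutes_def zero_less_Suc mult_pos_pos
        pos2 zero_le)
  obtain i where i: "m = 2 * i \<or> m = 2 * i + 1" by (metis oddE evenE)
  then have "i < Suc n" using m by auto
  then have "m = 2 * i"
    using i m(2) assms unfolding matching_perms_def by (metis (mono_tags, lifting) mem_Collect_eq not_less_zero)
  moreover have "i = 0"
  proof (rule ccontr)
    assume "i \<noteq> 0"
    then have "p (2 * 0) < p (2 * i)" using assms \<open>i < Suc n\<close> unfolding matching_perms_def by blast
    then show False using m \<open>m = 2 * i\<close> by simp
  qed
  ultimately show ?thesis using m by simp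
qed

text \<open>A perfect matching is determined by the partner \<open>Suc j\<close> of \<open>0\<close>
  and the matching induced on the remaining \<open>2 * n\<close> indices.\<close>

lemma bij_betw_perm_ins:
  "bij_betw (\<lambda>(j, q). perm_ins j q) ({..<2 * n + 1} \<times> matching_perms n) (matching_perms (Suc n))"
proof (rule bij_betw_imageI)
  show "inj_on (\<lambda>(j, q). perm_ins j q) ({..<2 * n + 1} \<times> matching_perms n)"
  proof (rule inj_onI, clarsimp)
    fix j q k r assume *: "j < Suc (2 * n)" "q \<in> matching_perms n" "k < Suc (2 * n)" "r \<in> matching_perms n"
      "perm_ins j q = perm_ins k r"
    then have "j = k" using perm_ins_simps(2) by (metis nat.inject)
    have "q i = r i" for i
    proof -
      have "insert_index j (q i) = insert_index j (r i)"
        using fun_cong[OF *(5), of "Suc (Suc i)"] \<open>j = k\<close> by (simp add: perm_ins_simps)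
      then show ?thesis by (metis delete_insert_index)
    qed
    then show "j = k \<and> q = r" using \<open>j = k\<close> by auto
  qed
  show "(\<lambda>(j, q). perm_ins j q) ` ({..<2 * n + 1} \<times> matching_perms n) = matching_perms (Suc n)"
  proof (intro equalityI subsetI)
    fix p assume "p \<in> (\<lambda>(j, q). perm_ins j q) ` ({..<2 * n + 1} \<times> matching_perms n)"
    then obtain j q where "p = perm_ins j q" "j < 2 * n + 1" "q \<in> matching_perms n" by auto
    then show "p \<in> matching_perms (Suc n)"
      using perm_ins_in_matching_perms_iff[of q n j] by (simp add: matching_perms_def)
  next
    fix p assume p: "p \<in> matching_perms (Suc n)"
    then have pp: "p permutes {0..<Suc (2 * n + 1)}" by (simp add: matching_perms_def)
    then obtain r where r: "r permutes {0..<2 * n + 1}" "p = permutation_insert 0 0 r"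
      using permutation_fix[of 0 "2 * n + 1" 0] matching_perms_first[OF p] by auto
    have r0: "r 0 < Suc (2 * n)" using permutes_in_image[OF r(1), of 0] by simp
    then obtain q where q: "q permutes {0..<2 * n}" "r = permutation_insert 0 (r 0) q"
      using permutation_fix[of 0 "2 * n" "r 0"] r(1) by auto
    have "p = perm_ins (r 0) q" using r(2) q(2) by simp
    then show "p \<in> (\<lambda>(j, q). perm_ins j q) ` ({..<2 * n + 1} \<times> matching_perms n)"
      using p q(1) r0 perm_ins_in_matching_perms_iff[OF q(1), of "r 0"]
      by (intro image_eqI[of _ _ "(r 0, q)"]) auto
  qed
qed

definition pfaffian_fun :: "nat \<Rightarrow> (nat \<Rightarrow> nat \<Rightarrow> 'a::comm_ring_1) \<Rightarrow> 'a" where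
  "pfaffian_fun n B = (\<Sum>p\<in>matching_perms n. of_int (sign p) * (\<Prod>i<n. B (p (2 * i)) (p (2 * i + 1))))"

text \<open>Matchings are grouped by the partner of \<open>0\<close>. Inserting the image
  \<open>j\<close> in first place changes the signature by \<open>(-1) ^ j\<close>, and inserting
  \<open>0\<close> in front of it does not change it.\<close>

lemma pfaffian_fun_Suc:
  "pfaffian_fun (Suc n) B = (\<Sum>j<2 * n + 1. (-1) ^ j * B 0 (Suc j) *
     pfaffian_fun n (\<lambda>a b. B (Suc (insert_index j a)) (Suc (insert_index j b))))"
proof -
  let ?t = "\<lambda>n B p. of_int (sign p) * (\<Prod>i<n. B (p (2 * i)) (p (2 * i + 1)))"
  have "pfaffian_fun (Suc n) B = (\<Sum>(j, q)\<in>{..<2 * n + 1} \<times> matching_perms n. ?t (Suc n) B (perm_ins j q))"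
    unfolding pfaffian_fun_def
    by (subst sum.reindex_bij_betw[OF bij_betw_perm_ins, symmetric]) (simp add: case_prod_beta)
  also have "\<dots> = (\<Sum>(j, q)\<in>{..<2 * n + 1} \<times> matching_perms n. (-1) ^ j * B 0 (Suc j) *
      ?t n (\<lambda>a b. B (Suc (insert_index j a)) (Suc (insert_index j b))) q)"
  proof (intro sum.cong refl)
    fix x assume "x \<in> {..<2 * n + 1} \<times> matching_perms n"
    then obtain j q where x: "x = (j, q)" and j: "j < Suc (2 * n)" and q: "q \<in> matching_perms n" by auto
    then have qp: "q permutes {0..<2 * n}" by (simp add: matching_perms_def)
    have "permutation_insert 0 j q permutes {0..<Suc (2 * n)}"
      using permutation_insert_permutes[OF qp, of 0 j] j by simp
    then have "(of_int (sign (perm_ins j q)) :: 'a) = (-1) ^ j * of_int (sign q)"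
      using signof_permutation_insert[of "permutation_insert 0 j q" "Suc (2 * n)" 0 0, where 'a = 'a]
        signof_permutation_insert[OF qp, of 0 j, where 'a = 'a] j by simp
    moreover have "(\<Prod>i<Suc n. B (perm_ins j q (2 * i)) (perm_ins j q (Suc (2 * i)))) =
      B 0 (Suc j) * (\<Prod>i<n. B (Suc (insert_index j (q (2 * i)))) (Suc (insert_index j (q (Suc (2 * i))))))"
      by (subst prod.lessThan_Suc_shift) (simp add: perm_ins_simps)
    ultimately show "(case x of (j, q) \<Rightarrow> ?t (Suc n) B (perm_ins j q)) =
      (case x of (j, q) \<Rightarrow> (-1) ^ j * B 0 (Suc j) *
        ?t n (\<lambda>a b. B (Suc (insert_index j a)) (Suc (insert_index j b))) q)"
      unfolding x split by (simp add: mult_ac del: prod.lessThan_Suc)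
  qed
  also have "\<dots> = (\<Sum>j<2 * n + 1. (-1) ^ j * B 0 (Suc j) *
     pfaffian_fun n (\<lambda>a b. B (Suc (insert_index j a)) (Suc (insert_index j b))))"
    unfolding sum.cartesian_product[symmetric] pfaffian_fun_def sum_distrib_left by (simp only: mult.assoc)
  finally show ?thesis .
qed

text \<open>The labelling \<open>g\<close> is arbitrary because removing a position relabels the
  remaining indices through \<open>insert_index\<close>; the induction hypothesis is applied to that
  relabelling.\<close>

lemma pf_eq_pfaffian_fun: "pf_list B (map g [0..<2 * n]) = pfaffian_fun n (\<lambda>a b. B (g a) (g b))"
proof (induction n arbitrary: g)
  case 0
  have "matching_perms 0 = {id}" by (auto simp: matching_perms_def)
  then show ?case by (simp add: pfaffian_fun_def sign_id)
next
  case (Suc n)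
  define ys where "ys = map (\<lambda>i. g (Suc i)) [0..<2 * n + 1]"
  have *: "map g [0..<2 * Suc n] = g 0 # ys"
    by (rule nth_equalityI) (auto simp: ys_def nth_Cons split: nat.split simp del: upt_Suc)
  have len: "length ys = 2 * n + 1" by (simp add: ys_def)
  have "remove_nth j ys = map (\<lambda>i. g (Suc (insert_index j i))) [0..<2 * n]" if "j < 2 * n + 1" for j
    using that by (intro nth_equalityI)
      (auto simp: len nth_remove_nth, auto simp: ys_def insert_index_def simp del: upt_Suc)
  moreover have "ys ! j = g (Suc j)" if "j < 2 * n + 1" for j
    using that by (simp add: ys_def del: upt_Suc)
  ultimately show ?case unfolding * by (simp add: len pfaffian_fun_Suc Suc.IH del: sum.lessThan_Suc)
qed

lemma pfaffian_eq_pf: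
  assumes "B \<in> carrier_mat (2 * n) (2 * n)"
  shows "pfaffian B = pf_list (\<lambda>i j. B $$ (i, j)) [0..<2 * n]"
proof -
  have "pfaffian B = pfaffian_fun n (\<lambda>i j. B $$ (i, j))"
    using assms by (simp add: pfaffian_def pfaffian_fun_def matching_perms_def Let_def)
  then show ?thesis using pf_eq_pfaffian_fun[of "\<lambda>i j. B $$ (i, j)" id n] by simp
qed

text \<open>Convergence off the diagonal suffices because a distinct list never reads a diagonal
  entry.\<close>

lemma tendsto_pf:
  fixes B :: "'b \<Rightarrow> 'e \<Rightarrow> 'e \<Rightarrow> real"
  assumes "\<And>x y. x \<in> set xs \<Longrightarrow> y \<in> set xs \<Longrightarrow> x \<noteq> y \<Longrightarrow> ((\<lambda>u. B u x y) \<longlongrightarrow> C x y) F" "distinct xs"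
  shows "((\<lambda>u. pf_list (B u) xs) \<longlongrightarrow> pf_list C xs) F"
  using assms
proof (induction "length xs" arbitrary: xs rule: less_induct)
  case less
  show ?case
  proof (cases xs)
    case (Cons x ys)
    have "((\<lambda>u. pf_list (B u) (remove_nth j ys)) \<longlongrightarrow> pf_list C (remove_nth j ys)) F" if "j < length ys" for j
      using that less.prems set_remove_nth_subset[of j ys] Cons
      by (intro less.hyps) (auto simp: subset_iff distinct_remove_nth)
    moreover have "((\<lambda>u. B u x (ys ! j)) \<longlongrightarrow> C x (ys ! j)) F" if "j < length ys" for j
      using that less.prems(2) Cons by (intro less.prems(1)) auto
    ultimately show ?thesis unfolding Cons pf_list.simps by (intro tendsto_sum tendsto_mult tendsto_const) auto
  qed simp
qed

text \<open>Every matching uses the index \<open>m\<close> exactly once, so the Pfaffian is linear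
  in the row and column of \<open>m\<close>. Differentiating it replaces these entries by their
  derivatives, and \<open>B'\<close> is the matrix after this replacement.\<close>

lemma has_derivative_pf:
  fixes B :: "real \<Rightarrow> 'e \<Rightarrow> 'e \<Rightarrow> real"
  assumes "distinct xs" "m \<in> set xs"
    and "\<And>v x y. x \<in> set xs \<Longrightarrow> y \<in> set xs \<Longrightarrow> x \<noteq> m \<Longrightarrow> y \<noteq> m \<Longrightarrow> B v x y = B' x y"
    and "\<And>y. y \<in> set xs \<Longrightarrow> y \<noteq> m \<Longrightarrow> ((\<lambda>v. B v m y) has_real_derivative B' m y) (at u)"
    and "\<And>y. y \<in> set xs \<Longrightarrow> y \<noteq> m \<Longrightarrow> ((\<lambda>v. B v y m) has_real_derivative B' y m) (at u)"
  shows "((\<lambda>v. pf_list (B v) xs) has_real_derivative pf_list B' xs) (at u)"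
  using assms
proof (induction "length xs" arbitrary: xs rule: less_induct)
  case less
  from less.prems(2) obtain x ys where Cons: "xs = x # ys" by (cases xs) auto
  have const: "pf_list (B v) (remove_nth j ys) = pf_list B' (remove_nth j ys)"
    if "j < length ys" "x = m \<or> ys ! j = m" for j v
    using that less.prems(1,3) set_remove_nth[of ys j] Cons by (intro pf_cong) auto
  have "((\<lambda>v. B v x (ys ! j) * pf_list (B v) (remove_nth j ys))
      has_real_derivative B' x (ys ! j) * pf_list B' (remove_nth j ys)) (at u)" if j: "j < length ys" for j
  proof -
    have jm: "ys ! j \<in> set ys" "ys ! j \<noteq> x" using j less.prems(1) Cons by auto
    consider "x = m" | "ys ! j = m" "x \<noteq> m" | "x \<noteq> m" "ys ! j \<noteq> m" by blast
    then show ?thesis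
    proof cases
      case 1
      then show ?thesis using const[OF j] less.prems(4)[of "ys ! j"] jm Cons
        by (auto intro!: DERIV_cmult_right)
    next
      case 2
      then show ?thesis using const[OF j] less.prems(5)[of x] jm Cons
        by (auto intro!: DERIV_cmult_right)
    next
      case 3
      have "((\<lambda>v. pf_list (B v) (remove_nth j ys)) has_real_derivative pf_list B' (remove_nth j ys)) (at u)"
        using less.prems Cons 3 j set_remove_nth[of ys j] by (intro less.hyps) (auto simp: distinct_remove_nth)
      moreover have "B v x (ys ! j) = B' x (ys ! j)" for v
        using less.prems(3)[of x "ys ! j"] 3 jm Cons by auto
      ultimately show ?thesis by (auto intro!: DERIV_cmult)
    qed
  qed
  then show ?case unfolding Cons pf_list.simps mult.assoc by (intro DERIV_sum DERIV_cmult) auto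
qed

section \<open>The Cauchy determinant\<close>

text \<open>The real Blaschke factor, that is, the pseudohyperbolic distance of \<open>s\<close> and
  \<open>t\<close> with the sign of \<open>s - t\<close>.\<close>

definition blaschke :: "real \<Rightarrow> real \<Rightarrow> real" where
  "blaschke s t = (s - t) / (1 - s * t)"

lemma one_minus_mult_pos:
  fixes s t :: real
  assumes "\<bar>s\<bar> < 1" "\<bar>t\<bar> < 1" shows "0 < 1 - s * t"
proof -
  have "\<bar>s * t\<bar> < 1" using assms abs_mult_less[of s 1 t 1] by (simp add: abs_mult)
  then show ?thesis by linarith
qed

lemma one_minus_square_pos: "\<bar>s\<bar> < 1 \<Longrightarrow> 0 < 1 - (s::real)\<^sup>2"
  using one_minus_mult_pos[of s s] by (simp add: power2_eq_square)

text \<open>The Schur complement of the Szego kernel at \<open>s\<close>: removing the part of the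
  covariance of \<open>f p\<close> and \<open>f q\<close> explained by \<open>f s\<close> multiplies
  it by two Blaschke factors. With denominators cleared it reads \<open>(s - p) * (s - q) + (1 -
  s\<^sup>2) * (1 - p * q) = (1 - s * p) * (1 - s * q)\<close>.\<close>

lemma blaschke_identity:
  assumes "\<bar>s\<bar> < 1" "\<bar>p\<bar> < 1" "\<bar>q\<bar> < 1"
  shows "blaschke p s * blaschke q s / (1 - p * q) + (1 - s\<^sup>2) / ((1 - s * p) * (1 - s * q)) = 1 / (1 - p * q)"
proof -
  define x a b c e where "x = (s - p) * (s - q)" and "a = 1 - s * p" and "b = 1 - s * q"
    and "c = 1 - p * q" and "e = 1 - s\<^sup>2"
  have pos: "a \<noteq> 0" "b \<noteq> 0" "c \<noteq> 0"
    using one_minus_mult_pos[of s p] one_minus_mult_pos[of s q] one_minus_mult_pos[of p q] assms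
    by (auto simp: a_def b_def c_def)
  have "x + e * c = a * b"
    by (simp add: x_def a_def b_def c_def e_def algebra_simps power2_eq_square)
  then have 1: "x / (a * b) / c + e / (a * b) = 1 / c"
    using pos by (simp add: field_simps)
  have 2: "x / (a * b) = blaschke p s * blaschke q s"
    by (simp add: x_def a_def b_def blaschke_def mult.commute minus_mult_minus[of "s - p" "s - q", symmetric])
  show ?thesis using 1 unfolding 2 unfolding a_def b_def c_def e_def .
qed

lemma blaschke_swap: "blaschke t s = - blaschke s t"
  by (simp add: blaschke_def mult.commute minus_divide_left)

text \<open>One step of Gaussian elimination: by \<open>blaschke_identity\<close>, the Schur
  complement of the corner entry is the smaller matrix scaled on both sides by the diagonal matrix
  of Blaschke factors.\<close>

lemma det_Sigma_mat_Suc: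
  assumes t: "\<And>i. i < Suc n \<Longrightarrow> \<bar>t i\<bar> < 1"
  shows "Determinant.det (Sigma_mat (Suc n) t) = 1 / (1 - (t 0)\<^sup>2) * (\<Prod>j<n. (blaschke (t 0) (t (Suc j)))\<^sup>2)
    * Determinant.det (Sigma_mat n (t \<circ> Suc))"
proof -
  define N where "N = Suc n"
  \<comment> \<open>The multiplier in column 0 is minus the quotient of the entries
    \<open>(i, 0)\<close> and \<open>(0, 0)\<close> of \<open>S\<close>, so that
    \<open>L * S\<close> has zeros below the corner.\<close>
  define L where "L = mat N N (\<lambda>(i, j). if i = j then 1
    else if j = 0 then - (1 - (t 0)\<^sup>2) / (1 - t 0 * t i) else (0::real))"
  define S where "S = Sigma_mat N t"
  define D where "D = mat_diag n (\<lambda>i. blaschke (t 0) (t (Suc i)))"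
  define M where "M = Sigma_mat n (t \<circ> Suc)"
  define A where "A = mat 1 1 (\<lambda>(i, j). 1 / (1 - (t 0)\<^sup>2))"
  define R where "R = mat 1 n (\<lambda>(i, j). 1 / (1 - t 0 * t (Suc j)))"
  have carr: "L \<in> carrier_mat N N" "S \<in> carrier_mat N N" "D \<in> carrier_mat n n" "M \<in> carrier_mat n n"
    "A \<in> carrier_mat 1 1" "R \<in> carrier_mat 1 n"
    by (simp_all add: L_def S_def D_def M_def A_def R_def Sigma_mat_def)
  have "Determinant.det L = prod_list (diag_mat L)"
    by (rule det_lower_triangular[OF _ carr(1)]) (auto simp: L_def)
  also have "diag_mat L = map (\<lambda>i. 1) [0..<N]" by (auto simp: diag_mat_def L_def)
  also have "prod_list (map (\<lambda>i. 1 :: real) xs) = 1" for xs :: "nat list" by (induction xs) auto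
  finally have detL: "Determinant.det L = 1" .
  have pos: "0 < 1 - t i * t j" if "i < N" "j < N" for i j
    using that t[of i] t[of j] one_minus_mult_pos by (simp add: N_def)
  have DMD: "D * M * D = mat n n (\<lambda>(i, j). blaschke (t 0) (t (Suc i)) * blaschke (t 0) (t (Suc j))
      / (1 - t (Suc i) * t (Suc j)))"
    using carr(3,4) unfolding D_def
    by (intro eq_matI) (auto simp: mat_diag_mult_left[of _ n n] mat_diag_mult_right[of _ n n] M_def Sigma_mat_def)
  have eq: "L * S = four_block_mat A R (0\<^sub>m n 1) (D * M * D)"
  proof (rule eq_matI)
    fix i j assume ij: "i < dim_row (four_block_mat A R (0\<^sub>m n 1) (D * M * D))"
      "j < dim_col (four_block_mat A R (0\<^sub>m n 1) (D * M * D))"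
    then have ij: "i < N" "j < N" using carr by (auto simp: N_def)
    have "(L * S) $$ (i, j) = (\<Sum>k<N. L $$ (i, k) * S $$ (k, j))"
      using carr ij by (simp add: scalar_prod_def atLeast0LessThan)
    also have "\<dots> = four_block_mat A R (0\<^sub>m n 1) (D * M * D) $$ (i, j)"
    proof (cases i)
      case 0
      have "(\<Sum>k<N. L $$ (i, k) * S $$ (k, j)) = (\<Sum>k<N. if k = 0 then S $$ (k, j) else 0)"
        using ij 0 by (intro sum.cong) (auto simp: L_def)
      also have "\<dots> = S $$ (0, j)" by (simp add: N_def)
      finally show ?thesis using ij 0
        by (cases j) (auto simp: S_def Sigma_mat_def A_def R_def N_def DMD power2_eq_square)
    next
      case (Suc i')
      have "(\<Sum>k<N. L $$ (i, k) * S $$ (k, j)) = (\<Sum>k\<in>{0, i}. L $$ (i, k) * S $$ (k, j))"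
        using ij Suc by (intro sum.mono_neutral_right) (auto simp: L_def)
      also have "\<dots> = 1 / (1 - t i * t j) - (1 - (t 0)\<^sup>2) / ((1 - t 0 * t i) * (1 - t 0 * t j))"
        using ij Suc by (simp add: L_def S_def Sigma_mat_def N_def minus_divide_left)
      also have "\<dots> = blaschke (t 0) (t i) * blaschke (t 0) (t j) / (1 - t i * t j)"
        using blaschke_identity[of "t 0" "t i" "t j"] t ij by (simp add: N_def blaschke_swap[of "t i"] blaschke_swap[of "t j"])
      also have "\<dots> = four_block_mat A R (0\<^sub>m n 1) (D * M * D) $$ (i, j)"
      proof (cases j)
        case 0
        then show ?thesis using ij Suc by (simp add: A_def R_def DMD N_def blaschke_def)
      next
        case (Suc j')
        then show ?thesis using ij \<open>i = Suc i'\<close>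
          by (simp add: A_def R_def DMD N_def)
      qed
      finally show ?thesis .
    qed
    finally show "(L * S) $$ (i, j) = four_block_mat A R (0\<^sub>m n 1) (D * M * D) $$ (i, j)" .
  qed (use carr in \<open>auto simp: N_def\<close>)
  have detD: "Determinant.det D = (\<Prod>j<n. blaschke (t 0) (t (Suc j)))"
  proof -
    have "Determinant.det D = prod_list (diag_mat D)"
      by (rule det_lower_triangular[OF _ carr(3)]) (auto simp: D_def mat_diag_def)
    also have "diag_mat D = map (\<lambda>i. blaschke (t 0) (t (Suc i))) [0..<n]" by (auto simp: diag_mat_def D_def mat_diag_def)
    finally show ?thesis by (simp add: prod.list_conv_set_nth atLeast0LessThan)
  qed
  have "Determinant.det S = Determinant.det (L * S)" using det_mult[OF carr(1,2)] detL by simp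
  also have "\<dots> = Determinant.det A * Determinant.det (D * M * D)"
    unfolding eq using carr by (intro det_four_block_mat_lower_left_zero_col) auto
  also have "Determinant.det (D * M * D) = Determinant.det D * Determinant.det M * Determinant.det D"
    using carr det_mult[of "D * M" n D] det_mult[of D n M] by (simp add: mult_carrier_mat)
  also have "Determinant.det A = 1 / (1 - (t 0)\<^sup>2)" using det_single[of A] carr(5) by (simp add: A_def)
  finally show ?thesis unfolding S_def M_def detD N_def
    by (simp add: power2_eq_square prod.distrib algebra_simps)
qed

text \<open>In this form of the Cauchy determinant every Blaschke factor is squared, so the square
  root is a product of absolute values of the factors that successive differentiations leave
  behind.\<close>

lemma det_Sigma_mat:
  assumes "\<And>i. i < n \<Longrightarrow> \<bar>t i\<bar> < 1"
  shows "Determinant.det (Sigma_mat n t) = (\<Prod>j<n. 1 / (1 - (t j)\<^sup>2) * (\<Prod>i<j. (blaschke (t i) (t j))\<^sup>2))"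
  using assms
proof (induction n arbitrary: t)
  case 0
  have "Sigma_mat 0 t = 1\<^sub>m 0" by (rule eq_matI) (auto simp: Sigma_mat_def)
  then show ?case by simp
next
  case (Suc n)
  have IH: "Determinant.det (Sigma_mat n (t \<circ> Suc)) = (\<Prod>j<n. 1 / (1 - (t (Suc j))\<^sup>2) * (\<Prod>i<j. (blaschke (t (Suc i)) (t (Suc j)))\<^sup>2))"
    using Suc.IH[of "t \<circ> Suc"] Suc.prems by (simp add: o_def)
  have "Determinant.det (Sigma_mat (Suc n) t) = 1 / (1 - (t 0)\<^sup>2)
      * (\<Prod>j<n. (blaschke (t 0) (t (Suc j)))\<^sup>2) * Determinant.det (Sigma_mat n (t \<circ> Suc))"
    by (rule det_Sigma_mat_Suc) (rule Suc.prems)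
  then show ?case unfolding IH prod.lessThan_Suc_shift by (simp add: prod.distrib prod_dividef mult_ac)
qed

section \<open>Uniqueness of characteristic functions in several variables\<close>

text \<open>The characteristic function at 0 is the total mass. Dividing both measures by this
  common mass reduces the claim to probability laws, unless the mass is zero.\<close>

lemma finite_measure_eqI_char:
  assumes fin: "finite_measure \<mu>" "finite_measure \<nu>" and sets: "sets \<mu> = sets borel" "sets \<nu> = sets borel"
    and char: "\<And>t. char \<mu> t = char \<nu> t"
  shows "\<mu> = (\<nu> :: real measure)"
proof -
  interpret \<mu>: finite_measure \<mu> by fact
  interpret \<nu>: finite_measure \<nu> by fact
  have space: "space \<mu> = UNIV" "space \<nu> = UNIV" using sets by (auto dest: sets_eq_imp_space_eq)
  define m where "m = measure \<mu> UNIV"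
  have m: "measure \<nu> UNIV = m"
    using char[of 0] space by (simp add: char_def m_def)
  show ?thesis
  proof (cases "m = 0")
    case True
    then have "emeasure \<mu> UNIV = 0" "emeasure \<nu> UNIV = 0"
      using m by (simp_all add: m_def \<mu>.emeasure_eq_measure \<nu>.emeasure_eq_measure)
    then have "emeasure \<mu> A = 0" "emeasure \<nu> A = 0" for A
      using emeasure_mono[of A UNIV \<mu>] emeasure_mono[of A UNIV \<nu>] sets by auto
    then show ?thesis using sets by (intro measure_eqI) auto
  next
    case False
    then have mpos: "m > 0" using m_def by (simp add: zero_less_measure_iff)
    define N where "N \<kappa> = density \<kappa> (\<lambda>_. ennreal (1 / m))" for \<kappa> :: "real measure"
    have em: "emeasure \<mu> UNIV = ennreal m" "emeasure \<nu> UNIV = ennreal m"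
      using m by (simp_all add: m_def \<mu>.emeasure_eq_measure \<nu>.emeasure_eq_measure)
    have rd: "real_distribution (N \<kappa>)" if "sets \<kappa> = sets borel" "emeasure \<kappa> UNIV = ennreal m" for \<kappa>
    proof -
      have [simp]: "space \<kappa> = UNIV" using that(1) by (auto dest: sets_eq_imp_space_eq)
      have "prob_space (N \<kappa>)"
        using that mpos by (intro prob_spaceI)
          (simp add: N_def emeasure_density_const ennreal_mult'[symmetric] flip: ennreal_1)
      then show ?thesis using that(1)
        by (simp add: real_distribution_def real_distribution_axioms_def N_def)
    qed
    have charN: "char (N \<kappa>) t = char \<kappa> t / m" if "sets \<kappa> = sets borel" for \<kappa> t
    proof -
      have [measurable_cong]: "sets \<kappa> = sets borel" by fact
      have "char (N \<kappa>) t = (\<integral>x. (1 / m) *\<^sub>R iexp (t * x) \<partial>\<kappa>)"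
        unfolding char_def N_def using mpos by (intro integral_density) auto
      then show ?thesis by (simp add: char_def scaleR_conv_of_real)
    qed
    have "N \<mu> = N \<nu>"
      using rd em sets charN char by (intro Levy_uniqueness ext) simp_all
    moreover have "\<kappa> = density (N \<kappa>) (\<lambda>_. ennreal m)" if "sets \<kappa> = sets borel" for \<kappa>
    proof -
      have "density (N \<kappa>) (\<lambda>_. ennreal m) = density \<kappa> (\<lambda>_. ennreal (1 / m) * ennreal m)"
        unfolding N_def by (rule density_density_eq) simp_all
      also have "ennreal (1 / m) * ennreal m = 1"
        using mpos by (simp add: ennreal_mult'[symmetric] flip: ennreal_1)
      finally show ?thesis by (simp add: density_1)
    qed
    ultimately show ?thesis using sets by metis
  qed
qed

text \<open>The weights become densities on the sample spaces, and the two finite measures on the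
  line are the images under \<open>X\<close> and \<open>Y\<close>. The bound 2 is the one met by
  \<open>1 + cos\<close> and \<open>1 + sin\<close>.\<close>

lemma weighted_char_unique:
  fixes X :: "'a \<Rightarrow> real" and Y :: "'b \<Rightarrow> real"
  assumes "prob_space M" "prob_space N"
  assumes [measurable]: "X \<in> borel_measurable M" "Y \<in> borel_measurable N"
    and [measurable]: "g \<in> borel_measurable M" "h \<in> borel_measurable N"
    and g: "\<And>x. 0 \<le> g x" "\<And>x. g x \<le> (2::real)" and h: "\<And>x. 0 \<le> h x" "\<And>x. h x \<le> (2::real)"
    and eq: "\<And>t. (\<integral>\<omega>. g \<omega> *\<^sub>R iexp (t * X \<omega>) \<partial>M) = (\<integral>\<omega>. h \<omega> *\<^sub>R iexp (t * Y \<omega>) \<partial>N)"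
    and A: "A \<in> sets borel"
  shows "(\<integral>\<omega>. g \<omega> * indicator A (X \<omega>) \<partial>M) = (\<integral>\<omega>. h \<omega> * indicator A (Y \<omega>) \<partial>N)"
proof -
  interpret M: prob_space M by fact
  interpret N: prob_space N by fact
  define \<mu> where "\<mu> = distr (density M g) borel X"
  define \<nu> where "\<nu> = distr (density N h) borel Y"
  have fin: "finite_measure (density P (\<lambda>x. ennreal (w x)))"
    if "prob_space P" "w \<in> borel_measurable P" "\<And>x. w x \<le> (2::real)" for P :: "'z measure" and w
  proof (rule finite_measureI)
    interpret P: prob_space P by fact
    have "emeasure (density P (\<lambda>x. ennreal (w x))) (space P) = (\<integral>\<^sup>+ x. ennreal (w x) * indicator (space P) x \<partial>P)"
      using that by (intro emeasure_density) auto
    also have "\<dots> \<le> (\<integral>\<^sup>+ x. ennreal 2 \<partial>P)"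
      using that(3) by (intro nn_integral_mono) (auto simp: indicator_def intro!: ennreal_leI simp del: ennreal_numeral)
    also have "\<dots> < \<infinity>" using P.emeasure_space_1 by simp
    finally show "emeasure (density P (\<lambda>x. ennreal (w x))) (space (density P (\<lambda>x. ennreal (w x)))) \<noteq> \<infinity>"
      by simp
  qed
  have "\<mu> = \<nu>"
  proof (rule finite_measure_eqI_char)
    show "finite_measure \<mu>" unfolding \<mu>_def
      using fin[OF \<open>prob_space M\<close>, of g] g by (intro finite_measure.finite_measure_distr) auto
    show "finite_measure \<nu>" unfolding \<nu>_def
      using fin[OF \<open>prob_space N\<close>, of h] h by (intro finite_measure.finite_measure_distr) auto
    show "char \<mu> t = char \<nu> t" for t
    proof -
      have "char \<mu> t = (\<integral>\<omega>. g \<omega> *\<^sub>R iexp (t * X \<omega>) \<partial>M)"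
        unfolding char_def \<mu>_def by (subst integral_distr, simp, simp, subst integral_density) (use g in auto)
      moreover have "char \<nu> t = (\<integral>\<omega>. h \<omega> *\<^sub>R iexp (t * Y \<omega>) \<partial>N)"
        unfolding char_def \<nu>_def by (subst integral_distr, simp, simp, subst integral_density) (use h in auto)
      ultimately show ?thesis using eq by simp
    qed
  qed (simp_all add: \<mu>_def \<nu>_def)
  then have "(\<integral>x. indicator A x \<partial>\<mu>) = (\<integral>x. indicator A x \<partial>\<nu> :: real)" by simp
  moreover have "(\<integral>x. indicator A x \<partial>\<mu> :: real) = (\<integral>\<omega>. g \<omega> * indicator A (X \<omega>) \<partial>M)"
    unfolding \<mu>_def using A by (subst integral_distr, simp, simp, subst integral_density) (use g in auto)
  moreover have "(\<integral>x. indicator A x \<partial>\<nu> :: real) = (\<integral>\<omega>. h \<omega> * indicator A (Y \<omega>) \<partial>N)"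
    unfolding \<nu>_def using A by (subst integral_distr, simp, simp, subst integral_density) (use h in auto)
  ultimately show ?thesis by simp
qed

lemma iexp_eq_Complex: "iexp x = Complex (cos x) (sin x)"
  by (simp add: cis_conv_exp[symmetric] complex_eq_iff)

lemma integrable_scaleR_iexp:
  assumes "prob_space P" "w \<in> borel_measurable P" "u \<in> borel_measurable P" "\<And>\<omega>. \<bar>w \<omega>\<bar> \<le> (c::real)"
  shows "integrable P (\<lambda>\<omega>. w \<omega> *\<^sub>R iexp (u \<omega>))"
proof -
  interpret P: prob_space P by fact
  show ?thesis using assms by (intro P.integrable_const_bound[of _ c]) auto
qed

text \<open>A trigonometric weight in \<open>C\<close> splits into characteristic integrals with
  frequencies 0, 1 and -1 in \<open>C\<close>, which are the ones under control in the
  application.\<close>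

lemma integral_trig_weight:
  assumes P: "prob_space P" and [measurable]: "p \<in> borel_measurable P" "C \<in> borel_measurable P" "Z \<in> borel_measurable P"
    and p: "\<And>\<omega>. \<bar>p \<omega>\<bar> \<le> (1::real)"
    and h: "\<And>x. complex_of_real (h x) = 1 + \<alpha> * iexp x + \<beta> * iexp (- x)"
  shows "(\<integral>\<omega>. (p \<omega> * h (C \<omega>)) *\<^sub>R iexp (t * Z \<omega>) \<partial>P) =
    (\<integral>\<omega>. p \<omega> *\<^sub>R iexp (t * Z \<omega> + 0 * C \<omega>) \<partial>P) +
    \<alpha> * (\<integral>\<omega>. p \<omega> *\<^sub>R iexp (t * Z \<omega> + 1 * C \<omega>) \<partial>P) +
    \<beta> * (\<integral>\<omega>. p \<omega> *\<^sub>R iexp (t * Z \<omega> + (-1) * C \<omega>) \<partial>P)"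
proof -
  define I where "I r \<omega> = p \<omega> *\<^sub>R iexp (t * Z \<omega> + r * C \<omega>)" for r \<omega>
  have int: "integrable P (I r)" for r
    unfolding I_def by (rule integrable_scaleR_iexp[OF P _ _ p]) measurable
  have "iexp (t * Z \<omega> + r * C \<omega>) = iexp (t * Z \<omega>) * iexp (r * C \<omega>)" for r \<omega>
    by (simp add: distrib_left exp_add)
  then have "I r \<omega> = p \<omega> *\<^sub>R (iexp (t * Z \<omega>) * iexp (r * C \<omega>))" for r \<omega>
    by (simp only: I_def)
  then have "(p \<omega> * h (C \<omega>)) *\<^sub>R iexp (t * Z \<omega>) = I 0 \<omega> + \<alpha> * I 1 \<omega> + \<beta> * I (-1) \<omega>" for \<omega>
    by (simp add: scaleR_conv_of_real h algebra_simps)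
  then have "(\<integral>\<omega>. (p \<omega> * h (C \<omega>)) *\<^sub>R iexp (t * Z \<omega>) \<partial>P) = (\<integral>\<omega>. I 0 \<omega> + \<alpha> * I 1 \<omega> + \<beta> * I (-1) \<omega> \<partial>P)"
    by presburger
  also have "\<dots> = (\<integral>\<omega>. I 0 \<omega> \<partial>P) + \<alpha> * (\<integral>\<omega>. I 1 \<omega> \<partial>P) + \<beta> * (\<integral>\<omega>. I (-1) \<omega> \<partial>P)"
    using int by simp
  finally show ?thesis unfolding I_def .
qed

text \<open>The weights \<open>1 + cos C\<close> and \<open>1 + sin C\<close> are nonnegative, so that Levy's uniqueness
  theorem for finite measures on the line applies with a complex factor \<open>exp (\<i> C)\<close> in place.\<close>

lemma weighted_char_indicator:
  fixes X C :: "'a \<Rightarrow> real" and Y D :: "'b \<Rightarrow> real"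
  assumes M: "prob_space M" and N: "prob_space N"
    and [measurable]: "X \<in> borel_measurable M" "C \<in> borel_measurable M" "p \<in> borel_measurable M"
    and [measurable]: "Y \<in> borel_measurable N" "D \<in> borel_measurable N" "q \<in> borel_measurable N"
    and p: "\<And>\<omega>. 0 \<le> p \<omega>" "\<And>\<omega>. p \<omega> \<le> 1" and q: "\<And>\<omega>. 0 \<le> q \<omega>" "\<And>\<omega>. q \<omega> \<le> 1"
    and eq: "\<And>t r. (\<integral>\<omega>. p \<omega> *\<^sub>R iexp (t * X \<omega> + r * C \<omega>) \<partial>M) = (\<integral>\<omega>. q \<omega> *\<^sub>R iexp (t * Y \<omega> + r * D \<omega>) \<partial>N)"
    and A [measurable]: "A \<in> sets borel"
  shows "(\<integral>\<omega>. (indicator A (X \<omega>) * p \<omega>) *\<^sub>R iexp (C \<omega>) \<partial>M) = (\<integral>\<omega>. (indicator A (Y \<omega>) * q \<omega>) *\<^sub>R iexp (D \<omega>) \<partial>N)"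
proof -
  have cos_iexp: "complex_of_real (1 + cos x) = 1 + 1 / 2 * iexp x + 1 / 2 * iexp (- x)"
    and sin_iexp: "complex_of_real (1 + sin x) = 1 + (- \<i> / 2) * iexp x + \<i> / 2 * iexp (- x)" for x
    unfolding iexp_eq_Complex by (simp_all add: complex_eq_iff)
  have abs: "\<bar>p \<omega>\<bar> \<le> 1" "\<bar>q \<omega>'\<bar> \<le> 1" for \<omega> \<omega>' using p q by (simp_all add: abs_of_nonneg)
  have bnd: "0 \<le> w * (1 + z)" "w * (1 + z) \<le> 2" if "0 \<le> w" "w \<le> 1" "\<bar>z\<bar> \<le> 1" for w z :: real
  proof -
    show "0 \<le> w * (1 + z)" using that by auto
    have "w * (1 + z) \<le> 1 * 2" using that by (intro mult_mono) auto
    then show "w * (1 + z) \<le> 2" by simp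
  qed
  have 1: "(\<integral>\<omega>. p \<omega> * (1 + cos (C \<omega>)) * indicator A (X \<omega>) \<partial>M) = (\<integral>\<omega>. q \<omega> * (1 + cos (D \<omega>)) * indicator A (Y \<omega>) \<partial>N)"
  proof (rule weighted_char_unique[OF M N])
    fix t
    show "(\<integral>\<omega>. (p \<omega> * (1 + cos (C \<omega>))) *\<^sub>R iexp (t * X \<omega>) \<partial>M) = (\<integral>\<omega>. (q \<omega> * (1 + cos (D \<omega>))) *\<^sub>R iexp (t * Y \<omega>) \<partial>N)"
      unfolding integral_trig_weight[where h = "\<lambda>x. 1 + cos x", OF M assms(5,4,3) abs(1) cos_iexp]
        integral_trig_weight[where h = "\<lambda>x. 1 + cos x", OF N assms(8,7,6) abs(2) cos_iexp] eq ..
  qed (use bnd[OF p abs_cos_le_one] bnd[OF q abs_cos_le_one] in auto)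
  have 2: "(\<integral>\<omega>. p \<omega> * (1 + sin (C \<omega>)) * indicator A (X \<omega>) \<partial>M) = (\<integral>\<omega>. q \<omega> * (1 + sin (D \<omega>)) * indicator A (Y \<omega>) \<partial>N)"
  proof (rule weighted_char_unique[OF M N])
    fix t
    show "(\<integral>\<omega>. (p \<omega> * (1 + sin (C \<omega>))) *\<^sub>R iexp (t * X \<omega>) \<partial>M) = (\<integral>\<omega>. (q \<omega> * (1 + sin (D \<omega>))) *\<^sub>R iexp (t * Y \<omega>) \<partial>N)"
      unfolding integral_trig_weight[where h = "\<lambda>x. 1 + sin x", OF M assms(5,4,3) abs(1) sin_iexp]
        integral_trig_weight[where h = "\<lambda>x. 1 + sin x", OF N assms(8,7,6) abs(2) sin_iexp] eq ..
  qed (use bnd[OF p abs_sin_le_one] bnd[OF q abs_sin_le_one] in auto)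
  have 3: "(\<integral>\<omega>. p \<omega> * indicator A (X \<omega>) \<partial>M) = (\<integral>\<omega>. q \<omega> * indicator A (Y \<omega>) \<partial>N)"
    using eq[of _ 0] p q by (intro weighted_char_unique M N A) (auto intro: order_trans[of _ 1])
  \<comment> \<open>Recovers the complex factor from nonnegative weights: \<open>iexp x\<close>
    equals \<open>(1 + cos x) + \<i> * (1 + sin x) - (1 + \<i>)\<close>.\<close>
  have split: "(\<integral>\<omega>. (indicator A (Z \<omega>) * w \<omega>) *\<^sub>R iexp (E \<omega>) \<partial>P) =
      complex_of_real (\<integral>\<omega>. w \<omega> * (1 + cos (E \<omega>)) * indicator A (Z \<omega>) \<partial>P) +
      \<i> * complex_of_real (\<integral>\<omega>. w \<omega> * (1 + sin (E \<omega>)) * indicator A (Z \<omega>) \<partial>P) -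
      (1 + \<i>) * complex_of_real (\<integral>\<omega>. w \<omega> * indicator A (Z \<omega>) \<partial>P)"
    if "prob_space P" and [measurable]: "w \<in> borel_measurable P" "Z \<in> borel_measurable P" "E \<in> borel_measurable P"
      and w: "\<And>\<omega>. 0 \<le> w \<omega>" "\<And>\<omega>. w \<omega> \<le> (1::real)"
    for P :: "'z measure" and w Z E
  proof -
    interpret P: prob_space P by fact
    have int: "integrable P (\<lambda>\<omega>. w \<omega> * (1 + z (E \<omega>)) * indicator A (Z \<omega>))"
      if [measurable]: "z \<in> borel_measurable borel" and "\<And>x. \<bar>z x\<bar> \<le> 1" for z :: "real \<Rightarrow> real"
    proof -
      have "\<bar>w \<omega> * (1 + z (E \<omega>))\<bar> \<le> 2" for \<omega>
        using bnd[OF w(1)[of \<omega>] w(2)[of \<omega>] that(2)[of "E \<omega>"]] by simp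
      then show ?thesis by (intro P.integrable_const_bound[of _ 2]) (auto simp: indicator_def intro!: AE_I2)
    qed
    have int': "integrable P (\<lambda>\<omega>. w \<omega> * indicator A (Z \<omega>))"
      using w by (intro P.integrable_const_bound[of _ 1]) (auto simp: abs_mult indicator_def intro!: AE_I2)
    have ic: "integrable P (\<lambda>\<omega>. complex_of_real (w \<omega> * (1 + cos (E \<omega>)) * indicator A (Z \<omega>)))"
      and isin: "integrable P (\<lambda>\<omega>. \<i> * complex_of_real (w \<omega> * (1 + sin (E \<omega>)) * indicator A (Z \<omega>)))"
      and ik: "integrable P (\<lambda>\<omega>. (1 + \<i>) * complex_of_real (w \<omega> * indicator A (Z \<omega>)))"
      using int[of cos] int[of sin] int' by (intro integrable_mult_right integrable_of_real; simp)+
    have "(indicator A (Z \<omega>) * w \<omega>) *\<^sub>R iexp (E \<omega>) =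
      complex_of_real (w \<omega> * (1 + cos (E \<omega>)) * indicator A (Z \<omega>)) +
      \<i> * complex_of_real (w \<omega> * (1 + sin (E \<omega>)) * indicator A (Z \<omega>)) -
      (1 + \<i>) * complex_of_real (w \<omega> * indicator A (Z \<omega>))" for \<omega>
      by (simp add: cis_conv_exp[symmetric] complex_eq_iff algebra_simps)
    then show ?thesis
      by (simp only: Bochner_Integration.integral_diff[OF Bochner_Integration.integrable_add[OF ic isin] ik]
        Bochner_Integration.integral_add[OF ic isin] integral_mult_right_zero integral_complex_of_real)
  qed
  show ?thesis unfolding split[OF M assms(5,3,4) p] split[OF N assms(8,6,7) q] 1 2 3 ..
qed

text \<open>Uniqueness in several variables is obtained one coordinate at a time: each induction
  step moves one coordinate from the exponent into an indicator, with the remaining coordinates kept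
  as an oscillating factor.\<close>

lemma char_rectangles:
  fixes X :: "'i \<Rightarrow> 'a \<Rightarrow> real" and Y :: "'i \<Rightarrow> 'b \<Rightarrow> real"
  assumes M: "prob_space M" and N: "prob_space N"
    and X [measurable]: "\<And>i. i \<in> J \<Longrightarrow> X i \<in> borel_measurable M"
    and Y [measurable]: "\<And>i. i \<in> J \<Longrightarrow> Y i \<in> borel_measurable N"
    and "finite J"
    and char: "\<And>\<theta>. (\<integral>\<omega>. iexp (\<Sum>i\<in>J. \<theta> i * X i \<omega>) \<partial>M) = (\<integral>\<omega>. iexp (\<Sum>i\<in>J. \<theta> i * Y i \<omega>) \<partial>N)"
    and A: "\<And>i. i \<in> J \<Longrightarrow> A i \<in> sets borel"
    and I: "I \<subseteq> J"
  shows "(\<integral>\<omega>. (\<Prod>i\<in>I. indicator (A i) (X i \<omega>)) *\<^sub>R iexp (\<Sum>i\<in>J-I. \<theta> i * X i \<omega>) \<partial>M)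
       = (\<integral>\<omega>. (\<Prod>i\<in>I. indicator (A i) (Y i \<omega>)) *\<^sub>R iexp (\<Sum>i\<in>J-I. \<theta> i * Y i \<omega>) \<partial>N)"
proof -
  have "finite I" using I \<open>finite J\<close> finite_subset by blast
  then show ?thesis using I
  proof (induction I arbitrary: \<theta>)
    case empty
    then show ?case using char by simp
  next
    case (insert i I)
    define K where "K = J - insert i I"
    have JI: "J - I = insert i K" "i \<notin> K" "i \<in> J" "finite K" "K \<subseteq> J" "I \<subseteq> J"
      using insert \<open>finite J\<close> by (auto simp: K_def)
    \<comment> \<open>The coordinate to be moved gets a free frequency \<open>t\<close> and the
      others are scaled by \<open>r\<close>. The induction hypothesis for these frequencies is the
      two-parameter identity that \<open>weighted_char_indicator\<close> asks for.\<close>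
    have sum: "(\<Sum>k\<in>J-I. (if k = i then t else r * \<theta> k) * z k) = t * z i + r * (\<Sum>k\<in>K. \<theta> k * z k)"
      for t r :: real and z
    proof -
      have "(\<Sum>k\<in>K. (if k = i then t else r * \<theta> k) * z k) = (\<Sum>k\<in>K. r * (\<theta> k * z k))"
        using JI(2) by (intro sum.cong) auto
      then show ?thesis using JI by (simp add: sum_distrib_left)
    qed
    have meas: "(\<lambda>\<omega>. (\<Prod>i\<in>I. indicator (A i) (X i \<omega>)) :: real) \<in> borel_measurable M"
      "(\<lambda>\<omega>. (\<Prod>i\<in>I. indicator (A i) (Y i \<omega>)) :: real) \<in> borel_measurable N"
      using JI(6) A by (intro borel_measurable_prod borel_measurable_indicator'; force)+
    have meas': "(\<lambda>\<omega>. \<Sum>k\<in>K. \<theta> k * X k \<omega>) \<in> borel_measurable M" "(\<lambda>\<omega>. \<Sum>k\<in>K. \<theta> k * Y k \<omega>) \<in> borel_measurable N"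
      using JI(5) by (auto intro!: borel_measurable_sum borel_measurable_times X Y)
    show ?case
      unfolding K_def[symmetric] prod.insert[OF insert.hyps]
    proof (rule weighted_char_indicator[OF M N X[OF JI(3)] meas'(1) meas(1) Y[OF JI(3)] meas'(2) meas(2)])
      fix t r
      show "(\<integral>\<omega>. (\<Prod>i\<in>I. indicator (A i) (X i \<omega>)) *\<^sub>R iexp (t * X i \<omega> + r * (\<Sum>k\<in>K. \<theta> k * X k \<omega>)) \<partial>M) =
        (\<integral>\<omega>. (\<Prod>i\<in>I. indicator (A i) (Y i \<omega>)) *\<^sub>R iexp (t * Y i \<omega> + r * (\<Sum>k\<in>K. \<theta> k * Y k \<omega>)) \<partial>N)"
        using insert.IH[of "\<lambda>k. if k = i then t else r * \<theta> k"] JI(6) unfolding sum by simp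
    qed (use A JI in \<open>auto intro!: prod_nonneg prod_le_1\<close>)
  qed
qed

text \<open>With all coordinates moved into indicators, \<open>char_rectangles\<close> says that
  both laws agree on measurable boxes, and these determine a finite measure on the product
  space.\<close>

lemma distr_PiM_eqI_char:
  fixes X :: "'i \<Rightarrow> 'a \<Rightarrow> real" and Y :: "'i \<Rightarrow> 'b \<Rightarrow> real"
  assumes M: "prob_space M" and N: "prob_space N"
    and X [measurable]: "\<And>i. i \<in> J \<Longrightarrow> X i \<in> borel_measurable M"
    and Y [measurable]: "\<And>i. i \<in> J \<Longrightarrow> Y i \<in> borel_measurable N"
    and J: "finite J"
    and char: "\<And>\<theta>. (\<integral>\<omega>. iexp (\<Sum>i\<in>J. \<theta> i * X i \<omega>) \<partial>M) = (\<integral>\<omega>. iexp (\<Sum>i\<in>J. \<theta> i * Y i \<omega>) \<partial>N)"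
  shows "distr M (PiM J (\<lambda>_. borel)) (\<lambda>\<omega>. \<lambda>i\<in>J. X i \<omega>) = distr N (PiM J (\<lambda>_. borel)) (\<lambda>\<omega>. \<lambda>i\<in>J. Y i \<omega>)"
    (is "?P = ?Q")
proof (rule measure_eqI_PiM_finite[where M = "\<lambda>_. borel"])
  interpret M: prob_space M by fact
  interpret N: prob_space N by fact
  note prob_MN = M N
  have mX: "(\<lambda>\<omega>. \<lambda>i\<in>J. X i \<omega>) \<in> measurable M (PiM J (\<lambda>_. borel))"
    and mY: "(\<lambda>\<omega>. \<lambda>i\<in>J. Y i \<omega>) \<in> measurable N (PiM J (\<lambda>_. borel))"
    using X Y by (auto intro!: measurable_restrict)
  show "emeasure ?P (Pi\<^sub>E J A) = emeasure ?Q (Pi\<^sub>E J A)" if A: "\<And>i. i \<in> J \<Longrightarrow> A i \<in> sets borel" for A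
  proof -
    have box: "Pi\<^sub>E J A \<in> sets (PiM J (\<lambda>_. borel))" using J A by (intro sets_PiM_I_finite)
    have em: "emeasure (distr P (PiM J (\<lambda>_. borel)) (\<lambda>\<omega>. \<lambda>i\<in>J. Z i \<omega>)) (Pi\<^sub>E J A)
        = ennreal (\<integral>\<omega>. (\<Prod>i\<in>J. indicator (A i) (Z i \<omega>)) \<partial>P)"
      if "prob_space P" and m: "(\<lambda>\<omega>. \<lambda>i\<in>J. Z i \<omega>) \<in> measurable P (PiM J (\<lambda>_. borel))"
      for P :: "'z measure" and Z :: "'i \<Rightarrow> 'z \<Rightarrow> real"
    proof -
      interpret P: prob_space P by fact
      let ?E = "(\<lambda>\<omega>. \<lambda>i\<in>J. Z i \<omega>) -` Pi\<^sub>E J A \<inter> space P"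
      have "emeasure (distr P (PiM J (\<lambda>_. borel)) (\<lambda>\<omega>. \<lambda>i\<in>J. Z i \<omega>)) (Pi\<^sub>E J A) = emeasure P ?E"
        by (rule emeasure_distr[OF m box])
      also have "\<dots> = ennreal (\<integral>\<omega>. indicator ?E \<omega> \<partial>P)"
        by (simp add: P.emeasure_eq_measure)
      also have "(\<integral>\<omega>. indicator ?E \<omega> \<partial>P :: real) = (\<integral>\<omega>. (\<Prod>i\<in>J. indicator (A i) (Z i \<omega>)) \<partial>P)"
      proof (intro Bochner_Integration.integral_cong refl)
        fix \<omega> assume "\<omega> \<in> space P"
        show "indicator ?E \<omega> = (\<Prod>i\<in>J. indicator (A i) (Z i \<omega>) :: real)"
        proof (cases "\<forall>i\<in>J. Z i \<omega> \<in> A i")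
          case True
          then show ?thesis using \<open>\<omega> \<in> space P\<close> by (auto simp: indicator_def)
        next
          case False
          then have "(\<Prod>i\<in>J. indicator (A i) (Z i \<omega>) :: real) = 0" using J by (intro prod_zero) (auto simp: indicator_def)
          then show ?thesis using False by (auto simp: indicator_def restrict_PiE_iff Pi_iff)
        qed
      qed
      finally show ?thesis .
    qed
    have "(\<integral>\<omega>. (\<Prod>i\<in>J. indicator (A i) (X i \<omega>)) *\<^sub>R (1::complex) \<partial>M) = (\<integral>\<omega>. (\<Prod>i\<in>J. indicator (A i) (Y i \<omega>)) *\<^sub>R (1::complex) \<partial>N)"
      using char_rectangles[of M N J X Y A J, OF prob_MN X Y J char A] by simp
    then have "(\<integral>\<omega>. (\<Prod>i\<in>J. indicator (A i) (X i \<omega>)) \<partial>M) = (\<integral>\<omega>. (\<Prod>i\<in>J. indicator (A i) (Y i \<omega>)) \<partial>N :: real)"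
      by (simp add: scaleR_conv_of_real del: of_real_prod)
    then show ?thesis using em[OF M mX] em[OF N mY] by simp
  qed
  define E where "E = (\<lambda>n::nat. space (PiM J (\<lambda>_::'i. borel :: real measure)))"
  show "range E \<subseteq> prod_algebra J (\<lambda>_. borel)" "(\<Union>i. E i) = space (PiM J (\<lambda>_. borel))"
    by (auto simp: E_def space_PiM intro!: prod_algebraI_finite J)
  show "emeasure ?P (E i) \<noteq> \<infinity>" for i
    using M.prob_space_distr[OF mX] prob_space.emeasure_space_1[of ?P] by (simp add: E_def)
qed (use J in auto)

section \<open>Increments of signs against a Gaussian variable\<close>

abbreviation stdN :: "real measure" where "stdN \<equiv> std_normal_distribution"

text \<open>Up to a null set the integrand is 2 or -2, with the sign of \<open>w\<close>, on the
  interval between \<open>- w\<close> and 0, and vanishes elsewhere.\<close>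

lemma has_bochner_integral_sgn_shift:
  "has_bochner_integral lborel (\<lambda>x::real. sgn (x + w) - sgn x) (2 * w)"
proof -
  have AE: "AE x in lborel. x \<noteq> 0 \<and> x \<noteq> - w" using AE_lborel_singleton[of 0] AE_lborel_singleton[of "- w"] by auto
  show ?thesis
  proof (cases "w \<ge> 0")
    case True
    have "has_bochner_integral lborel (\<lambda>x. 2 * indicator {-w<..<0} x :: real) (2 * measure lborel {-w<..<0})"
      using True by (intro has_bochner_integral_mult_right has_bochner_integral_real_indicator) auto
    moreover have "AE x in lborel. (sgn (x + w) - sgn x) = 2 * indicator {-w<..<0} x"
      using AE by eventually_elim (use True in \<open>auto simp: sgn_if indicator_def\<close>)
    ultimately show ?thesis using True by (subst has_bochner_integral_cong_AE) auto
  next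
    case False
    have "has_bochner_integral lborel (\<lambda>x. (-2) * indicator {0<..<-w} x :: real) ((-2) * measure lborel {0<..<-w})"
      using False by (intro has_bochner_integral_mult_right has_bochner_integral_real_indicator) auto
    moreover have "AE x in lborel. (sgn (x + w) - sgn x) = (-2) * indicator {0<..<-w} x"
      using AE by eventually_elim (use False in \<open>auto simp: sgn_if indicator_def\<close>)
    ultimately show ?thesis using False by (subst has_bochner_integral_cong_AE) auto
  qed
qed

lemma sgn_shift_bound:
  fixes x w b :: real
  assumes "\<bar>w\<bar> \<le> b" shows "\<bar>sgn (x + w) - sgn x\<bar> \<le> 2 * indicator {-b..b} x"
  using assms by (auto simp: sgn_if indicator_def abs_if split: if_splits)

lemma std_normal_density_le: "std_normal_density x \<le> 1 / sqrt (2 * pi)"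
  unfolding std_normal_density_def by (intro mult_left_le) auto

lemma tendsto_std_normal_density: "(h \<longlongrightarrow> l) F \<Longrightarrow> ((\<lambda>i. std_normal_density (h i)) \<longlongrightarrow> std_normal_density l) F"
  unfolding std_normal_density_def by (intro tendsto_intros) auto

text \<open>Substituting \<open>z = h x\<close> turns the difference quotient into an integral over the bounded
  range \<open>\<bar>x\<bar> \<le> B\<close>, on which dominated convergence applies.\<close>

lemma sgn_increment_inner_limit:
  fixes h w :: "nat \<Rightarrow> real" and g :: "nat \<Rightarrow> real \<Rightarrow> real"
  assumes h: "\<And>i. h i \<noteq> 0" "h \<longlonglongrightarrow> 0" and w: "w \<longlonglongrightarrow> w0" "\<And>i. \<bar>w i\<bar> \<le> b"
    and g: "\<And>x. (\<lambda>i. g i (h i * x)) \<longlonglongrightarrow> g0" "\<And>i x. \<bar>x\<bar> \<le> b \<Longrightarrow> \<bar>g i (h i * x)\<bar> \<le> c"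
    and [measurable]: "\<And>i. g i \<in> borel_measurable borel"
  shows "(\<lambda>i. 1 / h i * (\<integral>z. (sgn (z + h i * w i) - sgn z) * g i z \<partial>stdN))
      \<longlonglongrightarrow> sqrt (2 / pi) * (w0 * g0)" (is "?lim")
    and "\<bar>1 / h i * (\<integral>z. (sgn (z + h i * w i) - sgn z) * g i z \<partial>stdN)\<bar> \<le> 4 * (b * c)" (is "?bound")
proof -
  define K where "K i x = std_normal_density (h i * x) * ((sgn (x + w i) - sgn x) * g i (h i * x))" for i x
  have [measurable]: "K i \<in> borel_measurable borel" for i unfolding K_def by measurable
  have b: "0 \<le> b" using w(2)[of 0] by linarith
  have c: "0 \<le> c" using g(2)[of 0 0] b by (auto intro: order_trans[OF abs_ge_zero])
  have eq: "1 / h i * (\<integral>z. (sgn (z + h i * w i) - sgn z) * g i z \<partial>stdN) = (\<integral>x. K i x \<partial>lborel)" for i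
  proof -
    have "(\<integral>z. (sgn (z + h i * w i) - sgn z) * g i z \<partial>stdN)
        = (\<integral>z. std_normal_density z * ((sgn (z + h i * w i) - sgn z) * g i z) \<partial>lborel)"
      by (subst integral_density) auto
    also have "\<dots> = \<bar>h i\<bar> * (\<integral>x. std_normal_density (h i * x) * ((sgn (h i * x + h i * w i) - sgn (h i * x)) * g i (h i * x)) \<partial>lborel)"
      using lborel_integral_real_affine[of "h i" "\<lambda>z. std_normal_density z * ((sgn (z + h i * w i) - sgn z) * g i z)" 0] h(1) by simp
    \<comment> \<open>The sign of \<open>h i\<close>, pulled out of both \<open>sgn\<close> terms,
      combines with the factor \<open>\<bar>h i\<bar>\<close> of the substitution to
      \<open>h i\<close> itself, which cancels the difference quotient for either sign.\<close>
    also have "\<dots> = \<bar>h i\<bar> * (\<integral>x. sgn (h i) * K i x \<partial>lborel)"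
    proof -
      have "sgn (h i * x + h i * w i) - sgn (h i * x) = sgn (h i) * (sgn (x + w i) - sgn x)" for x
        by (simp add: sgn_mult right_diff_distrib flip: distrib_left)
      then show ?thesis by (simp add: K_def mult_ac)
    qed
    finally show ?thesis using h(1)[of i] by (simp add: sgn_if abs_if)
  qed
  define D where "D x = (2 * c) * indicator {-b..b} x" for x :: real
  have intD: "integrable lborel D" "(\<integral>x. D x \<partial>lborel) = 4 * (b * c)"
    using b unfolding D_def by (auto intro!: integrable_mult_right)
  have d1: "std_normal_density x \<le> 1" for x
  proof -
    have "1 \<le> sqrt (2 * pi)" using pi_ge_two by simp
    then show ?thesis using std_normal_density_le[of x] by (simp add: divide_le_eq order_trans)
  qed
  have KD: "\<bar>K i x\<bar> \<le> D x" for i x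
  proof (cases "\<bar>x\<bar> \<le> b")
    case True
    have "\<bar>K i x\<bar> \<le> 1 * (2 * c)"
      unfolding K_def abs_mult using sgn_shift_bound[OF w(2), of x i] True g(2)[of x i] d1[of "h i * x"] c
      by (intro mult_mono mult_nonneg_nonneg) (auto simp: abs_le_iff)
    then show ?thesis using True by (auto simp: D_def abs_le_iff)
  next
    case False
    then have "sgn (x + w i) - sgn x = 0"
      using sgn_shift_bound[OF w(2), of x i] by (auto simp: indicator_def abs_le_iff)
    then show ?thesis using c by (simp add: K_def D_def)
  qed
  have "(\<lambda>i. \<integral>x. K i x \<partial>lborel) \<longlonglongrightarrow> (\<integral>x. std_normal_density 0 * ((sgn (x + w0) - sgn x) * g0) \<partial>lborel)"
  proof (rule integral_dominated_convergence[where w = D])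
    have "AE x in lborel. x \<noteq> - w0" by (rule AE_lborel_singleton)
    then show "AE x in lborel. (\<lambda>i. K i x) \<longlonglongrightarrow> std_normal_density 0 * ((sgn (x + w0) - sgn x) * g0)"
    proof eventually_elim
      case (elim x)
      have "(\<lambda>i. h i * x) \<longlonglongrightarrow> 0" using tendsto_mult_right[OF h(2), of x] by simp
      moreover have "x + w0 \<noteq> 0" using elim by linarith
      ultimately show ?case unfolding K_def
        by (intro tendsto_mult tendsto_diff tendsto_std_normal_density tendsto_sgn tendsto_add tendsto_const w(1) g(1))
    qed
  qed (use intD(1) KD in auto)
  also have "(\<integral>x. std_normal_density 0 * ((sgn (x + w0) - sgn x) * g0) \<partial>lborel) = std_normal_density 0 * ((2 * w0) * g0)"
    using has_bochner_integral_integral_eq[OF has_bochner_integral_sgn_shift[of w0]] by simp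
  \<comment> \<open>The jump 2 of the sign times the standard normal density
    \<open>1 / sqrt (2 * pi)\<close> at 0.\<close>
  also have "\<dots> = sqrt (2 / pi) * (w0 * g0)"
    by (simp add: std_normal_density_def real_sqrt_mult real_sqrt_divide field_simps)
  finally show ?lim unfolding eq .
  have "norm (\<integral>x. K i x \<partial>lborel) \<le> (\<integral>x. D x \<partial>lborel)"
  proof -
    have "norm (K i x) \<le> norm (D x)" for x using KD[of i x] by simp
    then have "integrable lborel (K i)"
      by (intro Bochner_Integration.integrable_bound[OF intD(1)] AE_I2) simp_all
    then have "(\<integral>x. norm (K i x) \<partial>lborel) \<le> (\<integral>x. D x \<partial>lborel)"
      using KD intD(1) by (intro integral_mono) auto
    then show ?thesis by (rule order_trans[OF integral_norm_bound])
  qed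
  then show ?bound unfolding eq intD(2) real_norm_def .
qed

text \<open>For fixed \<open>\<omega>\<close> this is the one-dimensional limit in \<open>z\<close>;
  Fubini and dominated convergence integrate it over \<open>M\<close>. \<open>B\<close> bounds the
  increments and hence the relevant range of the rescaled variable, \<open>C\<close> bounds
  \<open>G\<close> on that range, and the inner integrals are then at most
  \<open>4 * (B \<omega> * C \<omega>)\<close>.\<close>

lemma sgn_increment_limit:
  fixes h :: "nat \<Rightarrow> real" and W :: "nat \<Rightarrow> 'a \<Rightarrow> real" and G :: "nat \<Rightarrow> 'a \<Rightarrow> real \<Rightarrow> real"
  assumes "prob_space M"
    and h: "\<And>i. h i \<noteq> 0" "h \<longlonglongrightarrow> 0"
    and W [measurable]: "\<And>i. W i \<in> borel_measurable M" "W0 \<in> borel_measurable M"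
    and G [measurable]: "\<And>i. case_prod (G i) \<in> borel_measurable (M \<Otimes>\<^sub>M borel)" "G0 \<in> borel_measurable M"
    and int: "\<And>i. integrable (M \<Otimes>\<^sub>M stdN) (case_prod (G i))"
    and AE_W: "AE \<omega> in M. (\<lambda>i. W i \<omega>) \<longlonglongrightarrow> W0 \<omega>" "AE \<omega> in M. \<forall>i. \<bar>W i \<omega>\<bar> \<le> B \<omega>"
    and AE_G: "AE \<omega> in M. \<forall>x. (\<lambda>i. G i \<omega> (h i * x)) \<longlonglongrightarrow> G0 \<omega>"
      "AE \<omega> in M. \<forall>i x. \<bar>x\<bar> \<le> B \<omega> \<longrightarrow> \<bar>G i \<omega> (h i * x)\<bar> \<le> C \<omega>"
    and BC: "integrable M (\<lambda>\<omega>. B \<omega> * C \<omega>)"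
  shows "(\<lambda>i. 1 / h i * (\<integral>(\<omega>, z). (sgn (z + h i * W i \<omega>) - sgn z) * G i \<omega> z \<partial>(M \<Otimes>\<^sub>M stdN)))
    \<longlonglongrightarrow> sqrt (2 / pi) * (\<integral>\<omega>. W0 \<omega> * G0 \<omega> \<partial>M)"
proof -
  interpret M: prob_space M by fact
  interpret N: prob_space stdN by (rule prob_space_normal_density)  simp
  interpret P: pair_prob_space M stdN ..
  define L where "L i \<omega> = 1 / h i * (\<integral>z. (sgn (z + h i * W i \<omega>) - sgn z) * G i \<omega> z \<partial>stdN)" for i \<omega>
  have G' [measurable]: "case_prod (G i) \<in> borel_measurable (M \<Otimes>\<^sub>M stdN)" for i
    using G(1)[of i] by (simp cong: measurable_cong_sets sets_pair_measure_cong)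
  have G1: "G i \<omega> \<in> borel_measurable borel" if "\<omega> \<in> space M" for i \<omega>
    using measurable_Pair2[OF G(1)[of i] that] by simp
  have LM [measurable]: "L i \<in> borel_measurable M" for i
    unfolding L_def by measurable
  have int': "integrable (M \<Otimes>\<^sub>M stdN) (\<lambda>(\<omega>, z). (sgn (z + h i * W i \<omega>) - sgn z) * G i \<omega> z)" for i
  proof (rule Bochner_Integration.integrable_bound)
    show "integrable (M \<Otimes>\<^sub>M stdN) (\<lambda>x. 2 * case_prod (G i) x)" using int by simp
    have "\<bar>sgn (a::real) - sgn b\<bar> * \<bar>c\<bar> \<le> 2 * \<bar>c\<bar>" for a b c :: real
      by (intro mult_right_mono) (auto simp: sgn_if)
    then show "AE x in M \<Otimes>\<^sub>M stdN.
      norm (case x of (\<omega>, z) \<Rightarrow> (sgn (z + h i * W i \<omega>) - sgn z) * G i \<omega> z) \<le> norm (2 * case_prod (G i) x)"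
      by (auto simp: abs_mult intro!: AE_I2)
  qed measurable
  have eq: "1 / h i * (\<integral>(\<omega>, z). (sgn (z + h i * W i \<omega>) - sgn z) * G i \<omega> z \<partial>(M \<Otimes>\<^sub>M stdN)) = (\<integral>\<omega>. L i \<omega> \<partial>M)" for i
    unfolding L_def using P.integral_fst'[OF int'[of i]] by simp
  have "(\<lambda>i. \<integral>\<omega>. L i \<omega> \<partial>M) \<longlonglongrightarrow> (\<integral>\<omega>. sqrt (2 / pi) * (W0 \<omega> * G0 \<omega>) \<partial>M)"
  proof (rule integral_dominated_convergence[where w = "\<lambda>\<omega>. 4 * (B \<omega> * C \<omega>)"])
    show "AE \<omega> in M. (\<lambda>i. L i \<omega>) \<longlonglongrightarrow> sqrt (2 / pi) * (W0 \<omega> * G0 \<omega>)"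
      using AE_W AE_G AE_space
    proof eventually_elim
      case (elim \<omega>)
      then show ?case unfolding L_def
        by (intro sgn_increment_inner_limit(1)[where b = "B \<omega>" and c = "C \<omega>"] h) (auto intro: G1)
    qed
    show "AE \<omega> in M. norm (L i \<omega>) \<le> 4 * (B \<omega> * C \<omega>)" for i
      using AE_W AE_G AE_space
    proof eventually_elim
      case (elim \<omega>)
      then show ?case unfolding L_def real_norm_def
        by (intro sgn_increment_inner_limit(2)[where ?w0.0 = "W0 \<omega>" and ?g0.0 = "G0 \<omega>"] h) (auto intro: G1)
    qed
  qed (use BC in auto)
  then show ?thesis unfolding eq by simp
qed

section \<open>Translation of a standard normal variable\<close>

lemma has_derivative_std_normal_density_shift:
  "((\<lambda>x. std_normal_density (z - x)) has_real_derivative (z - x) * std_normal_density (z - x)) (at x)"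
proof -
  have "((\<lambda>x. c * exp (- (z - x)\<^sup>2 / 2)) has_real_derivative (z - x) * (c * exp (- (z - x)\<^sup>2 / 2))) (at x)" for c
    by (rule derivative_eq_intros refl | simp)+
  then show ?thesis unfolding std_normal_density_def .
qed

text \<open>By the mean value theorem the difference is \<open>\<eta>\<close> times
  \<open>(z - \<xi>) * std_normal_density (z - \<xi>)\<close> with
  \<open>\<bar>\<xi>\<bar> \<le> 1\<close>. A normal density of variance 2 dominates this uniformly
  in \<open>\<xi>\<close>, which gives an integrable majorant for the difference quotients.\<close>

lemma std_normal_density_diff_bound:
  assumes "\<bar>\<eta>\<bar> \<le> 1"
  shows "\<bar>std_normal_density (z - \<eta>) - std_normal_density z\<bar> \<le> \<bar>\<eta>\<bar> * (4 * ((\<bar>z\<bar> + 1) * normal_density 0 (sqrt 2) z))"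
proof -
  have "\<exists>\<xi>. \<bar>\<xi>\<bar> \<le> 1 \<and> std_normal_density (z - \<eta>) - std_normal_density z = \<eta> * ((z - \<xi>) * std_normal_density (z - \<xi>))"
  proof -
    note der = has_derivative_std_normal_density_shift[of z]
    consider "\<eta> = 0" | "\<eta> > 0" | "\<eta> < 0" by linarith
    then show ?thesis
    proof cases
      case 1
      then show ?thesis by (auto intro: exI[of _ 0])
    next
      case 2
      obtain x where "0 < x" "x < \<eta>" "std_normal_density (z - \<eta>) - std_normal_density (z - 0) = (\<eta> - 0) * ((z - x) * std_normal_density (z - x))"
        using MVT2[OF 2 der] by blast
      then show ?thesis using assms by (intro exI[of _ x]) auto
    next
      case 3
      obtain x where "\<eta> < x" "x < 0" "std_normal_density (z - 0) - std_normal_density (z - \<eta>) = (0 - \<eta>) * ((z - x) * std_normal_density (z - x))"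
        using MVT2[OF 3 der] by blast
      then show ?thesis using assms by (intro exI[of _ x]) auto
    qed
  qed
  then obtain \<xi> where \<xi>: "\<bar>\<xi>\<bar> \<le> 1"
    and eq: "std_normal_density (z - \<eta>) - std_normal_density z = \<eta> * ((z - \<xi>) * std_normal_density (z - \<xi>))" by blast
  have "std_normal_density (z - \<xi>) \<le> 4 * normal_density 0 (sqrt 2) z"
  proof -
    \<comment> \<open>Completing the square gives
      \<open>(z - \<xi>)\<^sup>2 \<ge> z\<^sup>2 / 2 - 1\<close>. The constant 4 collects the bound
      2 for \<open>exp (1 / 2)\<close> and the bound 2 for the ratio \<open>sqrt 2\<close> of the
      normalising factors.\<close>
    have "0 \<le> (z - 2 * \<xi>)\<^sup>2 / 2" by simp
    also have "\<dots> = (z - \<xi>)\<^sup>2 - z\<^sup>2 / 2 + \<xi>\<^sup>2" by (simp add: power2_eq_square field_simps)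
    also have "\<xi>\<^sup>2 \<le> 1" using \<xi> by (simp add: abs_square_le_1)
    finally have "- (z - \<xi>)\<^sup>2 / 2 \<le> 1 / 2 + - z\<^sup>2 / 4" by simp
    then have "exp (- (z - \<xi>)\<^sup>2 / 2) \<le> exp (1 / 2) * exp (- z\<^sup>2 / 4)" by (simp flip: exp_add)
    also have "exp (1 / 2) \<le> (2::real)"
    proof -
      have "exp (1 / 2) \<le> 1 + (1/2) + (1/2 :: real)\<^sup>2" by (rule exp_bound) auto
      then show ?thesis by (simp add: power2_eq_square)
    qed
    finally have "exp (- (z - \<xi>)\<^sup>2 / 2) \<le> 2 * exp (- z\<^sup>2 / 4)" by simp
    then have "1 / sqrt (2 * pi) * exp (- (z - \<xi>)\<^sup>2 / 2) \<le> (2 * (1 / sqrt (2 * pi * 2))) * (2 * exp (- z\<^sup>2 / 4))"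
    proof (intro mult_mono)
      have "1 / sqrt (2 * pi) = sqrt 2 * (1 / sqrt (2 * pi * 2))" by (simp add: real_sqrt_mult field_simps)
      then show "1 / sqrt (2 * pi) \<le> 2 * (1 / sqrt (2 * pi * 2))"
        using sqrt2_less_2 by (simp add: mult_right_mono divide_right_mono)
    qed auto
    then show ?thesis unfolding normal_density_def by simp
  qed
  then have "\<bar>z - \<xi>\<bar> * std_normal_density (z - \<xi>) \<le> (\<bar>z\<bar> + 1) * (4 * normal_density 0 (sqrt 2) z)"
    using \<xi> by (intro mult_mono) auto
  then have "\<bar>\<eta>\<bar> * (\<bar>z - \<xi>\<bar> * std_normal_density (z - \<xi>)) \<le> \<bar>\<eta>\<bar> * ((\<bar>z\<bar> + 1) * (4 * normal_density 0 (sqrt 2) z))"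
    by (intro mult_left_mono) auto
  then show ?thesis unfolding eq by (simp add: abs_mult mult_ac)
qed

text \<open>Integration by parts for a bounded \<open>H\<close> that is only measurable: the
  translation is moved from \<open>H\<close> to the Gaussian density, whose derivative supplies the
  factor \<open>z\<close>. The second claim is uniform in \<open>H\<close> and provides domination
  once \<open>H\<close> depends on \<open>\<omega>\<close>.\<close>

lemma gaussian_shift_inner:
  fixes H :: "real \<Rightarrow> real" and \<eta> :: "nat \<Rightarrow> real"
  assumes [measurable]: "H \<in> borel_measurable borel" and H: "\<And>z. \<bar>H z\<bar> \<le> 1"
    and \<eta>: "\<And>i. \<eta> i \<noteq> 0" "\<And>i. \<bar>\<eta> i\<bar> \<le> 1" "\<eta> \<longlonglongrightarrow> 0"
  shows "(\<lambda>i. 1 / \<eta> i * ((\<integral>z. H (z + \<eta> i) \<partial>stdN) - (\<integral>z. H z \<partial>stdN)))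
      \<longlonglongrightarrow> (\<integral>z. z * H z \<partial>stdN)"
    and "\<bar>1 / \<eta> i * ((\<integral>z. H (z + \<eta> i) \<partial>stdN) - (\<integral>z. H z \<partial>stdN))\<bar>
      \<le> 4 * (\<integral>z. (\<bar>z\<bar> + 1) * normal_density 0 (sqrt 2) z \<partial>lborel)"
proof -
  define K where "K i z = (1 / \<eta> i * (std_normal_density (z - \<eta> i) - std_normal_density z)) * H z" for i z
  define D where "D z = 4 * ((\<bar>z\<bar> + 1) * normal_density 0 (sqrt 2) z)" for z :: real
  have [measurable]: "K i \<in> borel_measurable borel" for i unfolding K_def by measurable
  have intD: "integrable lborel D"
    using integrable_normal_moment_abs[of "sqrt 2" 0 1] integrable_normal_moment_abs[of "sqrt 2" 0 0]
    unfolding D_def by (simp add: distrib_right mult.commute)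
  have intN: "integrable lborel (\<lambda>z. std_normal_density z * G z)"
    if [measurable]: "G \<in> borel_measurable borel" and "\<And>z. \<bar>G z\<bar> \<le> 1" for G
  proof (rule Bochner_Integration.integrable_bound[of _ "std_normal_density"])
    show "integrable lborel std_normal_density" by simp
    show "AE z in lborel. norm (std_normal_density z * G z) \<le> norm (std_normal_density z)"
      using that(2) by (auto simp: abs_mult intro!: AE_I2 mult_right_le_one_le)
  qed measurable
  have eq: "1 / \<eta> i * ((\<integral>z. H (z + \<eta> i) \<partial>stdN) - (\<integral>z. H z \<partial>stdN)) = (\<integral>z. K i z \<partial>lborel)" for i
  proof -
    have "(\<integral>z. H (z + \<eta> i) \<partial>stdN) = (\<integral>z. std_normal_density z * H (z + \<eta> i) \<partial>lborel)"
      by (subst integral_density) auto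
    also have "\<dots> = (\<integral>z. std_normal_density (z - \<eta> i) * H z \<partial>lborel)"
      using lborel_integral_real_affine[of 1 "\<lambda>z. std_normal_density z * H (z + \<eta> i)" "- \<eta> i"] by simp
    finally have 1: "(\<integral>z. H (z + \<eta> i) \<partial>stdN) = (\<integral>z. std_normal_density (z - \<eta> i) * H z \<partial>lborel)" .
    have 2: "(\<integral>z. H z \<partial>stdN) = (\<integral>z. std_normal_density z * H z \<partial>lborel)"
      by (subst integral_density) auto
    have i1: "integrable lborel (\<lambda>z. std_normal_density (z - \<eta> i) * H z)"
      using lborel_integrable_real_affine[OF intN[of "\<lambda>z. H (z + \<eta> i)"], of 1 "- \<eta> i"] H by simp
    have "1 / \<eta> i * ((\<integral>z. H (z + \<eta> i) \<partial>stdN) - (\<integral>z. H z \<partial>stdN))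
       = (\<integral>z. 1 / \<eta> i * (std_normal_density (z - \<eta> i) * H z - std_normal_density z * H z) \<partial>lborel)"
      unfolding 1 2 using i1 intN[of H] H by simp
    also have "\<dots> = (\<integral>z. K i z \<partial>lborel)"
      by (intro Bochner_Integration.integral_cong) (simp_all add: K_def algebra_simps)
    finally show ?thesis .
  qed
  have KD: "\<bar>K i z\<bar> \<le> D z" for i z
  proof -
    have "\<bar>1 / \<eta> i * (std_normal_density (z - \<eta> i) - std_normal_density z)\<bar> \<le> D z"
      using std_normal_density_diff_bound[OF \<eta>(2)[of i], of z] \<eta>(1)[of i]
      by (simp add: abs_mult D_def field_simps)
    then have "\<bar>K i z\<bar> \<le> D z * 1"
      unfolding K_def abs_mult[of _ "H z"] using H[of z] by (intro mult_mono) (auto simp: D_def)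
    then show ?thesis by simp
  qed
  have "(\<lambda>i. \<integral>z. K i z \<partial>lborel) \<longlonglongrightarrow> (\<integral>z. (z * std_normal_density z) * H z \<partial>lborel)"
  proof (rule integral_dominated_convergence[where w = D])
    have "(\<lambda>i. 1 / \<eta> i * (std_normal_density (z - \<eta> i) - std_normal_density z)) \<longlonglongrightarrow> z * std_normal_density z" for z
    proof -
      have "((\<lambda>x. std_normal_density (z - x)) has_real_derivative (z - 0) * std_normal_density (z - 0)) (at 0)"
        by (rule has_derivative_std_normal_density_shift)
      then have "(\<lambda>x. (std_normal_density (z - (0 + x)) - std_normal_density (z - 0)) / x) \<midarrow>0\<rightarrow> (z - 0) * std_normal_density (z - 0)"
        unfolding DERIV_def .
      then have "((\<lambda>x. (std_normal_density (z - (0 + x)) - std_normal_density (z - 0)) / x) \<circ> \<eta>) \<longlonglongrightarrow> (z - 0) * std_normal_density (z - 0)"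
        using \<eta> unfolding tendsto_at_iff_sequentially by blast
      then show ?thesis by (simp add: o_def)
    qed
    then show "AE z in lborel. (\<lambda>i. K i z) \<longlonglongrightarrow> z * std_normal_density z * H z"
      unfolding K_def by (intro AE_I2 tendsto_mult_right)
  qed (use intD KD in auto)
  also have "(\<integral>z. (z * std_normal_density z) * H z \<partial>lborel) = (\<integral>z. z * H z \<partial>stdN)"
    by (subst integral_density) (auto simp: mult_ac)
  finally show "(\<lambda>i. 1 / \<eta> i * ((\<integral>z. H (z + \<eta> i) \<partial>stdN) - (\<integral>z. H z \<partial>stdN)))
      \<longlonglongrightarrow> (\<integral>z. z * H z \<partial>stdN)" unfolding eq .
  have "norm (\<integral>z. K i z \<partial>lborel) \<le> (\<integral>z. D z \<partial>lborel)"
  proof -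
    have "norm (K i x) \<le> norm (D x)" for x using KD[of i x] by simp
    then have "integrable lborel (K i)"
      by (intro Bochner_Integration.integrable_bound[OF intD] AE_I2) simp_all
    then have "(\<integral>x. norm (K i x) \<partial>lborel) \<le> (\<integral>x. D x \<partial>lborel)"
      using KD intD by (intro integral_mono) auto
    then show ?thesis by (rule order_trans[OF integral_norm_bound])
  qed
  then show "\<bar>1 / \<eta> i * ((\<integral>z. H (z + \<eta> i) \<partial>stdN) - (\<integral>z. H z \<partial>stdN))\<bar>
      \<le> 4 * (\<integral>z. (\<bar>z\<bar> + 1) * normal_density 0 (sqrt 2) z \<partial>lborel)" unfolding eq D_def real_norm_def by simp
qed

section \<open>The Gaussian power series\<close>

text \<open>The covariance of \<open>f p\<close> with the normalised value
  \<open>sqrt (1 - s\<^sup>2) * f s\<close>.\<close>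

definition tau :: "real \<Rightarrow> real \<Rightarrow> real" where
  "tau s p = sqrt (1 - s\<^sup>2) / (1 - s * p)"

lemma tau_pos: "\<bar>s\<bar> < 1 \<Longrightarrow> \<bar>p\<bar> < 1 \<Longrightarrow> 0 < tau s p"
  unfolding tau_def using one_minus_mult_pos one_minus_square_pos by simp

lemma blaschke_self [simp]: "blaschke s s = 0"
  by (simp add: blaschke_def)

lemma abs_blaschke_le: assumes "\<bar>p\<bar> < 1" "\<bar>s\<bar> < 1" shows "\<bar>blaschke p s\<bar> \<le> 1"
proof -
  have "0 \<le> (1 - p\<^sup>2) * (1 - s\<^sup>2)" using one_minus_square_pos assms by (simp add: less_imp_le)
  also have "\<dots> = (1 - p * s)\<^sup>2 - (p - s)\<^sup>2" by (simp add: power2_eq_square algebra_simps)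
  finally have "(p - s)\<^sup>2 \<le> (1 - p * s)\<^sup>2" by simp
  then have "\<bar>p - s\<bar> \<le> \<bar>1 - p * s\<bar>" by (simp add: abs_le_square_iff)
  then show ?thesis using one_minus_mult_pos[of p s] assms by (simp add: blaschke_def divide_le_eq)
qed

text \<open>The decomposition of the covariance of \<open>f p\<close> and \<open>f q\<close> into
  the conditional part given \<open>f s\<close> and the part explained by
  \<open>f s\<close>.\<close>

lemma blaschke_tau_identity:
  assumes "\<bar>s\<bar> < 1" "\<bar>p\<bar> < 1" "\<bar>q\<bar> < 1"
  shows "blaschke p s * blaschke q s / (1 - p * q) + tau s p * tau s q = 1 / (1 - p * q)"
proof -
  have "tau s p * tau s q = (1 - s\<^sup>2) / ((1 - s * p) * (1 - s * q))"
    using one_minus_square_pos[OF assms(1)] by (simp add: tau_def)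
  then show ?thesis using blaschke_identity[OF assms] by simp
qed

lemma prob_space_std_normal: "prob_space stdN"
  by (rule prob_space_normal_density) simp

locale gaussian_series = prob_space M for M :: "'w measure" +
  fixes a :: "nat \<Rightarrow> 'w \<Rightarrow> real"
  assumes indep: "indep_vars (\<lambda>_. borel) a UNIV"
    and normal: "\<And>k. distributed M lborel (a k) std_normal_density"
begin

abbreviation f :: "real \<Rightarrow> 'w \<Rightarrow> real" where "f \<equiv> random_power_series a"

abbreviation MN :: "('w \<times> real) measure" where "MN \<equiv> M \<Otimes>\<^sub>M stdN"

text \<open>One random variable bounding \<open>f t\<close> for all
  \<open>\<bar>t\<bar> \<le> r\<close> at once; its moments dominate every limit in a point.\<close>

definition majorant :: "real \<Rightarrow> 'w \<Rightarrow> real" where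
  "majorant r \<omega> = (\<Sum>k. \<bar>a k \<omega>\<bar> * r ^ k)"

text \<open>A single event of full measure that does not depend on the point, so that continuity of
  \<open>f\<close> may be used along whole sequences of points.\<close>

definition good :: "'w \<Rightarrow> bool" where
  "good \<omega> \<longleftrightarrow> (\<forall>r. 0 \<le> r \<and> r < 1 \<longrightarrow> summable (\<lambda>k. \<bar>a k \<omega>\<bar> * r ^ k))"

lemma a_measurable [measurable]: "a k \<in> borel_measurable M"
  using distributed_measurable[OF normal[of k]] by simp

lemma f_measurable [measurable]: "f t \<in> borel_measurable M"
  unfolding random_power_series_def[abs_def] by measurable

lemma majorant_measurable [measurable]: "majorant r \<in> borel_measurable M"
  unfolding majorant_def[abs_def] by measurable

lemma
  shows abs_moment_integrable: "integrable M (\<lambda>\<omega>. \<bar>a k \<omega>\<bar> ^ n)"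
    and abs_moment_eq: "(\<integral>\<omega>. \<bar>a k \<omega>\<bar> ^ n \<partial>M) = (\<integral>x. std_normal_density x * \<bar>x\<bar> ^ n \<partial>lborel)"
proof -
  have m: "(\<lambda>x::real. \<bar>x\<bar> ^ n) \<in> borel_measurable lborel" by measurable
  show "integrable M (\<lambda>\<omega>. \<bar>a k \<omega>\<bar> ^ n)"
    using distributed_integrable[OF normal[of k] m] integrable_std_normal_moment_abs[of n] by simp
  show "(\<integral>\<omega>. \<bar>a k \<omega>\<bar> ^ n \<partial>M) = (\<integral>x. std_normal_density x * \<bar>x\<bar> ^ n \<partial>lborel)"
    using distributed_integral[OF normal[of k] m] by simp
qed

text \<open>The absolute moments of \<open>a k\<close> do not depend on \<open>k\<close>, so by
  monotone convergence the expected sum is a geometric series.\<close>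

lemma moment_series:
  assumes q: "0 \<le> q" "q < 1"
  shows "AE \<omega> in M. summable (\<lambda>k. \<bar>a k \<omega>\<bar> ^ n * q ^ k)"
    and "integrable M (\<lambda>\<omega>. \<Sum>k. \<bar>a k \<omega>\<bar> ^ n * q ^ k)"
proof -
  define c where "c = (\<integral>x. std_normal_density x * \<bar>x\<bar> ^ n \<partial>lborel)"
  have c: "0 \<le> c" unfolding c_def by (intro Bochner_Integration.integral_nonneg) auto
  have int: "integrable M (\<lambda>\<omega>. \<bar>a k \<omega>\<bar> ^ n * q ^ k)" for k using abs_moment_integrable by simp
  have E: "(\<integral>\<omega>. \<bar>a k \<omega>\<bar> ^ n * q ^ k \<partial>M) = c * q ^ k" for k using abs_moment_eq[of k n] by (simp add: c_def)
  have "(\<integral>\<^sup>+\<omega>. (\<Sum>k. ennreal (\<bar>a k \<omega>\<bar> ^ n * q ^ k)) \<partial>M) = (\<Sum>k. \<integral>\<^sup>+\<omega>. ennreal (\<bar>a k \<omega>\<bar> ^ n * q ^ k) \<partial>M)"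
    by (rule nn_integral_suminf) measurable
  also have "\<dots> = (\<Sum>k. ennreal (c * q ^ k))"
  proof -
    have "(\<integral>\<^sup>+\<omega>. ennreal (\<bar>a k \<omega>\<bar> ^ n * q ^ k) \<partial>M) = ennreal (c * q ^ k)" for k
      using nn_integral_eq_integral[OF int[of k]] q unfolding E by simp
    then show ?thesis by simp
  qed
  also have "\<dots> = ennreal (\<Sum>k. c * q ^ k)"
    using q c by (intro suminf_ennreal2) (auto intro!: summable_mult summable_geometric)
  finally have "(\<integral>\<^sup>+\<omega>. (\<Sum>k. ennreal (\<bar>a k \<omega>\<bar> ^ n * q ^ k)) \<partial>M) \<noteq> \<infinity>" by simp
  then have "AE \<omega> in M. (\<Sum>k. ennreal (\<bar>a k \<omega>\<bar> ^ n * q ^ k)) \<noteq> \<infinity>"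
    by (intro nn_integral_PInf_AE) measurable
  then show AE: "AE \<omega> in M. summable (\<lambda>k. \<bar>a k \<omega>\<bar> ^ n * q ^ k)"
    by eventually_elim (use q in \<open>auto intro!: summable_suminf_not_top\<close>)
  show "integrable M (\<lambda>\<omega>. \<Sum>k. \<bar>a k \<omega>\<bar> ^ n * q ^ k)"
  proof (rule integrable_suminf[OF int])
    have norm: "norm (\<bar>a k \<omega>\<bar> ^ n * q ^ k) = \<bar>a k \<omega>\<bar> ^ n * q ^ k" for k \<omega> using q by simp
    show "AE \<omega> in M. summable (\<lambda>k. norm (\<bar>a k \<omega>\<bar> ^ n * q ^ k))" unfolding norm by (rule AE)
    show "summable (\<lambda>k. \<integral>\<omega>. norm (\<bar>a k \<omega>\<bar> ^ n * q ^ k) \<partial>M)"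
      unfolding norm E using q by (intro summable_mult summable_geometric) simp
  qed
qed

text \<open>The radii \<open>1 - inverse (Suc m)\<close> are countably many and exceed every
  \<open>r < 1\<close> eventually; comparison of the series covers all other radii.\<close>

lemma AE_good: "AE \<omega> in M. good \<omega>"
proof -
  have "AE \<omega> in M. \<forall>m::nat. summable (\<lambda>k. \<bar>a k \<omega>\<bar> ^ 1 * (1 - inverse (Suc m)) ^ k)"
    unfolding AE_all_countable by (intro allI moment_series(1)) (auto simp: field_simps)
  then show ?thesis
  proof eventually_elim
    case (elim \<omega>)
    show "good \<omega>" unfolding good_def
    proof (intro allI impI)
      fix r :: real assume r: "0 \<le> r \<and> r < 1"
      then obtain m where "inverse (real (Suc m)) < 1 - r" using reals_Archimedean[of "1 - r"] by auto
      then have "r ^ k \<le> (1 - inverse (Suc m)) ^ k" for k using r by (intro power_mono) auto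
      then have "norm (\<bar>a k \<omega>\<bar> * r ^ k) \<le> \<bar>a k \<omega>\<bar> ^ 1 * (1 - inverse (Suc m)) ^ k" for k
        using r by (simp add: abs_mult mult_left_mono)
      then show "summable (\<lambda>k. \<bar>a k \<omega>\<bar> * r ^ k)"
        by (rule summable_comparison_test'[OF elim[rule_format, of m]])
    qed
  qed
qed

lemma good_summable:
  assumes "good \<omega>" "\<bar>t\<bar> < 1" shows "summable (\<lambda>k. a k \<omega> * t ^ k)"
  using assms by (intro summable_norm_cancel[where f = "\<lambda>k. a k \<omega> * t ^ k"])
    (auto simp: good_def abs_mult power_abs)

lemma good_isCont:
  assumes "good \<omega>" "\<bar>t\<bar> < 1" shows "isCont (\<lambda>t. f t \<omega>) t"
proof -
  obtain r where r: "\<bar>t\<bar> < r" "r < 1" using dense assms(2) by blast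
  then have "summable (\<lambda>k. a k \<omega> * r ^ k)" using assms(1) by (intro good_summable) auto
  then show ?thesis unfolding random_power_series_def using r by (intro isCont_powser[of _ r]) auto
qed

lemma good_majorant:
  assumes "good \<omega>" "\<bar>t\<bar> \<le> r" "r < 1" shows "\<bar>f t \<omega>\<bar> \<le> majorant r \<omega>"
proof -
  have s: "summable (\<lambda>k. \<bar>a k \<omega>\<bar> * r ^ k)" "summable (\<lambda>k. \<bar>a k \<omega>\<bar> * \<bar>t\<bar> ^ k)"
    using assms by (auto simp: good_def)
  have "\<bar>f t \<omega>\<bar> \<le> (\<Sum>k. \<bar>a k \<omega> * t ^ k\<bar>)"
    unfolding random_power_series_def using s(2) by (intro summable_rabs) (simp add: abs_mult power_abs)
  also have "\<dots> \<le> majorant r \<omega>"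
    unfolding majorant_def using s assms(2)
    by (intro suminf_le) (auto simp: abs_mult power_abs intro!: mult_left_mono power_mono)
  finally show ?thesis .
qed

lemma majorant_nonneg: "good \<omega> \<Longrightarrow> 0 \<le> r \<Longrightarrow> r < 1 \<Longrightarrow> 0 \<le> majorant r \<omega>"
  unfolding majorant_def by (intro suminf_nonneg) (auto simp: good_def)

text \<open>With \<open>r = q * q\<close>, one factor \<open>q ^ k\<close> tames the coefficient:
  \<open>\<bar>a k \<omega>\<bar> * q ^ k\<close> is at most the \<open>n\<close>-th root of the
  integrable sum \<open>T\<close>. The other factor is summed as a geometric series, so the
  \<open>n\<close>-th power of the majorant is at most a constant times \<open>T\<close>.\<close>

lemma integrable_majorant_power:
  assumes r: "0 \<le> r" "r < 1"
  shows "integrable M (\<lambda>\<omega>. majorant r \<omega> ^ n)"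
proof (cases "n = 0")
  case False
  define q where "q = sqrt r"
  have q: "0 \<le> q" "q < 1" "r = q * q" using r by (auto simp: q_def)
  have "AE \<omega> in M. norm (majorant r \<omega> ^ n) \<le> norm ((1 / (1 - q)) ^ n * (\<Sum>k. \<bar>a k \<omega>\<bar> ^ n * q ^ k))"
    using AE_good moment_series(1)[OF q(1,2), of n]
  proof eventually_elim
    case (elim \<omega>)
    define T where "T = (\<Sum>k. \<bar>a k \<omega>\<bar> ^ n * q ^ k)"
    have T0: "0 \<le> T" unfolding T_def using elim(2) q by (intro suminf_nonneg) auto
    have le: "\<bar>a k \<omega>\<bar> * q ^ k \<le> root n T" for k
    proof -
      have "(\<bar>a k \<omega>\<bar> * q ^ k) ^ n = \<bar>a k \<omega>\<bar> ^ n * (q ^ k) ^ n" by (simp add: power_mult_distrib)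
      also have "(q ^ k) ^ n \<le> (q ^ k) ^ 1"
        using False q by (intro power_decreasing) (auto simp: power_le_one)
      also have "\<bar>a k \<omega>\<bar> ^ n * (q ^ k) ^ 1 \<le> T"
        unfolding T_def using sum_le_suminf[OF elim(2), of "{k}"] q by simp
      finally have "(\<bar>a k \<omega>\<bar> * q ^ k) ^ n \<le> T" by (simp add: mult_left_mono)
      then have "root n ((\<bar>a k \<omega>\<bar> * q ^ k) ^ n) \<le> root n T"
        using False by (intro real_root_le_mono) auto
      then show ?thesis using False q by (simp add: real_root_power_cancel)
    qed
    have s: "summable (\<lambda>k. \<bar>a k \<omega>\<bar> * r ^ k)" using elim(1) r by (auto simp: good_def)
    have "majorant r \<omega> \<le> (\<Sum>k. root n T * q ^ k)"
      unfolding majorant_def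
    proof (rule suminf_le[OF _ s])
      show "summable (\<lambda>k. root n T * q ^ k)" using q by (intro summable_mult summable_geometric) auto
      show "\<bar>a k \<omega>\<bar> * r ^ k \<le> root n T * q ^ k" for k
        using mult_right_mono[OF le[of k], of "q ^ k"] q by (simp add: power_mult_distrib mult_ac)
    qed
    also have "\<dots> = root n T * (1 / (1 - q))"
      using q by (subst suminf_mult) (auto simp: summable_geometric suminf_geometric)
    finally have "majorant r \<omega> ^ n \<le> (root n T * (1 / (1 - q))) ^ n"
      using elim(1) r by (intro power_mono majorant_nonneg)
    also have "\<dots> = (1 / (1 - q)) ^ n * T"
      using False T0 by (simp add: power_mult_distrib power_divide)
    finally show ?case using elim(1) r q T0 unfolding T_def
      by (simp add: majorant_nonneg abs_mult)
  qed
  then show ?thesis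
    by (rule Bochner_Integration.integrable_bound[OF integrable_mult_right[OF moment_series(2)[OF q(1,2)]], rotated]) measurable
qed simp

section \<open>Finite-dimensional laws of the series and conditioning at a point\<close>

lemma char_partial_sum:
  "(\<integral>\<omega>. iexp (\<Sum>k<N. c k * a k \<omega>) \<partial>M) = complex_of_real (exp (- (\<Sum>k<N. (c k)\<^sup>2) / 2))"
proof -
  have ind: "indep_vars (\<lambda>_. borel) (\<lambda>k \<omega>. c k * a k \<omega>) {..<N}"
    by (rule indep_vars_compose2[OF indep_vars_subset[OF indep], of _ "\<lambda>k x. c k * x"]) auto
  have std: "distr M borel (a k) = stdN" for k
  proof -
    have "distr M borel (a k) = distr M lborel (a k)" by (intro distr_cong) auto
    then show ?thesis using distributed_distr_eq_density[OF normal[of k]] by simp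
  qed
  have one: "char (distr M borel (\<lambda>\<omega>. c k * a k \<omega>)) 1 = complex_of_real (exp (- (c k)\<^sup>2 / 2))" for k
  proof -
    have "char (distr M borel (\<lambda>\<omega>. c k * a k \<omega>)) 1 = (\<integral>\<omega>. iexp (c k * a k \<omega>) \<partial>M)"
      unfolding char_def by (subst integral_distr) auto
    also have "\<dots> = char (distr M borel (a k)) (c k)"
      unfolding char_def by (subst integral_distr) auto
    finally show ?thesis unfolding std by (simp add: char_std_normal_distribution)
  qed
  have "(\<integral>\<omega>. iexp (\<Sum>k<N. c k * a k \<omega>) \<partial>M) = char (distr M borel (\<lambda>\<omega>. \<Sum>k<N. c k * a k \<omega>)) 1"
    unfolding char_def by (subst integral_distr) auto
  also have "\<dots> = (\<Prod>k<N. complex_of_real (exp (- (c k)\<^sup>2 / 2)))"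
    by (subst char_distr_sum[OF ind]) (simp add: one)
  also have "\<dots> = complex_of_real (exp (- (\<Sum>k<N. (c k)\<^sup>2) / 2))"
    by (simp add: exp_sum[symmetric] sum_negf sum_divide_distrib flip: of_real_prod)
  finally show ?thesis .
qed

text \<open>A linear combination of values of \<open>f\<close> is the limit of linear combinations
  of the coefficients with weights \<open>c k\<close>. The sum of the squares of these weights
  consists of geometric series that converge to the Szego kernel.\<close>

lemma char_finite:
  assumes J: "finite J" "\<And>p. p \<in> J \<Longrightarrow> \<bar>p\<bar> < 1"
  shows "(\<integral>\<omega>. iexp (\<Sum>p\<in>J. \<theta> p * f p \<omega>) \<partial>M)
    = complex_of_real (exp (- (\<Sum>p\<in>J. \<Sum>q\<in>J. \<theta> p * \<theta> q / (1 - p * q)) / 2))"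
proof -
  define c where "c k = (\<Sum>p\<in>J. \<theta> p * p ^ k)" for k
  have "(\<lambda>N. \<integral>\<omega>. iexp (\<Sum>k<N. c k * a k \<omega>) \<partial>M) \<longlonglongrightarrow> (\<integral>\<omega>. iexp (\<Sum>p\<in>J. \<theta> p * f p \<omega>) \<partial>M)"
  proof (rule integral_dominated_convergence[where w = "\<lambda>_. 1"])
    show "AE \<omega> in M. (\<lambda>N. iexp (\<Sum>k<N. c k * a k \<omega>)) \<longlonglongrightarrow> iexp (\<Sum>p\<in>J. \<theta> p * f p \<omega>)"
      using AE_good
    proof eventually_elim
      case (elim \<omega>)
      have "(\<Sum>k<N. c k * a k \<omega>) = (\<Sum>p\<in>J. \<theta> p * (\<Sum>k<N. a k \<omega> * p ^ k))" for N
        unfolding c_def sum_distrib_left sum_distrib_right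
        by (subst sum.swap) (simp add: mult_ac)
      moreover have "(\<lambda>N. \<Sum>p\<in>J. \<theta> p * (\<Sum>k<N. a k \<omega> * p ^ k)) \<longlonglongrightarrow> (\<Sum>p\<in>J. \<theta> p * f p \<omega>)"
        unfolding random_power_series_def using good_summable[OF elim] J(2)
        by (intro tendsto_sum tendsto_mult tendsto_const summable_LIMSEQ) auto
      ultimately have "(\<lambda>N. \<Sum>k<N. c k * a k \<omega>) \<longlonglongrightarrow> (\<Sum>p\<in>J. \<theta> p * f p \<omega>)" by simp
      then show ?case by (intro tendsto_exp tendsto_mult tendsto_const tendsto_of_real)
    qed
  qed auto
  moreover have "(\<lambda>N. complex_of_real (exp (- (\<Sum>k<N. (c k)\<^sup>2) / 2)))
      \<longlonglongrightarrow> complex_of_real (exp (- (\<Sum>p\<in>J. \<Sum>q\<in>J. \<theta> p * \<theta> q / (1 - p * q)) / 2))"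
  proof -
    have "(\<Sum>k<N. (c k)\<^sup>2) = (\<Sum>p\<in>J. \<Sum>q\<in>J. \<theta> p * \<theta> q * (\<Sum>k<N. (p * q) ^ k))" for N
    proof -
      have "(c k)\<^sup>2 = (\<Sum>p\<in>J. \<Sum>q\<in>J. \<theta> p * \<theta> q * (p * q) ^ k)" for k
        unfolding c_def power2_eq_square sum_product by (simp add: power_mult_distrib mult_ac)
      then have "(\<Sum>k<N. (c k)\<^sup>2) = (\<Sum>k<N. \<Sum>p\<in>J. \<Sum>q\<in>J. \<theta> p * \<theta> q * (p * q) ^ k)" by simp
      also have "\<dots> = (\<Sum>p\<in>J. \<Sum>k<N. \<Sum>q\<in>J. \<theta> p * \<theta> q * (p * q) ^ k)" by (rule sum.swap)
      also have "\<dots> = (\<Sum>p\<in>J. \<Sum>q\<in>J. \<Sum>k<N. \<theta> p * \<theta> q * (p * q) ^ k)"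
        by (intro sum.cong refl sum.swap)
      finally show ?thesis by (simp add: sum_distrib_left)
    qed
    moreover have "(\<lambda>N. \<Sum>p\<in>J. \<Sum>q\<in>J. \<theta> p * \<theta> q * (\<Sum>k<N. (p * q) ^ k))
        \<longlonglongrightarrow> (\<Sum>p\<in>J. \<Sum>q\<in>J. \<theta> p * \<theta> q * (1 / (1 - p * q)))"
    proof (intro tendsto_sum tendsto_mult tendsto_const)
      fix p q assume "p \<in> J" "q \<in> J"
      then have "norm (p * q) < 1" using J(2) abs_mult_less[of p 1 q 1] by (simp add: abs_mult)
      then show "(\<lambda>N. \<Sum>k<N. (p * q) ^ k) \<longlonglongrightarrow> 1 / (1 - p * q)"
        using geometric_sums[of "p * q"] by (simp add: sums_def)
    qed
    ultimately have "(\<lambda>N. \<Sum>k<N. (c k)\<^sup>2) \<longlonglongrightarrow> (\<Sum>p\<in>J. \<Sum>q\<in>J. \<theta> p * \<theta> q / (1 - p * q))" by simp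
    then show ?thesis by (intro tendsto_of_real tendsto_exp tendsto_divide tendsto_minus tendsto_const) auto
  qed
  ultimately show ?thesis unfolding char_partial_sum by (rule LIMSEQ_unique)
qed

text \<open>Conditionally on \<open>f s = 0\<close> the process \<open>f\<close> is distributed as the Blaschke factor of \<open>s\<close> times \<open>f\<close>;
  here \<open>snd x\<close> is the normalised value at \<open>s\<close>.\<close>

lemma blaschke_distr:
  assumes J: "finite J" "\<And>p. p \<in> J \<Longrightarrow> \<bar>p\<bar> < 1" and s: "\<bar>s\<bar> < 1"
  shows "distr M (PiM J (\<lambda>_. borel)) (\<lambda>\<omega>. \<lambda>p\<in>J. f p \<omega>) =
    distr MN (PiM J (\<lambda>_. borel)) (\<lambda>x. \<lambda>p\<in>J. blaschke p s * f p (fst x) + snd x * tau s p)"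
proof -
  interpret N: prob_space stdN by (rule prob_space_std_normal)
  interpret P: pair_prob_space M stdN ..
  show ?thesis
  proof (rule distr_PiM_eqI_char[OF prob_space_axioms P.prob_space_axioms])
    fix \<theta>
    define b where "b p = \<theta> p * blaschke p s" for p
    define t where "t = (\<Sum>p\<in>J. \<theta> p * tau s p)"
    have int: "integrable MN (\<lambda>x. iexp ((\<Sum>p\<in>J. b p * f p (fst x)) + t * snd x))"
      by (intro P.P.integrable_const_bound[of _ 1] AE_I2) simp_all
    have "(\<integral>x. iexp (\<Sum>p\<in>J. \<theta> p * (blaschke p s * f p (fst x) + snd x * tau s p)) \<partial>MN)
        = (\<integral>x. iexp ((\<Sum>p\<in>J. b p * f p (fst x)) + t * snd x) \<partial>MN)"
    proof -
      have "(\<Sum>p\<in>J. \<theta> p * (blaschke p s * f p (fst x) + snd x * tau s p)) = (\<Sum>p\<in>J. b p * f p (fst x)) + t * snd x" for x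
        unfolding t_def sum_distrib_right sum.distrib[symmetric] by (intro sum.cong) (simp_all add: b_def algebra_simps)
      then show ?thesis by simp
    qed
    also have "\<dots> = (\<integral>\<omega>. (\<integral>z. iexp ((\<Sum>p\<in>J. b p * f p \<omega>) + t * z) \<partial>stdN) \<partial>M)"
      using P.integral_fst'[OF int] by simp
    also have "\<dots> = (\<integral>\<omega>. iexp (\<Sum>p\<in>J. b p * f p \<omega>) * char stdN t \<partial>M)"
      by (simp add: char_def distrib_left exp_add)
    also have "\<dots> = complex_of_real (exp (- (\<Sum>p\<in>J. \<Sum>q\<in>J. b p * b q / (1 - p * q)) / 2)) * complex_of_real (exp (- t\<^sup>2 / 2))"
      using char_finite[OF J] by (simp add: char_std_normal_distribution)
    also have "\<dots> = complex_of_real (exp (- ((\<Sum>p\<in>J. \<Sum>q\<in>J. b p * b q / (1 - p * q)) + t\<^sup>2) / 2))"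
      by (simp add: exp_add[symmetric] add_divide_distrib flip: of_real_mult)
    \<comment> \<open>The quadratic form of the new process is that of the conditional covariance
      plus the square contributed by \<open>z\<close>; \<open>blaschke_tau_identity\<close> adds
      them up to the original one.\<close>
    also have "(\<Sum>p\<in>J. \<Sum>q\<in>J. b p * b q / (1 - p * q)) + t\<^sup>2 =
        (\<Sum>p\<in>J. \<Sum>q\<in>J. \<theta> p * \<theta> q * (blaschke p s * blaschke q s / (1 - p * q) + tau s p * tau s q))"
      unfolding t_def power2_eq_square sum_product sum.distrib[symmetric]
      by (intro sum.cong refl) (simp add: b_def algebra_simps)
    also have "\<dots> = (\<Sum>p\<in>J. \<Sum>q\<in>J. \<theta> p * \<theta> q / (1 - p * q))"
      using J s by (intro sum.cong refl) (simp add: blaschke_tau_identity)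
    finally show "(\<integral>\<omega>. iexp (\<Sum>p\<in>J. \<theta> p * f p \<omega>) \<partial>M) =
        (\<integral>x. iexp (\<Sum>p\<in>J. \<theta> p * (blaschke p s * f p (fst x) + snd x * tau s p)) \<partial>MN)"
      using char_finite[OF J] by simp
  qed (use J in auto)
qed

text \<open>The form in which the identity of laws is applied. Since \<open>\<Psi>\<close> reads
  only the coordinates in \<open>J\<close>, it may be fed with the unrestricted functions of
  \<open>p\<close>.\<close>

lemma blaschke_transfer:
  fixes \<Psi> :: "(real \<Rightarrow> real) \<Rightarrow> real"
  assumes J: "finite J" "\<And>p. p \<in> J \<Longrightarrow> \<bar>p\<bar> < 1" and s: "\<bar>s\<bar> < 1"
    and \<Psi> [measurable]: "\<Psi> \<in> borel_measurable (PiM J (\<lambda>_. borel))" and restr: "\<And>x. \<Psi> (restrict x J) = \<Psi> x"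
  shows "(\<integral>\<omega>. \<Psi> (\<lambda>p. f p \<omega>) \<partial>M) = (\<integral>(\<omega>, z). \<Psi> (\<lambda>p. blaschke p s * f p \<omega> + z * tau s p) \<partial>MN)"
    and "integrable M (\<lambda>\<omega>. \<Psi> (\<lambda>p. f p \<omega>)) \<longleftrightarrow> integrable MN (\<lambda>(\<omega>, z). \<Psi> (\<lambda>p. blaschke p s * f p \<omega> + z * tau s p))"
proof -
  have m1: "(\<lambda>\<omega>. \<lambda>p\<in>J. f p \<omega>) \<in> measurable M (PiM J (\<lambda>_. borel))" by measurable
  have m2: "(\<lambda>x. \<lambda>p\<in>J. blaschke p s * f p (fst x) + snd x * tau s p) \<in> measurable MN (PiM J (\<lambda>_. borel))" by measurable
  show "(\<integral>\<omega>. \<Psi> (\<lambda>p. f p \<omega>) \<partial>M) = (\<integral>(\<omega>, z). \<Psi> (\<lambda>p. blaschke p s * f p \<omega> + z * tau s p) \<partial>MN)"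
    using integral_distr[OF m1 \<Psi>] integral_distr[OF m2 \<Psi>] blaschke_distr[OF J s]
    by (simp add: restr case_prod_beta')
  show "integrable M (\<lambda>\<omega>. \<Psi> (\<lambda>p. f p \<omega>)) \<longleftrightarrow> integrable MN (\<lambda>(\<omega>, z). \<Psi> (\<lambda>p. blaschke p s * f p \<omega> + z * tau s p))"
    using integrable_distr_eq[OF m1 \<Psi>] integrable_distr_eq[OF m2 \<Psi>] blaschke_distr[OF J s]
    by (simp add: restr case_prod_beta')
qed

text \<open>Conditioning at \<open>p\<close> itself makes the Blaschke factor vanish and leaves a
  positive multiple of the normal variable \<open>z\<close>, which has no atom at 0.\<close>

lemma AE_f_nonzero:
  assumes p: "\<bar>p\<bar> < 1" shows "AE \<omega> in M. f p \<omega> \<noteq> 0"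
proof -
  interpret N: prob_space stdN by (rule prob_space_std_normal)
  interpret P: pair_prob_space M stdN ..
  define \<Psi> :: "(real \<Rightarrow> real) \<Rightarrow> real" where "\<Psi> x = indicator {0} (x p)" for x
  have m: "\<Psi> \<in> borel_measurable (PiM {p} (\<lambda>_. borel))" unfolding \<Psi>_def by measurable
  have "(\<integral>\<omega>. \<Psi> (\<lambda>p. f p \<omega>) \<partial>M) = (\<integral>(\<omega>, z). \<Psi> (\<lambda>q. blaschke q p * f q \<omega> + z * tau p q) \<partial>MN)"
    using p m by (intro blaschke_transfer(1)[of "{p}"]) (auto simp: \<Psi>_def)
  also have "\<dots> = (\<integral>(\<omega>, z). indicator {0} z \<partial>MN)"
    using tau_pos[OF p p] by (simp add: \<Psi>_def indicator_def)
  also have "\<dots> = (\<integral>\<omega>. (\<integral>z. indicator {0} z \<partial>stdN) \<partial>M)"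
    by (subst P.integral_fst'[symmetric]) (auto intro!: P.P.integrable_const_bound[of _ 1])
  also have "(\<integral>z. indicator {0} z \<partial>stdN :: real) = 0"
  proof -
    have "AE z in lborel. z \<noteq> (0::real)" by (rule AE_lborel_singleton)
    then have "(\<integral>z. std_normal_density z * indicator {0} z \<partial>lborel) = (\<integral>z. 0 \<partial>(lborel :: real measure))"
      by (intro integral_cong_AE) (auto elim!: eventually_mono)
    then show ?thesis by (subst integral_density) auto
  qed
  finally have "(\<integral>\<omega>. indicator {0} (f p \<omega>) \<partial>M) = (0::real)" by (simp add: \<Psi>_def)
  then have "AE \<omega> in M. indicator {0} (f p \<omega>) = (0::real)"
    by (subst (asm) integral_nonneg_eq_0_iff_AE) (auto intro!: integrable_const_bound[of _ 1])
  then show ?thesis by eventually_elim (auto simp: indicator_def split: if_splits)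
qed

end

section \<open>Differentiation of a moment with a sign factor\<close>

lemma finite_abs_bound:
  fixes J :: "real set"
  assumes "finite J" "\<And>p. p \<in> J \<Longrightarrow> \<bar>p\<bar> < 1"
  obtains r where "0 \<le> r" "r < 1" "\<And>p. p \<in> J \<Longrightarrow> \<bar>p\<bar> \<le> r"
proof
  let ?r = "Max (insert 0 (abs ` J))"
  show "0 \<le> ?r" "?r < 1" "\<And>p. p \<in> J \<Longrightarrow> \<bar>p\<bar> \<le> ?r"
    using assms by (auto intro: Max_ge)
qed

lemma abs_prod_le_power:
  fixes g :: "'a \<Rightarrow> real"
  assumes "\<And>p. p \<in> T \<Longrightarrow> \<bar>g p\<bar> \<le> K"
  shows "\<bar>\<Prod>p\<in>T. g p\<bar> \<le> K ^ card T"
  using prod_mono[of T "\<lambda>p. \<bar>g p\<bar>" "\<lambda>_. K"] assms by (simp add: abs_prod)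

lemma abs_prod_sgn_le_1: "\<bar>\<Prod>p\<in>T. sgn (g p :: real)\<bar> \<le> 1"
  using abs_prod_le_power[of T "\<lambda>p. sgn (g p)" 1] by (simp add: sgn_if)

text \<open>One factor is exchanged at a time: before \<open>j\<close> the factors are already those
  of \<open>A\<close>, after \<open>j\<close> still those of \<open>B\<close>.\<close>

lemma prod_diff_telescope:
  fixes A B :: "nat \<Rightarrow> real"
  shows "(\<Prod>k<m. A k) - (\<Prod>k<m. B k) = (\<Sum>j<m. (A j - B j) * ((\<Prod>k<j. A k) * (\<Prod>k\<in>{j<..<m}. B k)))"
proof (induction m)
  case (Suc m)
  have "{j<..<Suc m} = insert m {j<..<m}" if "j < m" for j using that by auto
  then have "(\<Sum>j<m. (A j - B j) * ((\<Prod>k<j. A k) * (\<Prod>k\<in>{j<..<Suc m}. B k)))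
      = B m * (\<Sum>j<m. (A j - B j) * ((\<Prod>k<j. A k) * (\<Prod>k\<in>{j<..<m}. B k)))"
    by (auto simp: sum_distrib_left mult_ac intro!: sum.cong)
  also have "\<dots> = B m * ((\<Prod>k<m. A k) - (\<Prod>k<m. B k))" by (simp only: Suc.IH)
  finally have "(\<Sum>j<Suc m. (A j - B j) * ((\<Prod>k<j. A k) * (\<Prod>k\<in>{j<..<Suc m}. B k)))
      = B m * ((\<Prod>k<m. A k) - (\<Prod>k<m. B k)) + (A m - B m) * ((\<Prod>k<m. A k) * (\<Prod>k\<in>{m<..<Suc m}. B k))"
    unfolding sum.lessThan_Suc by (simp only:)
  moreover have "{m<..<Suc m} = {}" by auto
  ultimately show ?case by (simp add: algebra_simps)
qed simp

text \<open>The offsets \<open>c k\<close> serve shifted and unshifted products alike; the terms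
  \<open>+ 0\<close> in later integrands are instances with offset zero.\<close>

lemma prod_sgn_measurable:
  assumes "\<And>k. k \<in> K \<Longrightarrow> p k \<in> J"
  shows "(\<lambda>x. \<Prod>k\<in>K. sgn (x (p k) + c k) :: real) \<in> borel_measurable (PiM J (\<lambda>_. borel))"
  using assms by (intro borel_measurable_prod) measurable

context gaussian_series
begin

lemma integrable_prod_f_sgn:
  assumes T: "finite T" "\<And>p. p \<in> T \<Longrightarrow> \<bar>p\<bar> < 1"
    and [measurable]: "w \<in> borel_measurable M" and w: "\<And>\<omega>. \<bar>w \<omega>\<bar> \<le> 1"
  shows "integrable M (\<lambda>\<omega>. w \<omega> * (\<Prod>p\<in>T. f p \<omega>))"
proof -
  obtain r where r: "0 \<le> r" "r < 1" "\<And>p. p \<in> T \<Longrightarrow> \<bar>p\<bar> \<le> r" using finite_abs_bound[OF T] by blast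
  have "AE \<omega> in M. norm (w \<omega> * (\<Prod>p\<in>T. f p \<omega>)) \<le> norm (majorant r \<omega> ^ card T)"
    using AE_good
  proof eventually_elim
    case (elim \<omega>)
    have "\<bar>\<Prod>p\<in>T. f p \<omega>\<bar> \<le> majorant r \<omega> ^ card T"
      using good_majorant[OF elim] r by (intro abs_prod_le_power) auto
    then have "\<bar>w \<omega>\<bar> * \<bar>\<Prod>p\<in>T. f p \<omega>\<bar> \<le> 1 * majorant r \<omega> ^ card T"
      using w by (intro mult_mono) auto
    then show ?case by (simp add: abs_mult)
  qed
  then show ?thesis
    by (rule Bochner_Integration.integrable_bound[OF integrable_majorant_power[OF r(1,2)], rotated]) measurable
qed

text \<open>Under conditioning at \<open>s\<close>, the sign of \<open>f s\<close> becomes the sign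
  of \<open>z\<close> and that of \<open>f (s + h)\<close> becomes the sign of
  \<open>z + h * W\<close>, where \<open>W\<close> is \<open>f (s + h)\<close> divided by
  \<open>\<sigma>\<close>. The difference quotient is thus a sign increment in \<open>z\<close>; its
  limit sets \<open>z = 0\<close> in the other factors, which leaves them with their Blaschke
  factors.\<close>

lemma has_derivative_sgn_moment:
  assumes T: "finite T" "\<And>p. p \<in> T \<Longrightarrow> \<bar>p\<bar> < 1" and S: "finite S" "\<And>q. q \<in> S \<Longrightarrow> \<bar>q\<bar> < 1"
    and s: "\<bar>s\<bar> < 1" "s \<notin> S"
  shows "((\<lambda>u. \<integral>\<omega>. sgn (f u \<omega>) * ((\<Prod>p\<in>T. f p \<omega>) * (\<Prod>q\<in>S. sgn (f q \<omega>))) \<partial>M) has_real_derivative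
    sqrt (2 / pi) / sqrt (1 - s\<^sup>2) * ((\<Prod>p\<in>T. blaschke p s) * (\<Prod>q\<in>S. sgn (blaschke q s))) *
      (\<integral>\<omega>. f s \<omega> * ((\<Prod>p\<in>T. f p \<omega>) * (\<Prod>q\<in>S. sgn (f q \<omega>))) \<partial>M)) (at s)"
    (is "(?F has_real_derivative ?D) _")
proof -
  interpret N: prob_space stdN by (rule prob_space_std_normal)
  interpret P: pair_prob_space M stdN ..
  obtain r0 where r0: "0 \<le> r0" "r0 < 1" "\<And>p. p \<in> insert s T \<Longrightarrow> \<bar>p\<bar> \<le> r0"
    using finite_abs_bound[of "insert s T"] T s by auto
  \<comment> \<open>A radius strictly between \<open>r0\<close> and 1; the margin \<open>d\<close>
    keeps \<open>s + h\<close> within radius \<open>r\<close> for all increments considered.\<close>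
  define r where "r = (1 + r0) / 2"
  define d where "d = r - r0"
  have r: "0 \<le> r" "r < 1" "\<And>p. p \<in> T \<Longrightarrow> \<bar>p\<bar> \<le> r" "\<bar>s\<bar> \<le> r" and d: "0 < d" "d \<le> 1"
    using r0 by (force simp: r_def d_def)+
  have sd: "\<bar>s + h\<bar> \<le> r" if "\<bar>h\<bar> \<le> d" for h using that r0(3)[of s] by (simp add: d_def)
  define \<sigma> where "\<sigma> = sqrt (1 - s\<^sup>2)"
  have \<sigma>: "0 < \<sigma>" using one_minus_square_pos[OF s(1)] by (simp add: \<sigma>_def)
  define B where "B \<omega> = majorant r \<omega> / \<sigma>" for \<omega>
  \<comment> \<open>The summand 1 bounds the Blaschke factor. The summand \<open>1 / (1 - r)\<close>
    bounds the \<open>z\<close> part, where the \<open>\<sigma>\<close> in \<open>B\<close> cancels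
    the one in \<open>tau\<close>.\<close>
  define \<kappa> where "\<kappa> = 1 + 1 / (1 - r)"
  define C where "C \<omega> = (\<kappa> * majorant r \<omega>) ^ card T" for \<omega>
  define G where "G \<omega> z = (\<Prod>p\<in>T. blaschke p s * f p \<omega> + z * tau s p) * (\<Prod>q\<in>S. sgn (blaschke q s * f q \<omega> + z * tau s q))" for \<omega> z
  define G0 where "G0 \<omega> = (\<Prod>p\<in>T. blaschke p s * f p \<omega>) * (\<Prod>q\<in>S. sgn (blaschke q s * f q \<omega>))" for \<omega>
  have intG: "integrable MN (case_prod G)"
  proof -
    have "integrable M (\<lambda>\<omega>. (\<Prod>p\<in>T. f p \<omega>) * (\<Prod>q\<in>S. sgn (f q \<omega>)))"
      using integrable_prod_f_sgn[OF T, of "\<lambda>\<omega>. \<Prod>q\<in>S. sgn (f q \<omega>)"] abs_prod_sgn_le_1[of _ S]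
      by (simp add: mult.commute)
    moreover have "(\<lambda>x. (\<Prod>p\<in>T. x p) * (\<Prod>q\<in>S. sgn (x q))) \<in> borel_measurable (PiM (T \<union> S) (\<lambda>_. borel :: real measure))"
      by (intro borel_measurable_times borel_measurable_prod) measurable
    ultimately show ?thesis
      using blaschke_transfer(2)[of "T \<union> S" s "\<lambda>x. (\<Prod>p\<in>T. x p) * (\<Prod>q\<in>S. sgn (x q))"] T S s
      unfolding G_def by auto
  qed
  have lim: "((\<lambda>h. (?F (s + h) - ?F s) / h) \<circ> X) \<longlonglongrightarrow> ?D"
    if X: "\<forall>i. X i \<in> {-d<..<d} - {0}" "X \<longlonglongrightarrow> 0" for X
  proof -
    have X': "X i \<noteq> 0" "\<bar>X i\<bar> \<le> d" for i using X(1)[rule_format, of i] by auto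
    have Xs: "\<bar>s + X i\<bar> < 1" for i using sd[OF X'(2)[of i]] r by linarith
    define W where "W i \<omega> = f (s + X i) \<omega> / \<sigma>" for i \<omega>
    have eq: "((\<lambda>h. (?F (s + h) - ?F s) / h) \<circ> X) i =
      1 / X i * (\<integral>(\<omega>, z). (sgn (z + X i * W i \<omega>) - sgn z) * G \<omega> z \<partial>MN)" for i
    proof -
      define h where "h = X i"
      define J where "J = {s, s + h} \<union> T \<union> S"
      have J: "finite J" "\<And>p. p \<in> J \<Longrightarrow> \<bar>p\<bar> < 1" using T S s Xs[of i] by (auto simp: J_def h_def)
      define \<Psi> :: "(real \<Rightarrow> real) \<Rightarrow> real" where
        "\<Psi> x = (sgn (x (s + h)) - sgn (x s)) * ((\<Prod>p\<in>T. x p) * (\<Prod>q\<in>S. sgn (x q)))" for x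
      have inJ: "s \<in> J" "s + h \<in> J" "\<And>p. p \<in> T \<Longrightarrow> p \<in> J" "\<And>q. q \<in> S \<Longrightarrow> q \<in> J" by (auto simp: J_def)
      have m: "\<Psi> \<in> borel_measurable (PiM J (\<lambda>_. borel))"
        unfolding \<Psi>_def using inJ by (intro borel_measurable_times borel_measurable_prod borel_measurable_diff) measurable
      have int: "integrable M (\<lambda>\<omega>. sgn (f u \<omega>) * ((\<Prod>p\<in>T. f p \<omega>) * (\<Prod>q\<in>S. sgn (f q \<omega>))))" for u
      proof -
        have "\<bar>sgn (f u \<omega>) * (\<Prod>q\<in>S. sgn (f q \<omega>))\<bar> \<le> 1" for \<omega>
          using abs_prod_sgn_le_1[of "\<lambda>q. f q \<omega>" S] by (simp add: abs_mult sgn_if)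
        then show ?thesis
          using integrable_prod_f_sgn[OF T, of "\<lambda>\<omega>. sgn (f u \<omega>) * (\<Prod>q\<in>S. sgn (f q \<omega>))"] by (simp add: mult_ac)
      qed
      have "?F (s + h) - ?F s = (\<integral>\<omega>. \<Psi> (\<lambda>p. f p \<omega>) \<partial>M)"
        using int by (simp add: \<Psi>_def left_diff_distrib)
      also have "\<dots> = (\<integral>(\<omega>, z). \<Psi> (\<lambda>p. blaschke p s * f p \<omega> + z * tau s p) \<partial>MN)"
        using inJ by (intro blaschke_transfer(1)[OF J s(1) m]) (auto simp: \<Psi>_def intro!: arg_cong2[of _ _ _ _ "(*)"] prod.cong)
      also have "\<dots> = (\<integral>(\<omega>, z). (sgn (z + h * W i \<omega>) - sgn z) * G \<omega> z \<partial>MN)"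
      proof -
        have t: "0 < tau s (s + h)" "0 < tau s s" using tau_pos s(1) Xs[of i] by (auto simp: h_def)
        \<comment> \<open>Both \<open>blaschke (s + h) s\<close> and \<open>tau s (s + h)\<close>
          have the denominator \<open>1 - s * (s + h)\<close>. The positive factor
          \<open>tau s (s + h)\<close> comes out and does not affect the sign.\<close>
        have "blaschke (s + h) s = h / \<sigma> * tau s (s + h)"
          using \<sigma> by (simp add: blaschke_def tau_def \<sigma>_def mult.commute)
        then have "blaschke (s + h) s * f (s + h) \<omega> + z * tau s (s + h) = tau s (s + h) * (z + h * W i \<omega>)" for \<omega> z
          by (simp add: W_def h_def algebra_simps)
        then have "sgn (blaschke (s + h) s * f (s + h) \<omega> + z * tau s (s + h)) = sgn (z + h * W i \<omega>)" for \<omega> z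
          using t(1) by (simp add: sgn_mult)
        moreover have "sgn (blaschke s s * f s \<omega> + z * tau s s) = sgn z" for \<omega> z
          using t(2) by (simp add: sgn_mult)
        ultimately show ?thesis by (simp add: \<Psi>_def G_def)
      qed
      finally show ?thesis by (simp add: h_def)
    qed
    have "(\<lambda>i. 1 / X i * (\<integral>(\<omega>, z). (sgn (z + X i * W i \<omega>) - sgn z) * G \<omega> z \<partial>MN))
        \<longlonglongrightarrow> sqrt (2 / pi) * (\<integral>\<omega>. f s \<omega> / \<sigma> * G0 \<omega> \<partial>M)"
    proof (rule sgn_increment_limit[where B = B and C = C])
      show "AE \<omega> in M. (\<lambda>i. W i \<omega>) \<longlonglongrightarrow> f s \<omega> / \<sigma>"
        using AE_good
      proof eventually_elim
        case (elim \<omega>)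
        have "(\<lambda>i. s + X i) \<longlonglongrightarrow> s" using tendsto_add[OF tendsto_const X(2), of s] by simp
        then have "(\<lambda>i. f (s + X i) \<omega>) \<longlonglongrightarrow> f s \<omega>"
          using isCont_tendsto_compose[OF good_isCont[OF elim s(1)]] by blast
        then show ?case using \<sigma> unfolding W_def by (intro tendsto_divide tendsto_const) auto
      qed
      show "AE \<omega> in M. \<forall>i. \<bar>W i \<omega>\<bar> \<le> B \<omega>"
        using AE_good
      proof eventually_elim
        case (elim \<omega>)
        show ?case using good_majorant[OF elim sd[OF X'(2)] r(2)] \<sigma> by (auto simp: W_def B_def abs_mult divide_right_mono)
      qed
      have "AE \<omega> in M. \<forall>q\<in>S. f q \<omega> \<noteq> 0" using S by (intro AE_finite_allI AE_f_nonzero)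
      then show "AE \<omega> in M. \<forall>x. (\<lambda>i. G \<omega> (X i * x)) \<longlonglongrightarrow> G0 \<omega>"
      proof eventually_elim
        case (elim \<omega>)
        show ?case
        proof
          fix x
          have "(\<lambda>i. X i * x) \<longlonglongrightarrow> 0" using tendsto_mult_right[OF X(2), of x] by simp
          then have l: "(\<lambda>i. blaschke p s * f p \<omega> + X i * x * tau s p) \<longlonglongrightarrow> blaschke p s * f p \<omega>" for p
            using tendsto_add[OF tendsto_const tendsto_mult_right] by fastforce
          \<comment> \<open>As \<open>s\<close> is not in \<open>S\<close>, the limits of the
            arguments of \<open>sgn\<close> are nonzero, so \<open>sgn\<close> is continuous
            there.\<close>
          have "blaschke q s * f q \<omega> \<noteq> 0" if "q \<in> S" for q
            using that elim S(2)[OF that] s one_minus_mult_pos[of q s] by (auto simp: blaschke_def)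
          then show "(\<lambda>i. G \<omega> (X i * x)) \<longlonglongrightarrow> G0 \<omega>"
            unfolding G_def G0_def by (intro tendsto_mult tendsto_prod tendsto_sgn l) auto
        qed
      qed
      show "AE \<omega> in M. \<forall>i x. \<bar>x\<bar> \<le> B \<omega> \<longrightarrow> \<bar>G \<omega> (X i * x)\<bar> \<le> C \<omega>"
        using AE_good
      proof eventually_elim
        case (elim \<omega>)
        show ?case
        proof (intro allI impI)
          fix i x assume x: "\<bar>x\<bar> \<le> B \<omega>"
          have m0: "0 \<le> majorant r \<omega>" using majorant_nonneg[OF elim] r by simp
          have "\<bar>blaschke p s * f p \<omega> + X i * x * tau s p\<bar> \<le> \<kappa> * majorant r \<omega>" if p: "p \<in> T" for p
          proof -
            have "\<bar>blaschke p s * f p \<omega>\<bar> \<le> 1 * majorant r \<omega>"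
              unfolding abs_mult using p T s r good_majorant[OF elim] by (intro mult_mono abs_blaschke_le) auto
            moreover have "\<bar>X i * x * tau s p\<bar> \<le> 1 * (majorant r \<omega> / \<sigma>) * (\<sigma> / (1 - r))"
              unfolding abs_mult
            proof (intro mult_mono)
              have "\<bar>s * p\<bar> \<le> r * 1" unfolding abs_mult using r(4) r(1) T(2)[OF p] by (intro mult_mono) auto
              then have "1 - r \<le> 1 - s * p" by linarith
              then show "\<bar>tau s p\<bar> \<le> \<sigma> / (1 - r)"
                using r(2) \<sigma> unfolding tau_def \<sigma>_def[symmetric] abs_divide by (intro frac_le) auto
            qed (use X'(2)[of i] d x m0 \<sigma> in \<open>auto simp: B_def\<close>)
            ultimately have "\<bar>blaschke p s * f p \<omega>\<bar> + \<bar>X i * x * tau s p\<bar> \<le> \<kappa> * majorant r \<omega>"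
              using \<sigma> by (simp add: \<kappa>_def distrib_right)
            then show ?thesis using abs_triangle_ineq order_trans by blast
          qed
          then have "\<bar>\<Prod>p\<in>T. blaschke p s * f p \<omega> + X i * x * tau s p\<bar> \<le> C \<omega>"
            unfolding C_def by (intro abs_prod_le_power) auto
          moreover have "0 \<le> C \<omega>" using r m0 by (simp add: C_def \<kappa>_def)
          ultimately have "\<bar>G \<omega> (X i * x)\<bar> \<le> C \<omega> * 1"
            unfolding G_def abs_mult[of "prod _ _" "prod _ _"] using abs_prod_sgn_le_1 by (intro mult_mono) auto
          then show "\<bar>G \<omega> (X i * x)\<bar> \<le> C \<omega>" by simp
        qed
      qed
      have "integrable M (\<lambda>\<omega>. \<kappa> ^ card T / \<sigma> * majorant r \<omega> ^ Suc (card T))"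
        using integrable_majorant_power[OF r(1,2)] by (intro integrable_mult_right)
      then show "integrable M (\<lambda>\<omega>. B \<omega> * C \<omega>)"
        by (simp add: B_def C_def power_mult_distrib mult_ac)
      show "case_prod G \<in> borel_measurable (M \<Otimes>\<^sub>M borel)" "G0 \<in> borel_measurable M"
        unfolding G_def G0_def by (measurable)
      show "W i \<in> borel_measurable M" "(\<lambda>\<omega>. f s \<omega> / \<sigma>) \<in> borel_measurable M" for i
        unfolding W_def by measurable
    qed (use X X' intG prob_space_axioms in auto)
    also have "sqrt (2 / pi) * (\<integral>\<omega>. f s \<omega> / \<sigma> * G0 \<omega> \<partial>M) = ?D"
    proof -
      have "f s \<omega> / \<sigma> * G0 \<omega> = 1 / \<sigma> * ((\<Prod>p\<in>T. blaschke p s) * (\<Prod>q\<in>S. sgn (blaschke q s))) *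
          (f s \<omega> * ((\<Prod>p\<in>T. f p \<omega>) * (\<Prod>q\<in>S. sgn (f q \<omega>))))" for \<omega>
        by (simp add: G0_def prod.distrib sgn_mult)
      then have "(\<integral>\<omega>. f s \<omega> / \<sigma> * G0 \<omega> \<partial>M) = 1 / \<sigma> * ((\<Prod>p\<in>T. blaschke p s) * (\<Prod>q\<in>S. sgn (blaschke q s))) *
          (\<integral>\<omega>. f s \<omega> * ((\<Prod>p\<in>T. f p \<omega>) * (\<Prod>q\<in>S. sgn (f q \<omega>))) \<partial>M)"
        by (simp only: integral_mult_right_zero)
      then show ?thesis by (simp add: \<sigma>_def mult.assoc)
    qed
    finally show ?thesis unfolding eq[THEN ext] .
  qed
  \<comment> \<open>Dominated convergence speaks of sequences, so the derivative is tested along all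
    null sequences in a punctured neighbourhood of 0.\<close>
  have "((\<lambda>h. (?F (s + h) - ?F s) / h) \<longlongrightarrow> ?D) (at 0 within {-d<..<d})"
    unfolding tendsto_at_iff_sequentially using lim by blast
  then show ?thesis unfolding DERIV_def using d at_within_open[of 0 "{-d<..<d}"] by simp
qed

end

section \<open>Gaussian integration by parts against products of signs\<close>

lemma tau_self:
  assumes "\<bar>s\<bar> < 1" shows "tau s s = 1 / sqrt (1 - s\<^sup>2)"
proof -
  define q where "q = sqrt (1 - s\<^sup>2)"
  have "0 < q" "1 - s * s = q * q"
    using one_minus_square_pos[OF assms] by (simp_all add: q_def power2_eq_square)
  then show ?thesis unfolding tau_def q_def[symmetric] by simp
qed

context gaussian_series
begin

definition sgn_moment :: "real list \<Rightarrow> real" where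
  "sgn_moment xs = (\<integral>\<omega>. (\<Prod>q\<in>set xs. sgn (f q \<omega>)) \<partial>M)"

text \<open>The shift has the Cameron-Martin direction \<open>tau u\<close>: conditioning at
  \<open>u\<close> turns it into the translation of \<open>z\<close> by \<open>\<eta> i\<close>. The
  one-dimensional derivative brings down the factor \<open>z\<close>, which under this conditioning
  represents \<open>sqrt (1 - u\<^sup>2) * f u\<close>.\<close>

lemma gaussian_shift_limit:
  fixes x :: "nat \<Rightarrow> real"
  assumes x: "\<And>k. k < m \<Longrightarrow> \<bar>x k\<bar> < 1" and u: "\<bar>u\<bar> < 1"
    and \<eta>: "\<And>i. \<eta> i \<noteq> 0" "\<And>i. \<bar>\<eta> i\<bar> \<le> 1" "\<eta> \<longlonglongrightarrow> 0"
  shows "(\<lambda>i. 1 / \<eta> i * ((\<integral>\<omega>. (\<Prod>k<m. sgn (f (x k) \<omega> + sqrt (1 - u\<^sup>2) * \<eta> i / (1 - u * x k))) \<partial>M)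
        - (\<integral>\<omega>. (\<Prod>k<m. sgn (f (x k) \<omega>)) \<partial>M)))
      \<longlonglongrightarrow> sqrt (1 - u\<^sup>2) * (\<integral>\<omega>. f u \<omega> * (\<Prod>k<m. sgn (f (x k) \<omega>)) \<partial>M)"
proof -
  interpret N: prob_space stdN by (rule prob_space_std_normal)
  interpret P: pair_prob_space M stdN ..
  define c where "c = sqrt (1 - u\<^sup>2)"
  have c: "0 < c" using one_minus_square_pos[OF u] by (simp add: c_def)
  define H where "H \<omega> z = (\<Prod>k<m. sgn (blaschke (x k) u * f (x k) \<omega> + z * tau u (x k)))" for \<omega> z
  have H1: "\<bar>H \<omega> z\<bar> \<le> 1" for \<omega> z unfolding H_def by (rule abs_prod_sgn_le_1)
  have [measurable]: "case_prod H \<in> borel_measurable (M \<Otimes>\<^sub>M borel)" unfolding H_def by measurable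
  have Hz [measurable]: "H \<omega> \<in> borel_measurable borel" for \<omega> unfolding H_def by measurable
  have Hpair [measurable]: "(\<lambda>(\<omega>, z). H \<omega> (z + y)) \<in> borel_measurable MN" for y unfolding H_def by measurable
  define J where "J = insert u (x ` {..<m})"
  have J: "finite J" "\<And>p. p \<in> J \<Longrightarrow> \<bar>p\<bar> < 1" using x u by (auto simp: J_def)
  have intH: "integrable MN (\<lambda>(\<omega>, z). H \<omega> (z + y))" for y
    using H1 by (intro P.P.integrable_const_bound[of _ 1]) (auto intro!: AE_I2)
  have shift: "(\<integral>\<omega>. (\<Prod>k<m. sgn (f (x k) \<omega> + c * y / (1 - u * x k))) \<partial>M)
      = (\<integral>\<omega>. (\<integral>z. H \<omega> (z + y) \<partial>stdN) \<partial>M)" for y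
  proof -
    have "(\<integral>\<omega>. (\<Prod>k<m. sgn (f (x k) \<omega> + c * y / (1 - u * x k))) \<partial>M) =
      (\<integral>(\<omega>, z). (\<Prod>k<m. sgn (blaschke (x k) u * f (x k) \<omega> + z * tau u (x k) + c * y / (1 - u * x k))) \<partial>MN)"
      by (rule blaschke_transfer(1)[OF J u prod_sgn_measurable]) (auto simp: J_def)
    also have "\<dots> = (\<integral>(\<omega>, z). H \<omega> (z + y) \<partial>MN)"
      unfolding H_def by (simp add: tau_def c_def algebra_simps add_divide_distrib)
    also have "\<dots> = (\<integral>\<omega>. (\<integral>z. H \<omega> (z + y) \<partial>stdN) \<partial>M)"
      using P.integral_fst'[OF intH[of y]] by simp
    finally show ?thesis .
  qed
  define L where "L i \<omega> = 1 / \<eta> i * ((\<integral>z. H \<omega> (z + \<eta> i) \<partial>stdN) - (\<integral>z. H \<omega> z \<partial>stdN))" for i \<omega>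
  have int1: "integrable M (\<lambda>\<omega>. \<integral>z. H \<omega> (z + y) \<partial>stdN)" for y
    using P.integrable_fst'[OF intH[of y]] by simp
  have [measurable]: "(\<lambda>\<omega>. \<integral>z. H \<omega> (z + y) \<partial>stdN) \<in> borel_measurable M" for y
    using int1 by auto
  have int0: "integrable M (\<lambda>\<omega>. \<integral>z. H \<omega> z \<partial>stdN)" using int1[of 0] by simp
  have eq: "1 / \<eta> i * ((\<integral>\<omega>. (\<Prod>k<m. sgn (f (x k) \<omega> + c * \<eta> i / (1 - u * x k))) \<partial>M)
        - (\<integral>\<omega>. (\<Prod>k<m. sgn (f (x k) \<omega>)) \<partial>M)) = (\<integral>\<omega>. L i \<omega> \<partial>M)" for i
    using shift[of "\<eta> i"] shift[of 0] int1[of "\<eta> i"] int0 unfolding L_def by simp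
  have tau_u: "tau u u = 1 / c" using tau_self[OF u] by (simp add: c_def)
  have m: "(\<lambda>y :: real \<Rightarrow> real. y u * (\<Prod>k<m. sgn (y (x k) + 0))) \<in> borel_measurable (PiM J (\<lambda>_. borel))"
    by (intro borel_measurable_times prod_sgn_measurable measurable_component_singleton) (auto simp: J_def)
  note tr = blaschke_transfer[OF J u m]
  have form: "(\<lambda>(\<omega>, z). (blaschke u u * f u \<omega> + z * tau u u) *
      (\<Prod>k<m. sgn (blaschke (x k) u * f (x k) \<omega> + z * tau u (x k) + 0))) = (\<lambda>x. 1 / c * (case x of (\<omega>, z) \<Rightarrow> z * H \<omega> z))"
    by (auto simp: tau_u H_def)
  have "integrable M (\<lambda>\<omega>. f u \<omega> * (\<Prod>k<m. sgn (f (x k) \<omega> + 0)))"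
    using integrable_prod_f_sgn[of "{u}" "\<lambda>\<omega>. \<Prod>k<m. sgn (f (x k) \<omega>)", OF _ _ _ abs_prod_sgn_le_1] u
    by (simp add: mult.commute)
  then have "integrable MN (\<lambda>x. 1 / c * (case x of (\<omega>, z) \<Rightarrow> z * H \<omega> z))"
    using tr(2) unfolding form by (auto simp: J_def)
  then have "integrable MN (\<lambda>x. c * (1 / c * (case x of (\<omega>, z) \<Rightarrow> z * H \<omega> z)))"
    by (rule integrable_mult_right)
  then have intz: "integrable MN (\<lambda>(\<omega>, z). z * H \<omega> z)"
    using c by (simp del: mult_divide_mult_cancel_left_if times_divide_eq_left)
  have "(\<lambda>i. \<integral>\<omega>. L i \<omega> \<partial>M) \<longlonglongrightarrow> (\<integral>\<omega>. (\<integral>z. z * H \<omega> z \<partial>stdN) \<partial>M)"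
  proof (rule integral_dominated_convergence[where w = "\<lambda>_. 4 * (\<integral>z. (\<bar>z\<bar> + 1) * normal_density 0 (sqrt 2) z \<partial>lborel)"])
    show "AE \<omega> in M. (\<lambda>i. L i \<omega>) \<longlonglongrightarrow> (\<integral>z. z * H \<omega> z \<partial>stdN)"
      unfolding L_def using H1 \<eta> by (intro AE_I2 gaussian_shift_inner(1)) auto
    show "AE \<omega> in M. norm (L i \<omega>) \<le> 4 * (\<integral>z. (\<bar>z\<bar> + 1) * normal_density 0 (sqrt 2) z \<partial>lborel)" for i
      unfolding L_def real_norm_def using H1 \<eta> by (intro AE_I2 gaussian_shift_inner(2)) auto
    show "L i \<in> borel_measurable M" for i unfolding L_def using int1 int0 by measurable
    show "(\<lambda>\<omega>. \<integral>z. z * H \<omega> z \<partial>stdN) \<in> borel_measurable M"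
      using P.integrable_fst'[OF intz] by auto
  qed simp
  also have "(\<integral>\<omega>. (\<integral>z. z * H \<omega> z \<partial>stdN) \<partial>M) = (\<integral>(\<omega>, z). z * H \<omega> z \<partial>MN)"
    using P.integral_fst'[OF intz] by simp
  also have "\<dots> = c * (\<integral>\<omega>. f u \<omega> * (\<Prod>k<m. sgn (f (x k) \<omega>)) \<partial>M)"
  proof -
    have "(\<integral>\<omega>. f u \<omega> * (\<Prod>k<m. sgn (f (x k) \<omega> + 0)) \<partial>M) = (\<integral>x. 1 / c * (case x of (\<omega>, z) \<Rightarrow> z * H \<omega> z) \<partial>MN)"
      using tr(1) unfolding form by (auto simp: J_def)
    also have "\<dots> = 1 / c * (\<integral>(\<omega>, z). z * H \<omega> z \<partial>MN)"
      by (rule integral_mult_right_zero)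
    finally show ?thesis using c by simp
  qed
  finally show ?thesis unfolding eq[symmetric] unfolding c_def .
qed

text \<open>Conditioning at \<open>x j\<close> makes the increment of this factor an increment in
  \<open>z\<close> of constant size \<open>w\<close>. The other factors are evaluated at
  \<open>z = 0\<close>, where their Blaschke factors contribute only the signs of
  \<open>x k - x j\<close>.\<close>

lemma sgn_shift_term_limit:
  fixes x :: "nat \<Rightarrow> real"
  assumes x: "\<And>k. k < m \<Longrightarrow> \<bar>x k\<bar> < 1" "inj_on x {..<m}" and j: "j < m"
    and \<eta>: "\<And>i. \<eta> i \<noteq> 0" "\<eta> \<longlonglongrightarrow> 0"
  shows "(\<lambda>i. 1 / \<eta> i * (\<integral>\<omega>. (sgn (f (x j) \<omega> + \<eta> i * v j) - sgn (f (x j) \<omega>)) *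
        ((\<Prod>k<j. sgn (f (x k) \<omega> + \<eta> i * v k)) * (\<Prod>k\<in>{j<..<m}. sgn (f (x k) \<omega>))) \<partial>M))
      \<longlonglongrightarrow> sqrt (2 / pi) * (v j * sqrt (1 - (x j)\<^sup>2)) * ((\<Prod>k\<in>{..<m} - {j}. sgn (x k - x j)) *
        (\<integral>\<omega>. (\<Prod>k\<in>{..<m} - {j}. sgn (f (x k) \<omega>)) \<partial>M))"
proof -
  interpret N: prob_space stdN by (rule prob_space_std_normal)
  interpret P: pair_prob_space M stdN ..
  define s where "s = x j"
  define J where "J = x ` {..<m}"
  have J: "finite J" "\<And>p. p \<in> J \<Longrightarrow> \<bar>p\<bar> < 1" and s: "\<bar>s\<bar> < 1" using x j by (auto simp: J_def s_def)
  have inJ: "x k \<in> J" if "k < m" for k using that by (auto simp: J_def)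
  define \<tau> where "\<tau> = tau s s"
  have \<tau>: "0 < \<tau>" using tau_pos[OF s s] by (simp add: \<tau>_def)
  have \<tau>_inv: "1 / \<tau> = sqrt (1 - s\<^sup>2)" by (simp add: \<tau>_def tau_self[OF s])
  \<comment> \<open>After conditioning, \<open>f (x j)\<close> is \<open>\<tau> * z\<close>, so a
    shift of it by \<open>\<eta> i * v j\<close> is a shift of \<open>z\<close> by
    \<open>\<eta> i * w\<close>.\<close>
  define w where "w = v j / \<tau>"
  define G where "G i \<omega> z = (\<Prod>k<j. sgn (blaschke (x k) s * f (x k) \<omega> + z * tau s (x k) + \<eta> i * v k))
      * (\<Prod>k\<in>{j<..<m}. sgn (blaschke (x k) s * f (x k) \<omega> + z * tau s (x k) + 0))" for i \<omega> z
  define G0 where "G0 \<omega> = (\<Prod>k<j. sgn (blaschke (x k) s * f (x k) \<omega>)) * (\<Prod>k\<in>{j<..<m}. sgn (blaschke (x k) s * f (x k) \<omega>))" for \<omega>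
  have G1: "\<bar>G i \<omega> z\<bar> \<le> 1" for i \<omega> z
  proof -
    have "\<bar>G i \<omega> z\<bar> \<le> 1 * 1"
      unfolding G_def abs_mult[of "prod _ _" "prod _ _"] by (intro mult_mono abs_prod_sgn_le_1) auto
    then show ?thesis by simp
  qed
  have Gm [measurable]: "case_prod (G i) \<in> borel_measurable (M \<Otimes>\<^sub>M borel)" for i unfolding G_def by measurable
  have Gm' [measurable]: "case_prod (G i) \<in> borel_measurable MN" for i unfolding G_def by measurable
  have eq: "(\<integral>\<omega>. (sgn (f (x j) \<omega> + \<eta> i * v j) - sgn (f (x j) \<omega> + 0)) *
        ((\<Prod>k<j. sgn (f (x k) \<omega> + \<eta> i * v k)) * (\<Prod>k\<in>{j<..<m}. sgn (f (x k) \<omega> + 0))) \<partial>M)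
      = (\<integral>(\<omega>, z). (sgn (z + \<eta> i * w) - sgn z) * G i \<omega> z \<partial>MN)" for i
  proof -
    define \<Psi> :: "(real \<Rightarrow> real) \<Rightarrow> real" where "\<Psi> y = (sgn (y (x j) + \<eta> i * v j) - sgn (y (x j) + 0)) *
        ((\<Prod>k<j. sgn (y (x k) + \<eta> i * v k)) * (\<Prod>k\<in>{j<..<m}. sgn (y (x k) + 0)))" for y
    have "(\<lambda>y. sgn (y (x j) + c)) \<in> borel_measurable (PiM J (\<lambda>_. borel :: real measure))" for c
      using prod_sgn_measurable[of "{j}" x J "\<lambda>_. c"] inJ j by simp
    then have m: "\<Psi> \<in> borel_measurable (PiM J (\<lambda>_. borel))"
      unfolding \<Psi>_def using inJ j by (intro borel_measurable_times borel_measurable_diff prod_sgn_measurable) auto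
    have "\<Psi> (restrict y J) = \<Psi> y" for y
      unfolding \<Psi>_def using inJ j by (intro arg_cong2[of _ _ _ _ "(*)"] prod.cong) auto
    then have "(\<integral>\<omega>. \<Psi> (\<lambda>p. f p \<omega>) \<partial>M) = (\<integral>(\<omega>, z). \<Psi> (\<lambda>p. blaschke p s * f p \<omega> + z * tau s p) \<partial>MN)"
      by (intro blaschke_transfer(1)[OF J s m])
    also have "\<dots> = (\<integral>(\<omega>, z). (sgn (z + \<eta> i * w) - sgn z) * G i \<omega> z \<partial>MN)"
    proof -
      have "blaschke s s * f s \<omega> + z * tau s s + \<eta> i * v j = \<tau> * (z + \<eta> i * w)"
           "blaschke s s * f s \<omega> + z * tau s s + 0 = \<tau> * z" for \<omega> z
        using \<tau> by (simp_all add: w_def \<tau>_def algebra_simps)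
      then have "sgn (blaschke s s * f s \<omega> + z * tau s s + \<eta> i * v j) = sgn (z + \<eta> i * w)"
         "sgn (blaschke s s * f s \<omega> + z * tau s s + 0) = sgn z" for \<omega> z
        using \<tau> by (simp_all only: sgn_mult sgn_pos mult_1)
      then show ?thesis unfolding \<Psi>_def s_def[symmetric] G_def by (simp only:)
    qed
    finally show ?thesis unfolding \<Psi>_def .
  qed
  have "(\<lambda>i. 1 / \<eta> i * (\<integral>(\<omega>, z). (sgn (z + \<eta> i * w) - sgn z) * G i \<omega> z \<partial>MN)) \<longlonglongrightarrow> sqrt (2 / pi) * (\<integral>\<omega>. w * G0 \<omega> \<partial>M)"
  proof (rule sgn_increment_limit[where B = "\<lambda>_. \<bar>w\<bar>" and C = "\<lambda>_. 1"])
    have "AE \<omega> in M. \<forall>k\<in>{..<m}. f (x k) \<omega> \<noteq> 0" using x by (intro AE_finite_allI AE_f_nonzero) auto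
    then show "AE \<omega> in M. \<forall>y. (\<lambda>i. G i \<omega> (\<eta> i * y)) \<longlonglongrightarrow> G0 \<omega>"
    proof eventually_elim
      case (elim \<omega>)
      show ?case
      proof
        fix y
        have l1: "(\<lambda>i. \<eta> i * y) \<longlonglongrightarrow> 0" for y using tendsto_mult_right[OF \<eta>(2), of y] by simp
        have l: "(\<lambda>i. \<beta> + \<eta> i * y * t + \<eta> i * r) \<longlonglongrightarrow> \<beta>" for \<beta> t r
          using tendsto_add[OF tendsto_add[OF tendsto_const[of \<beta>] l1[of "y * t"]] l1[of r]] by (simp add: mult.assoc)
        have l0: "(\<lambda>i. \<beta> + \<eta> i * y * t + 0) \<longlonglongrightarrow> \<beta>" for \<beta> t
          using l[of \<beta> t 0] by simp
        have "blaschke (x k) s * f (x k) \<omega> \<noteq> 0" if "k < m" "k \<noteq> j" for k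
        proof -
          have "x k \<noteq> s" using that j x(2) by (auto simp: inj_on_def s_def)
          then show ?thesis using elim that s x(1)[OF that(1)] one_minus_mult_pos[of "x k" s] by (auto simp: blaschke_def)
        qed
        then show "(\<lambda>i. G i \<omega> (\<eta> i * y)) \<longlonglongrightarrow> G0 \<omega>"
          unfolding G_def G0_def using j by (intro tendsto_mult tendsto_prod tendsto_sgn l l0) auto
      qed
    qed
    show "integrable MN (case_prod (G i))" for i
      using G1 by (intro P.P.integrable_const_bound[of _ 1]) (auto intro!: AE_I2)
    show "G0 \<in> borel_measurable M" unfolding G0_def by measurable
  qed (use \<eta> G1 prob_space_axioms Gm in auto)
  also have "(\<integral>\<omega>. w * G0 \<omega> \<partial>M) = v j * sqrt (1 - s\<^sup>2) * ((\<Prod>k\<in>{..<m} - {j}. sgn (x k - s)) * (\<integral>\<omega>. (\<Prod>k\<in>{..<m} - {j}. sgn (f (x k) \<omega>)) \<partial>M))"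
  proof -
    have split: "{..<m} - {j} = {..<j} \<union> {j<..<m}" using j by auto
    have "G0 \<omega> = (\<Prod>k\<in>{..<m} - {j}. sgn (blaschke (x k) s * f (x k) \<omega>))" for \<omega>
      unfolding split G0_def by (subst prod.union_disjoint) auto
    also have "(\<Prod>k\<in>{..<m} - {j}. sgn (blaschke (x k) s * f (x k) \<omega>)) =
      (\<Prod>k\<in>{..<m} - {j}. sgn (x k - s)) * (\<Prod>k\<in>{..<m} - {j}. sgn (f (x k) \<omega>))" for \<omega>
      unfolding prod.distrib[symmetric]
    proof (rule prod.cong)
      fix k assume "k \<in> {..<m} - {j}"
      then have "0 < 1 - x k * s" using x s one_minus_mult_pos by auto
      then show "sgn (blaschke (x k) s * f (x k) \<omega>) = sgn (x k - s) * sgn (f (x k) \<omega>)"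
        by (simp add: sgn_mult blaschke_def sgn_divide)
    qed simp
    finally have "w * G0 \<omega> = v j * sqrt (1 - s\<^sup>2) * (\<Prod>k\<in>{..<m} - {j}. sgn (x k - s)) * (\<Prod>k\<in>{..<m} - {j}. sgn (f (x k) \<omega>))" for \<omega>
      using \<tau>_inv by (simp add: w_def divide_inverse)
    then show ?thesis by (simp only: integral_mult_right_zero mult.assoc)
  qed
  finally show ?thesis using eq by (simp add: s_def mult.assoc)
qed

text \<open>The derivative of one shifted expectation is computed twice: by translating
  \<open>z\<close> at \<open>u\<close>, and by exchanging the shifted sign factors one at a time.
  The coefficient of term \<open>j\<close> is the jump 2 times the density of \<open>f (x j)\<close>
  at 0 times the covariance of \<open>f u\<close> and \<open>f (x j)\<close>.\<close>

lemma gaussian_ibp: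
  fixes x :: "nat \<Rightarrow> real"
  assumes x: "\<And>k. k < m \<Longrightarrow> \<bar>x k\<bar> < 1" "inj_on x {..<m}" and u: "\<bar>u\<bar> < 1"
  shows "(\<integral>\<omega>. f u \<omega> * (\<Prod>k<m. sgn (f (x k) \<omega>)) \<partial>M) =
    (\<Sum>j<m. sqrt (2 / pi) * (sqrt (1 - (x j)\<^sup>2) / (1 - u * x j)) * ((\<Prod>k\<in>{..<m} - {j}. sgn (x k - x j)) *
        (\<integral>\<omega>. (\<Prod>k\<in>{..<m} - {j}. sgn (f (x k) \<omega>)) \<partial>M)))"
proof -
  define c where "c = sqrt (1 - u\<^sup>2)"
  have c: "0 < c" using one_minus_square_pos[OF u] by (simp add: c_def)
  \<comment> \<open>This is \<open>tau u (x k)\<close>, the direction of the shift.\<close>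
  define v where "v k = c / (1 - u * x k)" for k
  define \<eta> :: "nat \<Rightarrow> real" where "\<eta> i = inverse (Suc i)" for i
  have \<eta>: "\<And>i. \<eta> i \<noteq> 0" "\<And>i. \<bar>\<eta> i\<bar> \<le> 1" by (auto simp: \<eta>_def field_simps)
  have \<eta>0: "\<eta> \<longlonglongrightarrow> 0" unfolding \<eta>_def[abs_def] by (rule LIMSEQ_inverse_real_of_nat)
  define D where "D i j \<omega> = (sgn (f (x j) \<omega> + \<eta> i * v j) - sgn (f (x j) \<omega>)) *
        ((\<Prod>k<j. sgn (f (x k) \<omega> + \<eta> i * v k)) * (\<Prod>k\<in>{j<..<m}. sgn (f (x k) \<omega>)))" for i j \<omega>
  have D_le: "\<bar>D i j \<omega>\<bar> \<le> 2" for i j \<omega>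
  proof -
    have "\<bar>D i j \<omega>\<bar> \<le> 2 * (1 * 1)"
      unfolding D_def abs_mult[of "_ - _"] abs_mult[of "prod _ _" "prod _ _"]
      by (intro mult_mono abs_prod_sgn_le_1) (auto simp: sgn_if)
    then show ?thesis by simp
  qed
  have [measurable]: "D i j \<in> borel_measurable M" for i j unfolding D_def by measurable
  have intD: "integrable M (D i j)" for i j
    using D_le by (intro integrable_const_bound[of _ 2]) (auto intro!: AE_I2)
  have sgn_int: "integrable M (\<lambda>\<omega>. \<Prod>k<m. sgn (f (x k) \<omega> + r k))" for r
    using abs_prod_sgn_le_1 by (intro integrable_const_bound[of _ 1]) (auto intro!: AE_I2)
  have sgn_int0: "integrable M (\<lambda>\<omega>. \<Prod>k<m. sgn (f (x k) \<omega>))" using sgn_int[of "\<lambda>_. 0"] by simp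
  have "(\<integral>\<omega>. (\<Prod>k<m. sgn (f (x k) \<omega> + \<eta> i * v k)) \<partial>M) - (\<integral>\<omega>. (\<Prod>k<m. sgn (f (x k) \<omega>)) \<partial>M)
      = (\<Sum>j<m. \<integral>\<omega>. D i j \<omega> \<partial>M)" for i
  proof -
    have "(\<integral>\<omega>. (\<Prod>k<m. sgn (f (x k) \<omega> + \<eta> i * v k)) \<partial>M) - (\<integral>\<omega>. (\<Prod>k<m. sgn (f (x k) \<omega>)) \<partial>M)
       = (\<integral>\<omega>. (\<Sum>j<m. D i j \<omega>) \<partial>M)"
      unfolding D_def prod_diff_telescope[symmetric] using sgn_int sgn_int0 by simp
    then show ?thesis using intD by simp
  qed
  then have eq: "1 / \<eta> i * ((\<integral>\<omega>. (\<Prod>k<m. sgn (f (x k) \<omega> + sqrt (1 - u\<^sup>2) * \<eta> i / (1 - u * x k))) \<partial>M)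
        - (\<integral>\<omega>. (\<Prod>k<m. sgn (f (x k) \<omega>)) \<partial>M)) = (\<Sum>j<m. 1 / \<eta> i * (\<integral>\<omega>. D i j \<omega> \<partial>M))" for i
    by (simp add: v_def c_def sum_distrib_left mult.commute)
  have "(\<lambda>i. \<Sum>j<m. 1 / \<eta> i * (\<integral>\<omega>. D i j \<omega> \<partial>M)) \<longlonglongrightarrow> (\<Sum>j<m. sqrt (2 / pi) * (v j * sqrt (1 - (x j)\<^sup>2)) *
      ((\<Prod>k\<in>{..<m} - {j}. sgn (x k - x j)) * (\<integral>\<omega>. (\<Prod>k\<in>{..<m} - {j}. sgn (f (x k) \<omega>)) \<partial>M)))"
    unfolding D_def using x \<eta> \<eta>0 by (intro tendsto_sum sgn_shift_term_limit) auto
  moreover have "(\<lambda>i. \<Sum>j<m. 1 / \<eta> i * (\<integral>\<omega>. D i j \<omega> \<partial>M)) \<longlonglongrightarrow> c * (\<integral>\<omega>. f u \<omega> * (\<Prod>k<m. sgn (f (x k) \<omega>)) \<partial>M)"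
    using gaussian_shift_limit[of m x u \<eta>, OF x(1) u \<eta> \<eta>0] unfolding eq c_def .
  ultimately have "c * (\<integral>\<omega>. f u \<omega> * (\<Prod>k<m. sgn (f (x k) \<omega>)) \<partial>M) = (\<Sum>j<m. sqrt (2 / pi) * (v j * sqrt (1 - (x j)\<^sup>2)) *
      ((\<Prod>k\<in>{..<m} - {j}. sgn (x k - x j)) * (\<integral>\<omega>. (\<Prod>k\<in>{..<m} - {j}. sgn (f (x k) \<omega>)) \<partial>M)))"
    using LIMSEQ_unique by blast
  also have "\<dots> = c * (\<Sum>j<m. sqrt (2 / pi) * (sqrt (1 - (x j)\<^sup>2) / (1 - u * x j)) * ((\<Prod>k\<in>{..<m} - {j}. sgn (x k - x j)) *
        (\<integral>\<omega>. (\<Prod>k\<in>{..<m} - {j}. sgn (f (x k) \<omega>)) \<partial>M)))"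
    unfolding sum_distrib_left by (intro sum.cong) (simp_all add: v_def)
  finally show ?thesis using c by simp
qed

end

section \<open>Sign moments\<close>

text \<open>Tag 1 stands for the sign of \<open>f\<close> at the point, tag 0 for the result of
  differentiating in that point. The tags depend on the position in the list, so the kernel takes
  them as arguments.\<close>

definition kappa :: "nat \<Rightarrow> nat \<Rightarrow> real \<Rightarrow> real \<Rightarrow> real" where
  "kappa k l s t = K_kernel s t $$ (if k = 0 then 0 else 1, if l = 0 then 0 else 1)"

lemma kappa_simps:
  "kappa 0 0 s t = (s - t) / (sqrt ((1 - s\<^sup>2) * (1 - t\<^sup>2)) * (1 - s * t)\<^sup>2)"
  "0 < l \<Longrightarrow> kappa 0 l s t = sqrt ((1 - t\<^sup>2) / (1 - s\<^sup>2)) * (1 / (1 - s * t))"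
  "0 < k \<Longrightarrow> kappa k 0 s t = - sqrt ((1 - s\<^sup>2) / (1 - t\<^sup>2)) * (1 / (1 - s * t))"
  "0 < k \<Longrightarrow> 0 < l \<Longrightarrow> kappa k l s t = sgn (t - s) * arcsin (c_kernel s t)"
  by (simp_all add: kappa_def K_kernel_def mat_of_rows_list_def)

lemma c_kernel_commute: "c_kernel s t = c_kernel t s"
  by (simp add: c_kernel_def mult.commute)

lemma kappa_skew: "kappa l k t s = - kappa k l s t"
proof -
  have sgn: "sgn (s - t) = - sgn (t - s)" by (simp add: sgn_if)
  have "(t - s) / (sqrt ((1 - t\<^sup>2) * (1 - s\<^sup>2)) * (1 - t * s)\<^sup>2) = - ((s - t) / (sqrt ((1 - s\<^sup>2) * (1 - t\<^sup>2)) * (1 - s * t)\<^sup>2))"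
    by (simp only: mult.commute[of "1 - t\<^sup>2"] mult.commute[of t s] minus_diff_eq[of s t, symmetric] divide_minus_left)
  then show ?thesis
    by (cases "k = 0"; cases "l = 0") (simp_all add: kappa_simps c_kernel_commute[of t s] mult.commute[of t s] sgn)
qed

lemma has_derivative_c_kernel:
  assumes u: "\<bar>u\<bar> < 1" and t: "\<bar>t\<bar> < 1"
  shows "((\<lambda>u. c_kernel u t) has_real_derivative sqrt (1 - t\<^sup>2) * (t - u) / (sqrt (1 - u\<^sup>2) * (1 - u * t)\<^sup>2)) (at u)"
proof -
  have p: "0 < 1 - u\<^sup>2" "0 < 1 - u * t" using one_minus_square_pos[OF u] one_minus_mult_pos[OF u t] by auto
  define g where "g = sqrt (1 - u\<^sup>2)"
  define e where "e = 1 - u * t"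
  have g: "0 < g" "g * g = 1 - u\<^sup>2" and e: "e \<noteq> 0" using p by (auto simp: g_def e_def)
  have "((\<lambda>u. sqrt (1 - u\<^sup>2)) has_real_derivative - u / g) (at u)"
    unfolding g_def using p by (auto intro!: derivative_eq_intros simp: field_simps)
  moreover have "((\<lambda>u. 1 - u * t) has_real_derivative - t) (at u)"
    by (auto intro!: derivative_eq_intros)
  ultimately have "((\<lambda>u. sqrt (1 - u\<^sup>2) / (1 - u * t)) has_real_derivative
     ((- u / g) * e - g * (- t)) / (e * e)) (at u)"
    unfolding g_def e_def using p by (intro DERIV_divide) auto
  moreover have "(- u / g) * e - g * (- t) = (t - u) / g"
  proof -
    have "((- u / g) * e - g * (- t)) * g = - u * e + (g * g) * t" using g by (simp add: field_simps)
    also have "\<dots> = t - u" unfolding g(2) e_def by (simp add: algebra_simps power2_eq_square)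
    finally show ?thesis using g(1) by (simp add: nonzero_eq_divide_eq)
  qed
  ultimately have "((\<lambda>u. sqrt (1 - u\<^sup>2) / (1 - u * t)) has_real_derivative (t - u) / (g * (e * e))) (at u)"
    by simp
  then have "((\<lambda>u. sqrt (1 - t\<^sup>2) * (sqrt (1 - u\<^sup>2) / (1 - u * t))) has_real_derivative
      sqrt (1 - t\<^sup>2) * ((t - u) / (g * (e * e)))) (at u)"
    by (rule DERIV_cmult)
  moreover have "c_kernel u t = sqrt (1 - t\<^sup>2) * (sqrt (1 - u\<^sup>2) / (1 - u * t))" for u
    by (simp add: c_kernel_def real_sqrt_mult)
  ultimately show ?thesis by (simp add: g_def e_def power2_eq_square)
qed

text \<open>\<open>c_kernel u t\<close> is the correlation coefficient of \<open>f u\<close> and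
  \<open>f t\<close>, and its complement is a squared Blaschke factor. The square root in the
  derivative of \<open>arcsin\<close> is thereby explicit.\<close>

lemma one_minus_c_kernel_square:
  assumes u: "\<bar>u\<bar> < 1" and t: "\<bar>t\<bar> < 1"
  shows "1 - (c_kernel u t)\<^sup>2 = ((t - u) / (1 - u * t))\<^sup>2"
proof -
  have p: "0 < 1 - u\<^sup>2" "0 < 1 - t\<^sup>2" "0 < 1 - u * t"
    using one_minus_square_pos one_minus_mult_pos u t by auto
  have "(c_kernel u t)\<^sup>2 = (1 - u\<^sup>2) * (1 - t\<^sup>2) / (1 - u * t)\<^sup>2"
    using p by (simp add: c_kernel_def power_divide less_imp_le)
  also have "(1 - u\<^sup>2) * (1 - t\<^sup>2) = (1 - u * t)\<^sup>2 - (t - u)\<^sup>2"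
    by (simp add: power2_eq_square algebra_simps)
  finally have "1 - (c_kernel u t)\<^sup>2 = 1 - ((1 - u * t)\<^sup>2 - (t - u)\<^sup>2) / (1 - u * t)\<^sup>2" by simp
  moreover have "1 - (e\<^sup>2 - d\<^sup>2) / e\<^sup>2 = (d / e)\<^sup>2" if "e \<noteq> 0" for d e :: real
    using that by (simp add: power_divide diff_divide_distrib)
  ultimately show ?thesis using p by simp
qed

lemma c_kernel_bounds:
  assumes u: "\<bar>u\<bar> < 1" and t: "\<bar>t\<bar> < 1"
  shows "0 < c_kernel u t" "c_kernel u t \<le> 1" "u \<noteq> t \<Longrightarrow> c_kernel u t < 1"
proof -
  have p: "0 < 1 - u\<^sup>2" "0 < 1 - t\<^sup>2" "0 < 1 - u * t"
    using one_minus_square_pos one_minus_mult_pos u t by auto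
  show 0: "0 < c_kernel u t" using p by (simp add: c_kernel_def)
  have "(c_kernel u t)\<^sup>2 \<le> 1" using one_minus_c_kernel_square[OF u t] zero_le_power2[of "(t - u) / (1 - u * t)"] by linarith
  then show "c_kernel u t \<le> 1" using power2_le_imp_le[of "c_kernel u t" 1] by simp
  assume "u \<noteq> t"
  then have "0 < ((t - u) / (1 - u * t))\<^sup>2" using p by simp
  then have "(c_kernel u t)\<^sup>2 < 1" using one_minus_c_kernel_square[OF u t] by linarith
  then show "c_kernel u t < 1" using power_less_imp_less_base[of "c_kernel u t" 2 1] by simp
qed

text \<open>The derivative of \<open>arcsin\<close> produces \<open>\<bar>t - u\<bar>\<close> in the
  denominator, while the derivative of \<open>c_kernel\<close> has \<open>t - u\<close> in the
  numerator. The factor \<open>sgn (t - u)\<close>, locally constant off the diagonal, cancels the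
  sign that is left.\<close>

lemma has_derivative_kappa_sgn:
  assumes u: "\<bar>u\<bar> < 1" and t: "\<bar>t\<bar> < 1" and "u \<noteq> t"
  shows "((\<lambda>u. kappa 1 1 u t) has_real_derivative kappa 0 1 u t) (at u)"
proof -
  have p: "0 < 1 - u\<^sup>2" "0 < 1 - t\<^sup>2" "0 < 1 - u * t"
    using one_minus_square_pos one_minus_mult_pos u t by auto
  define s where "s = sgn (t - u)"
  have sq: "sqrt (1 - (c_kernel u t)\<^sup>2) = \<bar>t - u\<bar> / (1 - u * t)"
    unfolding one_minus_c_kernel_square[OF u t] using p by (simp add: abs_divide)
  have "((\<lambda>u. arcsin (c_kernel u t)) has_real_derivative inverse (sqrt (1 - (c_kernel u t)\<^sup>2)) *
     (sqrt (1 - t\<^sup>2) * (t - u) / (sqrt (1 - u\<^sup>2) * (1 - u * t)\<^sup>2))) (at u)"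
    using c_kernel_bounds[OF u t] \<open>u \<noteq> t\<close>
    by (intro DERIV_chain2[OF DERIV_arcsin has_derivative_c_kernel[OF u t]]) auto
  then have "((\<lambda>u. s * arcsin (c_kernel u t)) has_real_derivative s * (inverse (sqrt (1 - (c_kernel u t)\<^sup>2)) *
     (sqrt (1 - t\<^sup>2) * (t - u) / (sqrt (1 - u\<^sup>2) * (1 - u * t)\<^sup>2)))) (at u)"
    by (rule DERIV_cmult)
  also have "s * (inverse (sqrt (1 - (c_kernel u t)\<^sup>2)) * (sqrt (1 - t\<^sup>2) * (t - u) / (sqrt (1 - u\<^sup>2) * (1 - u * t)\<^sup>2)))
      = kappa 0 1 u t"
  proof -
    have A: "s * (inverse (\<bar>x\<bar> / e) * (b * x / (g * e\<^sup>2))) = (s * x / \<bar>x\<bar>) * (b / g * (1 / e))"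
      if "e \<noteq> 0" for b g e x :: real
      using that by (simp add: power2_eq_square)
    have B: "s * (t - u) / \<bar>t - u\<bar> = 1" using \<open>u \<noteq> t\<close> by (simp add: s_def sgn_if)
    have "s * (inverse (\<bar>t - u\<bar> / e) * (b * (t - u) / (g * e\<^sup>2))) = b / g * (1 / e)"
      if "e \<noteq> 0" for b g e
      unfolding A[OF that] B mult_1 ..
    then show ?thesis using p unfolding sq by (simp add: kappa_simps real_sqrt_divide)
  qed
  finally have 1: "((\<lambda>u. s * arcsin (c_kernel u t)) has_real_derivative kappa 0 1 u t) (at u)" .
  show ?thesis
  proof (rule has_field_derivative_transform_within_open[OF 1])
    show "open (if u < t then {..<t} else {t<..})" "u \<in> (if u < t then {..<t} else {t<..})"
      using \<open>u \<noteq> t\<close> by auto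
    show "v \<in> (if u < t then {..<t} else {t<..}) \<Longrightarrow> s * arcsin (c_kernel v t) = kappa 1 1 v t" for v
      using \<open>u \<noteq> t\<close> by (auto simp: kappa_simps s_def split: if_splits)
  qed
qed

text \<open>As a function of its second argument, the mixed entry is \<open>c_kernel\<close> up to
  the constant \<open>1 / (1 - t\<^sup>2)\<close>.\<close>

lemma has_derivative_kappa_mixed:
  assumes u: "\<bar>u\<bar> < 1" and t: "\<bar>t\<bar> < 1"
  shows "((\<lambda>u. kappa 0 1 t u) has_real_derivative kappa 0 0 t u) (at u)"
proof -
  have p: "0 < 1 - u\<^sup>2" "0 < 1 - t\<^sup>2" "0 < 1 - u * t"
    using one_minus_square_pos one_minus_mult_pos u t by auto
  have eq: "kappa 0 1 t u = 1 / (1 - t\<^sup>2) * c_kernel u t" for u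
  proof -
    define b where "b = sqrt (1 - t\<^sup>2)"
    have b: "0 < b" "1 - t\<^sup>2 = b * b" using p by (auto simp: b_def)
    have k: "kappa 0 1 t u = sqrt ((1 - u\<^sup>2) / (1 - t\<^sup>2)) * (1 / (1 - t * u))" by (simp add: kappa_simps)
    show ?thesis
      unfolding c_kernel_def k real_sqrt_divide real_sqrt_mult b_def[symmetric] b(2)
      using b(1) by (simp add: mult.commute)
  qed
  have "((\<lambda>u. 1 / (1 - t\<^sup>2) * c_kernel u t) has_real_derivative
      1 / (1 - t\<^sup>2) * (sqrt (1 - t\<^sup>2) * (t - u) / (sqrt (1 - u\<^sup>2) * (1 - u * t)\<^sup>2))) (at u)"
    by (rule DERIV_cmult[OF has_derivative_c_kernel[OF u t]])
  also have "1 / (1 - t\<^sup>2) * (sqrt (1 - t\<^sup>2) * (t - u) / (sqrt (1 - u\<^sup>2) * (1 - u * t)\<^sup>2)) = kappa 0 0 t u"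
  proof -
    define b where "b = sqrt (1 - t\<^sup>2)"
    have b: "0 < b" "1 - t\<^sup>2 = b * b" using p by (auto simp: b_def)
    show ?thesis unfolding kappa_simps real_sqrt_mult b_def[symmetric] b(2) using b(1)
      by (simp add: mult.commute)
  qed
  finally show ?thesis unfolding eq .
qed

text \<open>Off the diagonal the whole matrix kernel arises from its arcsine entry: differentiation
  in a point turns the tag 1 of that point into 0.\<close>

lemma has_derivative_kappa:
  assumes "\<bar>u\<bar> < 1" "\<bar>t\<bar> < 1" "u \<noteq> t"
  shows "((\<lambda>u. kappa 1 k u t) has_real_derivative kappa 0 k u t) (at u)"
    and "((\<lambda>u. kappa k 1 t u) has_real_derivative kappa k 0 t u) (at u)"
proof -
  have "kappa 1 k = kappa 1 1" "kappa 0 k = kappa 0 1" if "k \<noteq> 0" using that by (auto simp: kappa_def fun_eq_iff)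
  moreover have "((\<lambda>u. kappa 1 0 u t) has_real_derivative kappa 0 0 u t) (at u)"
    unfolding kappa_skew[of 1 0 _ t] kappa_skew[of 0 0 u t]
    by (intro DERIV_minus has_derivative_kappa_mixed assms)
  ultimately show 1: "((\<lambda>u. kappa 1 k u t) has_real_derivative kappa 0 k u t) (at u)"
    using has_derivative_kappa_sgn[OF assms] by (cases "k = 0") simp_all
  show "((\<lambda>u. kappa k 1 t u) has_real_derivative kappa k 0 t u) (at u)"
    unfolding kappa_skew[of k 1 t] kappa_skew[of k 0 t] by (intro DERIV_minus 1)
qed

section \<open>Recursion and boundary values of sign moments\<close>

lemma prod_set_nth:
  assumes "distinct ys" shows "(\<Prod>q\<in>set ys. g q) = (\<Prod>k<length ys. g (ys ! k))"
  using prod.reindex_bij_betw[OF bij_betw_nth[OF assms refl refl], of g] by simp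

lemma prod_set_remove_nth:
  assumes "distinct ys" "j < length ys"
  shows "(\<Prod>q\<in>set (remove_nth j ys). g q) = (\<Prod>k\<in>{..<length ys} - {j}. g (ys ! k))"
proof -
  have "bij_betw ((!) ys) ({..<length ys} - {j}) (set ys - {ys ! j})"
    using bij_betw_nth[OF assms(1) refl refl] assms
    by (intro bij_betw_DiffI bij_betw_singletonI) (auto simp: bij_betw_def)
  then show ?thesis using prod.reindex_bij_betw[of _ _ _ g] set_remove_nth[OF assms] by metis
qed

lemma sorted_wrt_remove_nth:
  assumes "sorted_wrt P ys" "j < length ys" shows "sorted_wrt P (remove_nth j ys)"
  using assms by (auto simp: sorted_wrt_iff_nth_less nth_remove_nth insert_index_def)

text \<open>Exactly \<open>j\<close> entries lie below \<open>ys ! j\<close>. This turns the signs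
  from integration by parts into the alternating signs of the expansion along the first row.\<close>

lemma prod_sgn_sorted:
  fixes ys :: "real list"
  assumes "sorted_wrt (<) ys" "j < length ys"
  shows "(\<Prod>k\<in>{..<length ys} - {j}. sgn (ys ! k - ys ! j)) = (-1) ^ j"
proof -
  have eq: "{..<length ys} - {j} = {..<j} \<union> {j<..<length ys}" using assms by auto
  have "(\<Prod>k\<in>{..<length ys} - {j}. sgn (ys ! k - ys ! j)) =
    (\<Prod>k<j. sgn (ys ! k - ys ! j)) * (\<Prod>k\<in>{j<..<length ys}. sgn (ys ! k - ys ! j))"
    unfolding eq by (rule prod.union_disjoint) auto
  also have "(\<Prod>k<j. sgn (ys ! k - ys ! j)) = (\<Prod>k<j. -1)"
    using sorted_wrt_nth_less[OF assms(1), of _ j] assms(2) by (intro prod.cong) auto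
  also have "(\<Prod>k\<in>{j<..<length ys}. sgn (ys ! k - ys ! j)) = (\<Prod>k\<in>{j<..<length ys}. 1)"
    using sorted_wrt_nth_less[OF assms(1), of j] by (intro prod.cong) auto
  finally show ?thesis by simp
qed

lemma integral_sgn_std_normal: "(\<integral>z. sgn z \<partial>stdN) = 0"
proof -
  have 1: "(\<integral>z. sgn z \<partial>stdN) = (\<integral>z. std_normal_density z * sgn z \<partial>lborel)"
    by (subst integral_density) auto
  have "(\<integral>z. std_normal_density z * sgn z \<partial>lborel) = (\<integral>z. std_normal_density (- z) * sgn (- z) \<partial>lborel)"
    using lborel_integral_real_affine[of "-1" "\<lambda>z. std_normal_density z * sgn z" 0] by simp
  also have "\<dots> = - (\<integral>z. std_normal_density z * sgn z \<partial>lborel)"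
    by (simp add: std_normal_density_def sgn_minus)
  finally show ?thesis unfolding 1 by simp
qed

text \<open>The correlation of \<open>f u\<close> and \<open>f t\<close> vanishes as
  \<open>u\<close> approaches -1.\<close>

lemma tendsto_kappa_boundary:
  assumes t: "\<bar>t\<bar> < 1" shows "((\<lambda>u. kappa 1 1 u t) \<longlongrightarrow> 0) (at_right (-1))"
proof -
  have "((\<lambda>u. c_kernel u t) \<longlongrightarrow> sqrt ((1 - (-1)\<^sup>2) * (1 - t\<^sup>2)) / (1 - (-1) * t)) (at_right (-1))"
    unfolding c_kernel_def using t by (intro tendsto_intros) auto
  then have "((\<lambda>u. c_kernel u t) \<longlongrightarrow> 0) (at_right (-1))" by simp
  then have "((\<lambda>u. arcsin (c_kernel u t)) \<longlongrightarrow> arcsin 0) (at_right (-1))"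
    using isCont_tendsto_compose[OF isCont_arcsin, of 0] by simp
  moreover have "((\<lambda>u. sgn (t - u)) \<longlongrightarrow> sgn (t - (-1))) (at_right (-1))"
    using t by (intro tendsto_sgn tendsto_intros) auto
  ultimately have "((\<lambda>u. sgn (t - u) * arcsin (c_kernel u t)) \<longlongrightarrow> sgn (t - (-1)) * arcsin 0) (at_right (-1))"
    by (intro tendsto_mult)
  then show ?thesis by (simp add: kappa_simps)
qed

context gaussian_series
begin

text \<open>Conditioning at \<open>u\<close> represents the sign of \<open>f u\<close> by that of
  \<open>z\<close>. As \<open>u\<close> tends to -1, the Blaschke factors tend to 1 and
  \<open>tau\<close> to 0, so this sign becomes independent of the others, and its mean is 0 by
  symmetry.\<close>

lemma sgn_moment_boundary:
  assumes S: "finite S" "\<And>q. q \<in> S \<Longrightarrow> \<bar>q\<bar> < 1" "S \<noteq> {}"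
  shows "((\<lambda>u. \<integral>\<omega>. sgn (f u \<omega>) * (\<Prod>q\<in>S. sgn (f q \<omega>)) \<partial>M) \<longlongrightarrow> 0) (at_right (-1))"
proof -
  interpret N: prob_space stdN by (rule prob_space_std_normal)
  interpret P: pair_prob_space M stdN ..
  let ?F = "\<lambda>u. \<integral>\<omega>. sgn (f u \<omega>) * (\<Prod>q\<in>S. sgn (f q \<omega>)) \<partial>M"
  have lim: "(?F \<circ> X) \<longlonglongrightarrow> 0" if X: "\<forall>i. X i \<in> {-1<..<1} - {-1}" "X \<longlonglongrightarrow> -1" for X
  proof -
    have X1: "\<bar>X i\<bar> < 1" for i using X(1)[rule_format, of i] by (auto simp: abs_less_iff)
    define g where "g i = (\<lambda>(\<omega>, z). sgn z * (\<Prod>q\<in>S. sgn (blaschke q (X i) * f q \<omega> + z * tau (X i) q)))" for i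
    have [measurable]: "g i \<in> borel_measurable MN" for i unfolding g_def by measurable
    have eq: "(?F \<circ> X) i = (\<integral>x. g i x \<partial>MN)" for i
    proof -
      define s where "s = X i"
      have s: "\<bar>s\<bar> < 1" using X1 by (simp add: s_def)
      define J where "J = insert s S"
      have J: "finite J" "\<And>p. p \<in> J \<Longrightarrow> \<bar>p\<bar> < 1" using S s by (auto simp: J_def)
      have m: "(\<lambda>y. sgn (y s) * (\<Prod>q\<in>S. sgn (y q))) \<in> borel_measurable (PiM J (\<lambda>_. borel :: real measure))"
        using prod_sgn_measurable[of "{s}" id J "\<lambda>_. 0"] prod_sgn_measurable[of S id J "\<lambda>_. 0"]
        by (intro borel_measurable_times) (auto simp: J_def)
      have "(?F \<circ> X) i = (\<integral>(\<omega>, z). sgn (blaschke s s * f s \<omega> + z * tau s s) *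
          (\<Prod>q\<in>S. sgn (blaschke q s * f q \<omega> + z * tau s q)) \<partial>MN)"
        unfolding o_def s_def[symmetric]
        by (rule blaschke_transfer(1)[OF J s m]) (auto simp: J_def intro!: arg_cong2[of _ _ _ _ "(*)"] prod.cong)
      also have "\<dots> = (\<integral>x. g i x \<partial>MN)"
        using tau_pos[OF s s] by (simp add: g_def s_def[symmetric] sgn_mult)
      finally show ?thesis .
    qed
    have "(\<lambda>i. \<integral>x. g i x \<partial>MN) \<longlonglongrightarrow> (\<integral>(\<omega>, z). sgn z * (\<Prod>q\<in>S. sgn (f q \<omega>)) \<partial>MN)"
    proof (rule integral_dominated_convergence[where w = "\<lambda>_. 1"])
      have "AE x in MN. f q (fst x) \<noteq> 0" if "q \<in> S" for q
      proof (rule P.AE_pair_measure)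
        show "AE \<omega> in M. AE z in stdN. f q (fst (\<omega>, z)) \<noteq> 0"
          using AE_f_nonzero[OF S(2)[OF that]] by simp
      qed measurable
      then have "AE x in MN. \<forall>q\<in>S. f q (fst x) \<noteq> 0" using S(1) by (intro AE_finite_allI)
      then show "AE x in MN. (\<lambda>i. g i x) \<longlonglongrightarrow> (case x of (\<omega>, z) \<Rightarrow> sgn z * (\<Prod>q\<in>S. sgn (f q \<omega>)))"
      proof eventually_elim
        case (elim x)
        have "(\<lambda>i. blaschke q (X i) * f q (fst x) + snd x * tau (X i) q) \<longlonglongrightarrow> f q (fst x)" if "q \<in> S" for q
        proof -
          have q: "1 - q * (-1) \<noteq> 0" "1 - (-1) * q \<noteq> 0" using S(2)[OF that] by auto
          have "(\<lambda>i. blaschke q (X i)) \<longlonglongrightarrow> (q - (-1)) / (1 - q * (-1))"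
            unfolding blaschke_def using q X(2) by (intro tendsto_intros)
          moreover have "(\<lambda>i. tau (X i) q) \<longlonglongrightarrow> sqrt (1 - (-1)\<^sup>2) / (1 - (-1) * q)"
            unfolding tau_def using q X(2) by (intro tendsto_intros)
          ultimately have "(\<lambda>i. blaschke q (X i) * f q (fst x) + snd x * tau (X i) q)
             \<longlonglongrightarrow> (q - (-1)) / (1 - q * (-1)) * f q (fst x) + snd x * (sqrt (1 - (-1)\<^sup>2) / (1 - (-1) * q))"
            by (intro tendsto_intros)
          then show ?thesis using q by (simp add: add.commute)
        qed
        then show ?case unfolding g_def case_prod_beta using elim
          by (intro tendsto_mult tendsto_const tendsto_prod tendsto_sgn) auto
      qed
      show "AE x in MN. norm (g i x) \<le> 1" for i
      proof (intro AE_I2)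
        fix x
        have "\<bar>sgn (snd x)\<bar> * \<bar>\<Prod>q\<in>S. sgn (blaschke q (X i) * f q (fst x) + snd x * tau (X i) q)\<bar> \<le> 1 * 1"
          by (intro mult_mono abs_prod_sgn_le_1) (auto simp: sgn_if)
        then show "norm (g i x) \<le> 1" by (simp add: g_def case_prod_beta abs_mult)
      qed
    qed auto
    also have "(\<integral>(\<omega>, z). sgn z * (\<Prod>q\<in>S. sgn (f q \<omega>)) \<partial>MN) = 0"
    proof -
      have "integrable MN (\<lambda>(\<omega>, z). sgn z * (\<Prod>q\<in>S. sgn (f q \<omega>)))"
      proof (rule P.P.integrable_const_bound[of _ 1])
        have "\<bar>sgn (z::real)\<bar> * \<bar>\<Prod>q\<in>S. sgn (f q \<omega>)\<bar> \<le> 1 * 1" for \<omega> z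
          by (intro mult_mono abs_prod_sgn_le_1) (auto simp: sgn_if)
        then show "AE x in MN. norm (case x of (\<omega>, z) \<Rightarrow> sgn z * (\<Prod>q\<in>S. sgn (f q \<omega>))) \<le> 1"
          by (auto simp: abs_mult intro!: AE_I2)
      qed measurable
      then show ?thesis using P.integral_fst'[of "\<lambda>(\<omega>, z). sgn z * (\<Prod>q\<in>S. sgn (f q \<omega>))"]
        by (simp add: integral_sgn_std_normal)
    qed
    finally show ?thesis unfolding eq[THEN ext] .
  qed
  have "(?F \<longlongrightarrow> 0) (at (-1) within {-1<..<1})"
    unfolding tendsto_at_iff_sequentially using lim by blast
  moreover have "at (-1) within {-1<..<1} = at_right (-1 :: real)"
    by (rule at_within_nhd[where S = "{..<1}"]) auto
  ultimately show ?thesis by simp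
qed

lemma gaussian_ibp_list:
  assumes ys: "sorted_wrt (<) ys" "\<And>y. y \<in> set ys \<Longrightarrow> \<bar>y\<bar> < 1" and u: "\<bar>u\<bar> < 1"
  shows "(\<integral>\<omega>. f u \<omega> * (\<Prod>q\<in>set ys. sgn (f q \<omega>)) \<partial>M) =
    (\<Sum>j<length ys. (-1) ^ j * (sqrt (2 / pi) * (sqrt (1 - (ys ! j)\<^sup>2) / (1 - u * ys ! j))) * sgn_moment (remove_nth j ys))"
proof -
  have d: "distinct ys" using ys(1) by (simp add: strict_sorted_iff)
  have inj: "inj_on ((!) ys) {..<length ys}" using d by (simp add: inj_on_nth)
  have "(\<integral>\<omega>. f u \<omega> * (\<Prod>k<length ys. sgn (f (ys ! k) \<omega>)) \<partial>M) =
    (\<Sum>j<length ys. sqrt (2 / pi) * (sqrt (1 - (ys ! j)\<^sup>2) / (1 - u * ys ! j)) *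
      ((\<Prod>k\<in>{..<length ys} - {j}. sgn (ys ! k - ys ! j)) * (\<integral>\<omega>. (\<Prod>k\<in>{..<length ys} - {j}. sgn (f (ys ! k) \<omega>)) \<partial>M)))"
    using ys(2) u inj by (intro gaussian_ibp) auto
  also have "\<dots> = (\<Sum>j<length ys. (-1) ^ j * (sqrt (2 / pi) * (sqrt (1 - (ys ! j)\<^sup>2) / (1 - u * ys ! j))) * sgn_moment (remove_nth j ys))"
    using prod_sgn_sorted[OF ys(1)] by (intro sum.cong) (simp_all add: sgn_moment_def prod_set_remove_nth[OF d])
  finally show ?thesis by (simp only: prod_set_nth[OF d])
qed

lemma sgn_moment_eq_pf:
  assumes "sorted_wrt (<) xs" "\<And>x. x \<in> set xs \<Longrightarrow> \<bar>x\<bar> < 1" "length xs = 2 * N"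
  shows "sgn_moment xs = (2 / pi) ^ N * pf_list (kappa 1 1) xs"
  using assms
proof (induction N arbitrary: xs)
  case 0
  then show ?case by (simp add: sgn_moment_def prob_space)
next
  case (Suc N)
  then obtain x ys where xs: "xs = x # ys" and len: "length ys = Suc (2 * N)" by (cases xs) auto
  have ys: "sorted_wrt (<) ys" "\<And>y. y \<in> set ys \<Longrightarrow> \<bar>y\<bar> < 1" "\<And>y. y \<in> set ys \<Longrightarrow> x < y"
    using Suc.prems xs by auto
  \<comment> \<open>The first point may move through the whole interval from -1 to \<open>b\<close>
    without meeting another point, so the order and the differentiability of the kernel
    persist.\<close>
  define b where "b = hd ys"
  have b: "x < b" "\<bar>b\<bar> < 1" "\<And>y. y \<in> set ys \<Longrightarrow> b \<le> y"
    using ys len unfolding b_def by (cases ys; force)+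
  define F where "F u = (\<integral>\<omega>. sgn (f u \<omega>) * (\<Prod>q\<in>set ys. sgn (f q \<omega>)) \<partial>M)" for u
  define R where "R u = (2 / pi) ^ Suc N * pf_list (kappa 1 1) (u # ys)" for u
  have IH: "sgn_moment (remove_nth j ys) = (2 / pi) ^ N * pf_list (kappa 1 1) (remove_nth j ys)" if "j < length ys" for j
    using that ys(2) len set_remove_nth_subset[of j ys] by (intro Suc.IH sorted_wrt_remove_nth ys(1)) auto
  define D where "D u = (2 / pi) ^ Suc N * (\<Sum>j<length ys. (-1) ^ j * kappa 0 1 u (ys ! j) * pf_list (kappa 1 1) (remove_nth j ys))" for u
  have FD: "(F has_real_derivative D u) (at u)" if u: "-1 < u" "u < b" for u
  proof -
    have u1: "\<bar>u\<bar> < 1" using u b by auto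
    have notin: "u \<notin> set ys" using u b(3) by force
    have "(F has_real_derivative sqrt (2 / pi) / sqrt (1 - u\<^sup>2) * (\<Prod>q\<in>set ys. sgn (blaschke q u)) *
        (\<integral>\<omega>. f u \<omega> * (\<Prod>q\<in>set ys. sgn (f q \<omega>)) \<partial>M)) (at u)"
      using has_derivative_sgn_moment[of "{}" "set ys" u] ys(2) u1 notin unfolding F_def by simp
    \<comment> \<open>All other points lie to the right of \<open>u\<close>, so no sign is lost in
      the differentiation.\<close>
    also have "(\<Prod>q\<in>set ys. sgn (blaschke q u)) = 1"
    proof (rule prod.neutral, rule ballI)
      fix q assume q: "q \<in> set ys"
      then have "u < q" "0 < 1 - q * u" using u b(3)[OF q] one_minus_mult_pos[OF ys(2)[OF q] u1] by auto
      then show "sgn (blaschke q u) = 1" by (simp add: blaschke_def)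
    qed
    also have "(\<integral>\<omega>. f u \<omega> * (\<Prod>q\<in>set ys. sgn (f q \<omega>)) \<partial>M) =
      (\<Sum>j<length ys. (-1) ^ j * (sqrt (2 / pi) * (sqrt (1 - (ys ! j)\<^sup>2) / (1 - u * ys ! j))) * sgn_moment (remove_nth j ys))"
      by (rule gaussian_ibp_list[OF ys(1)]) (use ys u1 in auto)
    also have "sqrt (2 / pi) / sqrt (1 - u\<^sup>2) * 1 * (\<Sum>j<length ys. (-1) ^ j *
        (sqrt (2 / pi) * (sqrt (1 - (ys ! j)\<^sup>2) / (1 - u * ys ! j))) * sgn_moment (remove_nth j ys)) = D u"
      unfolding D_def sum_distrib_left
    proof (intro sum.cong refl)
      fix j assume "j \<in> {..<length ys}"
      then have j: "j < length ys" by simp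
      \<comment> \<open>One factor \<open>sqrt (2 / pi)\<close> comes from the derivative and one
        from integration by parts; together they raise the power of \<open>2 / pi\<close> by
        one.\<close>
      have "A / \<sigma> * 1 * (m * (A * (y / e)) * (c * P)) = (A * A) * c * (m * (y / \<sigma> * (1 / e)) * P)"
        for A \<sigma> m y e c P :: real by simp
      moreover have "sqrt (2 / pi) * sqrt (2 / pi) * (2 / pi) ^ N = (2 / pi) ^ Suc N" by simp
      moreover have "kappa 0 1 u (ys ! j) = sqrt (1 - (ys ! j)\<^sup>2) / sqrt (1 - u\<^sup>2) * (1 / (1 - u * ys ! j))"
        by (simp add: kappa_simps real_sqrt_divide)
      ultimately show "sqrt (2 / pi) / sqrt (1 - u\<^sup>2) * 1 * ((-1) ^ j * (sqrt (2 / pi) * (sqrt (1 - (ys ! j)\<^sup>2) / (1 - u * ys ! j))) * sgn_moment (remove_nth j ys))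
        = (2 / pi) ^ Suc N * ((-1) ^ j * kappa 0 1 u (ys ! j) * pf_list (kappa 1 1) (remove_nth j ys))"
        unfolding IH[OF j] by (simp only:)
    qed
    finally show ?thesis .
  qed
  have RD: "(R has_real_derivative D u) (at u)" if u: "-1 < u" "u < b" for u
  proof -
    have u1: "\<bar>u\<bar> < 1" using u b by auto
    have "u \<noteq> ys ! j" if "j < length ys" for j using u b(3)[of "ys ! j"] that by force
    then show ?thesis
      unfolding R_def D_def pf_list.simps mult.assoc using ys(2) u1
      by (intro DERIV_cmult DERIV_sum DERIV_cmult_right has_derivative_kappa) auto
  qed
  have "\<exists>c. \<forall>u\<in>{-1<..<b}. F u - R u = c"
  proof (rule has_field_derivative_zero_constant)
    fix u assume "u \<in> {-1<..<b}"
    then have "((\<lambda>u. F u - R u) has_real_derivative D u - D u) (at u)"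
      by (intro DERIV_diff FD RD) auto
    then show "((\<lambda>u. F u - R u) has_real_derivative 0) (at u within {-1<..<b})"
      by (simp add: has_field_derivative_at_within)
  qed simp
  then obtain c where c: "\<And>u. -1 < u \<Longrightarrow> u < b \<Longrightarrow> F u - R u = c" by auto
  have "((\<lambda>u. F u - R u) \<longlongrightarrow> 0 - 0) (at_right (-1))"
  proof (rule tendsto_diff)
    show "(F \<longlongrightarrow> 0) (at_right (-1))"
      unfolding F_def using ys(2) len by (intro sgn_moment_boundary) auto
    have "(R \<longlongrightarrow> (2 / pi) ^ Suc N * (\<Sum>j<length ys. (-1) ^ j * 0 * pf_list (kappa 1 1) (remove_nth j ys))) (at_right (-1))"
      unfolding R_def pf_list.simps using ys(2)
      by (intro tendsto_mult tendsto_sum tendsto_const tendsto_kappa_boundary) auto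
    then show "(R \<longlongrightarrow> 0) (at_right (-1))" by simp
  qed
  moreover have "eventually (\<lambda>u. F u - R u = c) (at_right (-1))"
  proof -
    have "-1 < b" using b(2) by (simp add: abs_less_iff)
    then show ?thesis using c by (auto simp: eventually_at_right[of "-1" b] intro!: exI[of _ b])
  qed
  then have "((\<lambda>u. F u - R u) \<longlongrightarrow> c) (at_right (-1))"
    by (rule tendsto_eventually)
  ultimately have "0 - 0 = c" by (rule tendsto_unique[OF trivial_limit_at_right_real])
  moreover have "-1 < x" using Suc.prems(2)[of x] xs by (simp add: abs_less_iff)
  ultimately have "F x = R x" using c[of x] b(1) by simp
  moreover have "x \<notin> set ys" using ys(3) by auto
  ultimately show ?case by (simp add: xs sgn_moment_def F_def R_def del: pf_list.simps)
qed

end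

section \<open>Absolute moments\<close>

text \<open>The tags after \<open>l\<close> differentiations: even positions carry the points of the
  theorem, odd positions their auxiliary neighbours, and the first \<open>l\<close> even positions
  have been turned from signs into values.\<close>

definition kind :: "nat \<Rightarrow> nat \<Rightarrow> nat" where
  "kind l i = (if even i \<and> i < 2 * l then 0 else 1)"

definition sgn_indices :: "nat \<Rightarrow> nat \<Rightarrow> nat set" where
  "sgn_indices N l = {j. j < 2 * N \<and> kind l j = 1}"

text \<open>The constants left by \<open>l\<close> successive differentiations, each new point
  contributing its Blaschke factors with the earlier ones. For \<open>l = n\<close> this is the
  square root of \<open>(2 / pi) ^ n\<close> times the determinant.\<close>

definition weight :: "nat \<Rightarrow> (nat \<Rightarrow> real) \<Rightarrow> real" where
  "weight l t = (\<Prod>j<l. sqrt (2 / pi) / sqrt (1 - (t j)\<^sup>2) * (\<Prod>i<j. \<bar>blaschke (t i) (t j)\<bar>))"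

lemma finite_sgn_indices [simp]: "finite (sgn_indices N l)"
  by (simp add: sgn_indices_def)

lemma sgn_blaschke:
  assumes "\<bar>q\<bar> < 1" "\<bar>s\<bar> < 1" shows "sgn (blaschke q s) = sgn (q - s)"
  using one_minus_mult_pos[OF assms] by (simp add: blaschke_def sgn_divide)

lemma sgn_indices_step:
  assumes "l < N"
  shows "sgn_indices N l = insert (2 * l) (sgn_indices N (Suc l))" "2 * l \<notin> sgn_indices N (Suc l)"
    "sgn_indices N (Suc l) = (\<lambda>i. 2 * i + 1) ` {..<l} \<union> {2 * l<..<2 * N}"
proof -
  show "sgn_indices N l = insert (2 * l) (sgn_indices N (Suc l))" "2 * l \<notin> sgn_indices N (Suc l)"
    using assms by (auto simp: sgn_indices_def kind_def split: if_splits elim!: evenE)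
  show "sgn_indices N (Suc l) = (\<lambda>i. 2 * i + 1) ` {..<l} \<union> {2 * l<..<2 * N}"
  proof (intro equalityI subsetI)
    fix j assume j: "j \<in> sgn_indices N (Suc l)"
    show "j \<in> (\<lambda>i. 2 * i + 1) ` {..<l} \<union> {2 * l<..<2 * N}"
    proof (cases "2 * l < j")
      case True
      then show ?thesis using j by (simp add: sgn_indices_def)
    next
      case False
      then have "odd j" using j by (auto simp: sgn_indices_def kind_def split: if_splits)
      then obtain i where "j = 2 * i + 1" by (elim oddE)
      then show ?thesis using False by auto
    qed
  next
    fix j assume "j \<in> (\<lambda>i. 2 * i + 1) ` {..<l} \<union> {2 * l<..<2 * N}"
    then show "j \<in> sgn_indices N (Suc l)"
      using assms by (auto simp: sgn_indices_def kind_def)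
  qed
qed

text \<open>Passing the sign indices and the Blaschke factors to the left of \<open>x (2 l)\<close> produces \<open>2 l\<close> minus signs.\<close>

lemma blaschke_sign_product:
  assumes x: "strict_mono_on {..<2 * N} x" "\<And>i. i < 2 * N \<Longrightarrow> \<bar>x i\<bar> < 1" and l: "l < N"
  shows "(\<Prod>i<l. blaschke (x (2 * i)) (x (2 * l))) * (\<Prod>j\<in>sgn_indices N (Suc l). sgn (blaschke (x j) (x (2 * l)))) =
    (\<Prod>i<l. \<bar>blaschke (x (2 * i)) (x (2 * l))\<bar>)"
proof -
  have less: "x i < x j" if "i < j" "j < 2 * N" for i j using strict_mono_onD[OF x(1)] that by simp
  have sg: "sgn (blaschke (x i) (x (2 * l))) = sgn (x i - x (2 * l))" if "i < 2 * N" for i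
    using sgn_blaschke x(2) l that by simp
  have "(\<Prod>j\<in>sgn_indices N (Suc l). sgn (blaschke (x j) (x (2 * l)))) =
    (\<Prod>j\<in>(\<lambda>i. 2 * i + 1) ` {..<l}. sgn (blaschke (x j) (x (2 * l)))) * (\<Prod>j\<in>{2 * l<..<2 * N}. sgn (blaschke (x j) (x (2 * l))))"
    unfolding sgn_indices_step(3)[OF l] by (rule prod.union_disjoint) auto
  also have "(\<Prod>j\<in>{2 * l<..<2 * N}. sgn (blaschke (x j) (x (2 * l)))) = 1"
    using less[of "2 * l"] by (intro prod.neutral) (auto simp: sg)
  also have "(\<Prod>j\<in>(\<lambda>i. 2 * i + 1) ` {..<l}. sgn (blaschke (x j) (x (2 * l)))) = (\<Prod>i<l. sgn (blaschke (x (2 * i + 1)) (x (2 * l))))"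
    by (subst prod.reindex) (auto simp: inj_on_def)
  finally have "(\<Prod>i<l. blaschke (x (2 * i)) (x (2 * l))) * (\<Prod>j\<in>sgn_indices N (Suc l). sgn (blaschke (x j) (x (2 * l)))) =
    (\<Prod>i<l. blaschke (x (2 * i)) (x (2 * l)) * sgn (blaschke (x (2 * i + 1)) (x (2 * l))))"
    by (simp add: prod.distrib)
  also have "\<dots> = (\<Prod>i<l. \<bar>blaschke (x (2 * i)) (x (2 * l))\<bar>)"
  proof (rule prod.cong)
    fix i assume "i \<in> {..<l}"
    then have i: "i < l" by simp
    then have "sgn (blaschke (x (2 * i + 1)) (x (2 * l))) = -1" "sgn (blaschke (x (2 * i)) (x (2 * l))) = -1"
      using less[of "2 * i + 1" "2 * l"] less[of "2 * i" "2 * l"] l by (simp_all add: sg)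
    then show "blaschke (x (2 * i)) (x (2 * l)) * sgn (blaschke (x (2 * i + 1)) (x (2 * l))) = \<bar>blaschke (x (2 * i)) (x (2 * l))\<bar>"
      by (simp add: sgn_if split: if_splits)
  qed simp
  finally show ?thesis .
qed

text \<open>Only the arcsine entry jumps across the diagonal; the entries with a tag 0 are
  continuous there.\<close>

lemma tendsto_kappa:
  assumes a: "(a \<longlongrightarrow> s) F" "\<bar>s\<bar> < 1" and b: "(b \<longlongrightarrow> t) F" "\<bar>t\<bar> < 1"
    and kl: "k = 0 \<or> l = 0 \<or> s \<noteq> t"
  shows "((\<lambda>x. kappa k l (a x) (b x)) \<longlongrightarrow> kappa k l s t) F"
proof -
  have p: "1 - s\<^sup>2 \<noteq> 0" "1 - t\<^sup>2 \<noteq> 0" "1 - s * t \<noteq> 0"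
    using one_minus_square_pos[of s] one_minus_square_pos[of t] one_minus_mult_pos[of s t] a b by auto
  consider "k = 0" "l = 0" | "k = 0" "l > 0" | "k > 0" "l = 0" | "k > 0" "l > 0" "s \<noteq> t" using kl by auto
  then show ?thesis
  proof cases
    case 1
    then show ?thesis using p unfolding 1 kappa_simps by (intro tendsto_intros a b) auto
  next
    case 2
    then show ?thesis using p unfolding 2(1) kappa_simps(2)[OF 2(2)] by (intro tendsto_intros a b) auto
  next
    case 3
    then show ?thesis using p unfolding 3(2) kappa_simps(3)[OF 3(1)] by (intro tendsto_intros a b) auto
  next
    case 4
    have "((\<lambda>x. c_kernel (a x) (b x)) \<longlongrightarrow> c_kernel s t) F"
      unfolding c_kernel_def using p by (intro tendsto_intros a b) auto
    moreover have "isCont arcsin (c_kernel s t)"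
      using c_kernel_bounds[OF a(2) b(2)] 4(3) by (intro isCont_arcsin) auto
    ultimately have "((\<lambda>x. arcsin (c_kernel (a x) (b x))) \<longlongrightarrow> arcsin (c_kernel s t)) F"
      by (rule isCont_tendsto_compose[rotated])
    then show ?thesis unfolding kappa_simps(4)[OF 4(1,2)] using 4(3) by (intro tendsto_mult tendsto_sgn tendsto_diff a b) auto
  qed
qed

context gaussian_series
begin

definition mixed_moment :: "nat \<Rightarrow> nat \<Rightarrow> (nat \<Rightarrow> real) \<Rightarrow> real" where
  "mixed_moment N l x = (\<integral>\<omega>. (\<Prod>i<l. f (x (2 * i)) \<omega>) * (\<Prod>j\<in>sgn_indices N l. sgn (f (x j) \<omega>)) \<partial>M)"

text \<open>An instance of \<open>has_derivative_sgn_moment\<close>, with \<open>T\<close> the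
  points already turned into values and \<open>S\<close> the points that keep their signs. The signs
  of all Blaschke factors combine to absolute values by
  \<open>blaschke_sign_product\<close>.\<close>

lemma has_derivative_mixed_moment:
  assumes x: "strict_mono_on {..<2 * N} x" "\<And>i. i < 2 * N \<Longrightarrow> \<bar>x i\<bar> < 1" and l: "l < N"
  shows "((\<lambda>u. mixed_moment N l (x(2 * l := u))) has_real_derivative
    sqrt (2 / pi) / sqrt (1 - (x (2 * l))\<^sup>2) * (\<Prod>i<l. \<bar>blaschke (x (2 * i)) (x (2 * l))\<bar>) * mixed_moment N (Suc l) x) (at (x (2 * l)))"
proof -
  define s where "s = x (2 * l)"
  define T where "T = (\<lambda>i. x (2 * i)) ` {..<l}"
  define J where "J = sgn_indices N (Suc l)"
  define S where "S = x ` J"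
  have inj: "inj_on x {..<2 * N}" using x(1) by (rule strict_mono_on_imp_inj_on)
  have J: "j < 2 * N" "j \<noteq> 2 * l" if "j \<in> J" for j
    using that sgn_indices_step(2)[OF l] by (auto simp: J_def sgn_indices_def)
  have injT: "inj_on (\<lambda>i. x (2 * i)) {..<l}"
    using l by (intro inj_onI) (auto dest!: inj_onD[OF inj])
  have injS: "inj_on x J" using J(1) by (intro inj_on_subset[OF inj]) auto
  have T: "(\<Prod>p\<in>T. g p) = (\<Prod>i<l. g (x (2 * i)))" for g :: "real \<Rightarrow> real" unfolding T_def using injT by (simp add: prod.reindex)
  have S: "(\<Prod>q\<in>S. g q) = (\<Prod>j\<in>J. g (x j))" for g :: "real \<Rightarrow> real" unfolding S_def using injS by (simp add: prod.reindex)
  have "s \<notin> S" using J inj l unfolding S_def s_def by (force dest: inj_onD)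
  then have "((\<lambda>u. \<integral>\<omega>. sgn (f u \<omega>) * ((\<Prod>p\<in>T. f p \<omega>) * (\<Prod>q\<in>S. sgn (f q \<omega>))) \<partial>M) has_real_derivative
    sqrt (2 / pi) / sqrt (1 - s\<^sup>2) * ((\<Prod>p\<in>T. blaschke p s) * (\<Prod>q\<in>S. sgn (blaschke q s))) *
      (\<integral>\<omega>. f s \<omega> * ((\<Prod>p\<in>T. f p \<omega>) * (\<Prod>q\<in>S. sgn (f q \<omega>))) \<partial>M)) (at s)"
    using x(2) l J(1) by (intro has_derivative_sgn_moment) (auto simp: T_def S_def J_def s_def)
  also have "(\<Prod>p\<in>T. blaschke p s) * (\<Prod>q\<in>S. sgn (blaschke q s)) = (\<Prod>i<l. \<bar>blaschke (x (2 * i)) s\<bar>)"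
    unfolding T S s_def J_def by (rule blaschke_sign_product[OF x l])
  also have "(\<integral>\<omega>. f s \<omega> * ((\<Prod>p\<in>T. f p \<omega>) * (\<Prod>q\<in>S. sgn (f q \<omega>))) \<partial>M) = mixed_moment N (Suc l) x"
    unfolding T S mixed_moment_def J_def s_def by (simp add: mult_ac)
  also have "(\<lambda>u. \<integral>\<omega>. sgn (f u \<omega>) * ((\<Prod>p\<in>T. f p \<omega>) * (\<Prod>q\<in>S. sgn (f q \<omega>))) \<partial>M) = (\<lambda>u. mixed_moment N l (x(2 * l := u)))"
  proof (intro ext)
    fix u
    have "(\<Prod>i<l. f ((x(2 * l := u)) (2 * i)) \<omega>) = (\<Prod>i<l. f (x (2 * i)) \<omega>)" for \<omega> by (intro prod.cong) auto
    moreover have "(\<Prod>j\<in>sgn_indices N l. sgn (f ((x(2 * l := u)) j) \<omega>)) = sgn (f u \<omega>) * (\<Prod>j\<in>J. sgn (f (x j) \<omega>))" for \<omega>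
      unfolding sgn_indices_step(1)[OF l] J_def[symmetric] using J by (subst prod.insert) (auto simp: J_def intro!: arg_cong2[of _ _ _ _ "(*)"] prod.cong)
    ultimately show "(\<integral>\<omega>. sgn (f u \<omega>) * ((\<Prod>p\<in>T. f p \<omega>) * (\<Prod>q\<in>S. sgn (f q \<omega>))) \<partial>M) = mixed_moment N l (x(2 * l := u))"
      unfolding T S mixed_moment_def by (simp add: mult_ac)
  qed
  finally show ?thesis unfolding s_def .
qed

text \<open>The points of the induction are arbitrary, so the hypothesis for \<open>l\<close> holds
  in a whole neighbourhood of \<open>x (2 * l)\<close> and may be differentiated there. On the left
  this enlarges the weight and turns a sign into a value; on the right it turns a tag 1 into
  0.\<close>

lemma mixed_moment_eq_pf:
  assumes "strict_mono_on {..<2 * N} x" "\<And>i. i < 2 * N \<Longrightarrow> \<bar>x i\<bar> < 1" "l \<le> N"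
  shows "weight l (\<lambda>i. x (2 * i)) * mixed_moment N l x =
    (2 / pi) ^ N * pf_list (\<lambda>i j. kappa (kind l i) (kind l j) (x i) (x j)) [0..<2 * N]"
  using assms
proof (induction l arbitrary: x)
  case 0
  have sorted: "sorted_wrt (<) (map x [0..<2 * N])"
    using strict_mono_onD[OF 0(1)] by (auto simp: sorted_wrt_iff_nth_less)
  have "sgn_indices N 0 = {..<2 * N}" by (auto simp: sgn_indices_def kind_def)
  moreover have "inj_on x {..<2 * N}" using 0(1) by (rule strict_mono_on_imp_inj_on)
  ultimately have "mixed_moment N 0 x = sgn_moment (map x [0..<2 * N])"
    by (simp add: mixed_moment_def sgn_moment_def prod.reindex atLeast0LessThan)
  also have "\<dots> = (2 / pi) ^ N * pf_list (kappa 1 1) (map x [0..<2 * N])"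
    using 0(2) by (intro sgn_moment_eq_pf sorted) auto
  finally show ?case by (simp add: weight_def pf_map kind_def)
next
  case (Suc l)
  note x = Suc.prems(1,2)
  have l: "l < N" using Suc.prems(3) by simp
  define s where "s = x (2 * l)"
  have less: "x i < x j" if "i < j" "j < 2 * N" for i j using strict_mono_onD[OF x(1)] that by simp
  \<comment> \<open>The weight involves only the points \<open>x (2 * i)\<close> with
    \<open>i < l\<close>, so it is a constant factor.\<close>
  have w: "weight l (\<lambda>i. (x(2 * l := u)) (2 * i)) = weight l (\<lambda>i. x (2 * i))" for u
    unfolding weight_def by (intro prod.cong refl arg_cong2[of _ _ _ _ "(*)"]) auto
  define R where "R u = (2 / pi) ^ N * pf_list (\<lambda>i j. kappa (kind l i) (kind l j) ((x(2 * l := u)) i) ((x(2 * l := u)) j)) [0..<2 * N]" for u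
  \<comment> \<open>Strict monotonicity survives small changes of a single point.\<close>
  have "eventually (\<lambda>u. \<forall>i\<in>{..<2 * N}. (i < 2 * l \<longrightarrow> x i < u) \<and> (2 * l < i \<longrightarrow> u < x i)) (nhds s)"
  proof (rule eventually_ball_finite, simp, rule ballI)
    fix i assume "i \<in> {..<2 * N}"
    then have "eventually (\<lambda>u. u \<in> (if i < 2 * l then {x i<..} else if 2 * l < i then {..<x i} else UNIV)) (nhds s)"
      using less[of i "2 * l"] less[of "2 * l" i] l by (intro eventually_nhds_in_open) (auto simp: s_def)
    then show "eventually (\<lambda>u. (i < 2 * l \<longrightarrow> x i < u) \<and> (2 * l < i \<longrightarrow> u < x i)) (nhds s)"
      by (rule eventually_mono) (auto split: if_splits)
  qed
  moreover have "eventually (\<lambda>u. u \<in> {-1<..<1}) (nhds s)"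
    using x(2)[of "2 * l"] l by (intro eventually_nhds_in_open) (auto simp: s_def abs_less_iff)
  ultimately have ev: "eventually (\<lambda>u. weight l (\<lambda>i. x (2 * i)) * mixed_moment N l (x(2 * l := u)) = R u) (nhds s)"
  proof eventually_elim
    case (elim u)
    have "weight l (\<lambda>i. (x(2 * l := u)) (2 * i)) * mixed_moment N l (x(2 * l := u)) =
      (2 / pi) ^ N * pf_list (\<lambda>i j. kappa (kind l i) (kind l j) ((x(2 * l := u)) i) ((x(2 * l := u)) j)) [0..<2 * N]"
    proof (rule Suc.IH)
      show "strict_mono_on {..<2 * N} (x(2 * l := u))"
        using elim(1) less by (intro strict_mono_onI) auto
      show "\<bar>(x(2 * l := u)) i\<bar> < 1" if "i < 2 * N" for i
        using elim(2) x(2)[OF that] by auto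
    qed (use l in simp)
    then show ?case unfolding w R_def .
  qed
  have "((\<lambda>u. weight l (\<lambda>i. x (2 * i)) * mixed_moment N l (x(2 * l := u))) has_real_derivative
    weight l (\<lambda>i. x (2 * i)) * (sqrt (2 / pi) / sqrt (1 - s\<^sup>2) * (\<Prod>i<l. \<bar>blaschke (x (2 * i)) s\<bar>) * mixed_moment N (Suc l) x)) (at s)"
    unfolding s_def by (intro DERIV_cmult has_derivative_mixed_moment x l)
  then have "(R has_real_derivative
    weight l (\<lambda>i. x (2 * i)) * (sqrt (2 / pi) / sqrt (1 - s\<^sup>2) * (\<Prod>i<l. \<bar>blaschke (x (2 * i)) s\<bar>) * mixed_moment N (Suc l) x)) (at s)"
    by (rule iffD1[OF DERIV_cong_ev[OF refl ev refl]])
  moreover have "(R has_real_derivative (2 / pi) ^ N *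
    pf_list (\<lambda>i j. kappa (kind (Suc l) i) (kind (Suc l) j) (x i) (x j)) [0..<2 * N]) (at s)"
    unfolding R_def
  proof (intro DERIV_cmult has_derivative_pf[where m = "2 * l"])
    show "2 * l \<in> set [0..<2 * N]" using l by simp
    show "kappa (kind l i) (kind l j) ((x(2 * l := v)) i) ((x(2 * l := v)) j) =
        kappa (kind (Suc l) i) (kind (Suc l) j) (x i) (x j)" if "i \<noteq> 2 * l" "j \<noteq> 2 * l" for v i j
    proof -
      have "kind l k = kind (Suc l) k" if "k \<noteq> 2 * l" for k using that by (auto simp: kind_def elim!: evenE)
      then show ?thesis using that by simp
    qed
    fix j assume j: "j \<in> set [0..<2 * N]" "j \<noteq> 2 * l"
    have k: "kind l (2 * l) = 1" "kind (Suc l) (2 * l) = 0" "kind (Suc l) j = kind l j"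
      using j by (auto simp: kind_def elim!: evenE)
    have "s \<noteq> x j" "\<bar>s\<bar> < 1" "\<bar>x j\<bar> < 1"
      using j l less[of j "2 * l"] less[of "2 * l" j] x(2) by (cases j "2 * l" rule: linorder_cases; force simp: s_def)+
    then show "((\<lambda>v. kappa (kind l (2 * l)) (kind l j) ((x(2 * l := v)) (2 * l)) ((x(2 * l := v)) j)) has_real_derivative
        kappa (kind (Suc l) (2 * l)) (kind (Suc l) j) (x (2 * l)) (x j)) (at s)"
      "((\<lambda>v. kappa (kind l j) (kind l (2 * l)) ((x(2 * l := v)) j) ((x(2 * l := v)) (2 * l))) has_real_derivative
        kappa (kind (Suc l) j) (kind (Suc l) (2 * l)) (x j) (x (2 * l))) (at s)"
      using has_derivative_kappa[of s "x j" "kind l j"] j(2) unfolding k s_def[symmetric] by auto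
  qed simp
  ultimately have "weight l (\<lambda>i. x (2 * i)) * (sqrt (2 / pi) / sqrt (1 - s\<^sup>2) * (\<Prod>i<l. \<bar>blaschke (x (2 * i)) s\<bar>) * mixed_moment N (Suc l) x)
     = (2 / pi) ^ N * pf_list (\<lambda>i j. kappa (kind (Suc l) i) (kind (Suc l) j) (x i) (x j)) [0..<2 * N]"
    by (rule DERIV_unique)
  then show ?case by (simp add: weight_def s_def mult_ac)
qed

end

section \<open>Reduction to increasing points and merging of the neighbouring points\<close>

lemma kind_full: "i < 2 * n \<Longrightarrow> kind n i = i mod 2"
  by (auto simp: kind_def odd_iff_mod_2_eq_one)

lemma sgn_indices_full: "sgn_indices n n = (\<lambda>i. 2 * i + 1) ` {..<n}"
proof (intro equalityI subsetI)
  fix j assume j: "j \<in> sgn_indices n n"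
  then have "odd j" "j < 2 * n" by (auto simp: sgn_indices_def kind_def split: if_splits)
  then show "j \<in> (\<lambda>i. 2 * i + 1) ` {..<n}" by (elim oddE) auto
qed (auto simp: sgn_indices_def kind_def)

lemma K_mat_pfaffian:
  "pfaffian (K_mat n t) = pf_list (\<lambda>i j. kappa (i mod 2) (j mod 2) (t (i div 2)) (t (j div 2))) [0..<2 * n]"
proof -
  have "pfaffian (K_mat n t) = pf_list (\<lambda>i j. K_mat n t $$ (i, j)) [0..<2 * n]"
    by (rule pfaffian_eq_pf) (simp add: K_mat_def)
  also have "\<dots> = pf_list (\<lambda>i j. kappa (i mod 2) (j mod 2) (t (i div 2)) (t (j div 2))) [0..<2 * n]"
  proof (rule pf_cong)
    have "(if k mod 2 = 0 then 0 else 1) = k mod (2::nat)" for k by auto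
    then show "K_mat n t $$ (i, j) = kappa (i mod 2) (j mod 2) (t (i div 2)) (t (j div 2))"
      if "i \<in> set [0..<2 * n]" "j \<in> set [0..<2 * n]" for i j
      using that by (simp add: K_mat_def kappa_def)
  qed
  finally show ?thesis .
qed

lemma blocks_map: "blocks (map t [0..<n]) = map (\<lambda>i. (i mod 2, t (i div 2))) [0..<2 * n]"
  by (induction n) simp_all

text \<open>Here the points enter as a list, so that \<open>pf_blocks_sort\<close> applies.\<close>

lemma K_mat_pfaffian_blocks:
  "pfaffian (K_mat n t) = pf_list (\<lambda>x y. kappa (fst x) (fst y) (snd x) (snd y)) (blocks (map t [0..<n]))"
  unfolding K_mat_pfaffian blocks_map pf_map by simp

text \<open>The permutation acts on rows and columns alike, and the two signatures cancel.\<close>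

lemma det_Sigma_mat_permute:
  assumes p: "p permutes {0..<n}"
  shows "Determinant.det (Sigma_mat n (t \<circ> p)) = Determinant.det (Sigma_mat n t)"
proof -
  have pl: "p i < n" if "i < n" for i using permutes_in_image[OF p, of i] that by simp
  have sq: "of_int (sign p) * of_int (sign p) = (1 :: real)" by (simp add: sign_def)
  define A where "A = mat n n (\<lambda>(i, j). Sigma_mat n t $$ (p i, j))"
  have A: "A \<in> carrier_mat n n" by (simp add: A_def)
  have "Sigma_mat n (t \<circ> p) = mat n n (\<lambda>(i, j). transpose_mat A $$ (p i, j))"
    using pl by (intro eq_matI) (auto simp: Sigma_mat_def A_def mult.commute)
  then have "Determinant.det (Sigma_mat n (t \<circ> p)) = of_int (sign p) * Determinant.det (transpose_mat A)"
    using det_permute_rows[of "transpose_mat A" n p] A p by simp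
  also have "Determinant.det (transpose_mat A) = of_int (sign p) * Determinant.det (Sigma_mat n t)"
    using det_transpose[OF A] det_permute_rows[of "Sigma_mat n t" n p] p by (simp add: A_def Sigma_mat_def)
  finally show ?thesis
    by (simp only: mult.assoc[symmetric] sq mult_1)
qed

text \<open>The square of the weight is the product form of the Cauchy determinant times
  \<open>(2 / pi) ^ n\<close>. Distinctness keeps the Blaschke factors nonzero, hence the
  determinant positive.\<close>

lemma weight_det:
  assumes t: "\<And>i. i < n \<Longrightarrow> \<bar>t i\<bar> < 1" "inj_on t {..<n}"
  shows "0 < Determinant.det (Sigma_mat n t)"
    and "weight n t = sqrt ((2 / pi) ^ n * Determinant.det (Sigma_mat n t))"
proof -
  have pos: "0 < 1 / (1 - (t j)\<^sup>2) * (\<Prod>i<j. (blaschke (t i) (t j))\<^sup>2)" if "j < n" for j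
  proof -
    have "blaschke (t i) (t j) \<noteq> 0" if "i < j" for i
    proof -
      have "t i \<noteq> t j" using that \<open>j < n\<close> t(2) by (auto simp: inj_on_def)
      then show ?thesis using one_minus_mult_pos[of "t i" "t j"] t(1) that \<open>j < n\<close> by (simp add: blaschke_def)
    qed
    then show ?thesis using one_minus_square_pos[OF t(1)[OF that]] by (intro mult_pos_pos prod_pos) auto
  qed
  have det_eq: "Determinant.det (Sigma_mat n t) = (\<Prod>j<n. 1 / (1 - (t j)\<^sup>2) * (\<Prod>i<j. (blaschke (t i) (t j))\<^sup>2))"
    by (rule det_Sigma_mat) (rule t(1))
  show det: "0 < Determinant.det (Sigma_mat n t)"
    unfolding det_eq using pos by (intro prod_pos) auto
  have "(weight n t)\<^sup>2 = (\<Prod>j<n. (2 / pi) * (1 / (1 - (t j)\<^sup>2) * (\<Prod>i<j. (blaschke (t i) (t j))\<^sup>2)))"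
    unfolding weight_def prod_power_distrib
  proof (rule prod.cong)
    fix j assume "j \<in> {..<n}"
    then have "0 < 1 - (t j)\<^sup>2" using one_minus_square_pos t(1) by simp
    then show "(sqrt (2 / pi) / sqrt (1 - (t j)\<^sup>2) * (\<Prod>i<j. \<bar>blaschke (t i) (t j)\<bar>))\<^sup>2 =
        (2 / pi) * (1 / (1 - (t j)\<^sup>2) * (\<Prod>i<j. (blaschke (t i) (t j))\<^sup>2))"
      by (simp add: power_mult_distrib power_divide prod_power_distrib)
  qed simp
  also have "\<dots> = (2 / pi) ^ n * Determinant.det (Sigma_mat n t)"
    unfolding det_eq by (simp only: prod.distrib prod_constant card_lessThan)
  finally have "(weight n t)\<^sup>2 = (2 / pi) ^ n * Determinant.det (Sigma_mat n t)" .
  moreover have "0 \<le> weight n t"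
  proof -
    have "0 \<le> sqrt (1 - (t j)\<^sup>2)" if "j < n" for j using one_minus_square_pos[OF t(1)[OF that]] by simp
    then show ?thesis
      unfolding weight_def by (intro prod_nonneg mult_nonneg_nonneg divide_nonneg_nonneg) simp_all
  qed
  ultimately show "weight n t = sqrt ((2 / pi) ^ n * Determinant.det (Sigma_mat n t))"
    using real_sqrt_unique[of "weight n t"] by simp
qed

lemma ex_sorting_permutation:
  fixes t :: "nat \<Rightarrow> real"
  assumes "inj_on t {..<n}"
  obtains p where "p permutes {0..<n}" "strict_mono_on {..<n} (t \<circ> p)"
    "map (t \<circ> p) [0..<n] = sort (map t [0..<n])"
proof -
  define L where "L = map t [0..<n]"
  obtain p where p: "p permutes {..<length L}" "permute_list p L = sort L"
    using mset_eq_permutation[of "sort L" L] by auto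
  have pl: "p i < n" if "i < n" for i using permutes_in_image[OF p(1), of i] that by (simp add: L_def)
  have eq: "map (t \<circ> p) [0..<n] = sort L"
    unfolding p(2)[symmetric] using pl by (intro nth_equalityI) (auto simp: permute_list_def L_def)
  have "distinct (sort L)" using assms by (simp add: L_def distinct_map atLeast0LessThan)
  then have "sorted_wrt (<) (map (t \<circ> p) [0..<n])" unfolding eq by (simp add: strict_sorted_iff)
  then have "strict_mono_on {..<n} (t \<circ> p)"
    by (intro strict_mono_onI) (auto simp: sorted_wrt_iff_nth_less)
  then show ?thesis using that p(1) eq by (simp add: L_def atLeast0LessThan)
qed

context gaussian_series
begin

lemma integrable_abs_prod:
  fixes t :: "nat \<Rightarrow> real" and n :: nat
  assumes "\<And>i. i < n \<Longrightarrow> \<bar>t i\<bar> < 1" "inj_on t {..<n}"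
  shows "integrable M (\<lambda>\<omega>. \<bar>\<Prod>i<n. f (t i) \<omega>\<bar>)"
proof -
  have "integrable M (\<lambda>\<omega>. 1 * (\<Prod>p\<in>t ` {..<n}. f p \<omega>))"
    using assms(1) by (intro integrable_prod_f_sgn) auto
  then show ?thesis using assms(2) by (simp add: prod.reindex integrable_abs)
qed

text \<open>By continuity of the sample functions, the sign at \<open>t i + \<epsilon>\<close> tends
  almost surely to the sign at \<open>t i\<close>, where a number times its sign is its absolute
  value. The integrable limit itself dominates.\<close>

lemma mixed_moment_limit:
  fixes t :: "nat \<Rightarrow> real" and n :: nat
  assumes t: "\<And>i. i < n \<Longrightarrow> \<bar>t i\<bar> < 1" "inj_on t {..<n}"
  shows "((\<lambda>\<epsilon>. \<integral>\<omega>. (\<Prod>i<n. f (t i) \<omega>) * (\<Prod>i<n. sgn (f (t i + \<epsilon>) \<omega>)) \<partial>M) \<longlongrightarrow> (\<integral>\<omega>. \<bar>\<Prod>i<n. f (t i) \<omega>\<bar> \<partial>M)) (at_right 0)"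
    (is "(?F \<longlongrightarrow> ?I) _")
  unfolding tendsto_at_iff_sequentially
proof (intro allI impI)
  fix X :: "nat \<Rightarrow> real" assume X: "X \<longlonglongrightarrow> 0"
  have "(\<lambda>k. ?F (X k)) \<longlonglongrightarrow> ?I"
  proof (rule integral_dominated_convergence[where w = "\<lambda>\<omega>. \<bar>\<Prod>i<n. f (t i) \<omega>\<bar>"])
    have "AE \<omega> in M. \<forall>i\<in>{..<n}. f (t i) \<omega> \<noteq> 0" using t by (intro AE_finite_allI AE_f_nonzero) auto
    then show "AE \<omega> in M. (\<lambda>k. (\<Prod>i<n. f (t i) \<omega>) * (\<Prod>i<n. sgn (f (t i + X k) \<omega>))) \<longlonglongrightarrow> \<bar>\<Prod>i<n. f (t i) \<omega>\<bar>"
      using AE_good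
    proof eventually_elim
      case (elim \<omega>)
      have "(\<lambda>k. f (t i + X k) \<omega>) \<longlonglongrightarrow> f (t i) \<omega>" if "i < n" for i
      proof -
        have "(\<lambda>k. t i + X k) \<longlonglongrightarrow> t i" using tendsto_add[OF tendsto_const X, of "t i"] by simp
        then show ?thesis by (rule isCont_tendsto_compose[OF good_isCont[OF elim(2) t(1)[OF that]]])
      qed
      then have "(\<lambda>k. (\<Prod>i<n. f (t i) \<omega>) * (\<Prod>i<n. sgn (f (t i + X k) \<omega>))) \<longlonglongrightarrow>
         (\<Prod>i<n. f (t i) \<omega>) * (\<Prod>i<n. sgn (f (t i) \<omega>))"
        using elim(1) by (intro tendsto_mult tendsto_const tendsto_prod tendsto_sgn) auto
      also have "(\<Prod>i<n. f (t i) \<omega>) * (\<Prod>i<n. sgn (f (t i) \<omega>)) = \<bar>\<Prod>i<n. f (t i) \<omega>\<bar>"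
        unfolding prod.distrib[symmetric] abs_prod by (simp add: abs_sgn)
      finally show ?case .
    qed
    show "AE \<omega> in M. norm ((\<Prod>i<n. f (t i) \<omega>) * (\<Prod>i<n. sgn (f (t i + X k) \<omega>))) \<le> \<bar>\<Prod>i<n. f (t i) \<omega>\<bar>" for k
      unfolding real_norm_def abs_mult using abs_prod_sgn_le_1 by (intro AE_I2 mult_left_le) auto
  qed (use integrable_abs_prod[OF t] in auto)
  then show "(?F \<circ> X) \<longlonglongrightarrow> ?I" by (simp add: o_def)
qed

lemma abs_prod_moment_sorted:
  assumes t: "\<And>i. i < n \<Longrightarrow> \<bar>t i\<bar> < 1" "strict_mono_on {..<n} t"
  shows "weight n t * (\<integral>\<omega>. \<bar>\<Prod>i<n. f (t i) \<omega>\<bar> \<partial>M) = (2 / pi) ^ n * pfaffian (K_mat n t)"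
proof -
  \<comment> \<open>Even positions hold the points \<open>t i\<close>, odd positions
    \<open>t i + \<epsilon>\<close>. For small positive \<open>\<epsilon>\<close> this sequence is
    strictly increasing inside the unit interval.\<close>
  define x where "x \<epsilon> i = t (i div 2) + (if even i then 0 else \<epsilon>)" for \<epsilon> i
  have inj: "inj_on t {..<n}" using t(2) by (rule strict_mono_on_imp_inj_on)
  have add: "((\<lambda>\<epsilon>. c + \<epsilon>) \<longlongrightarrow> c) (at_right 0)" for c :: real
    using tendsto_add[OF tendsto_const tendsto_ident_at, of c 0 "{0<..}"] by simp
  have ev: "eventually (\<lambda>\<epsilon>. 0 < \<epsilon> \<and> (\<forall>i\<in>{..<n}. t i + \<epsilon> < 1) \<and> (\<forall>i\<in>{..<n}. \<forall>j\<in>{..<n}. i < j \<longrightarrow> t i + \<epsilon> < t j)) (at_right 0)"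
  proof (intro eventually_conj eventually_ball_finite ballI)
    show "eventually (\<lambda>\<epsilon>. 0 < \<epsilon>) (at_right (0::real))" by (simp add: eventually_at_right_less)
    show "eventually (\<lambda>\<epsilon>. t i + \<epsilon> < 1) (at_right 0)" if "i \<in> {..<n}" for i
      using order_tendstoD(2)[OF add[of "t i"], of 1] t(1)[of i] that by (auto simp: abs_less_iff)
    show "eventually (\<lambda>\<epsilon>. i < j \<longrightarrow> t i + \<epsilon> < t j) (at_right 0)" if "i \<in> {..<n}" "j \<in> {..<n}" for i j
    proof (cases "i < j")
      case True
      then have "t i < t j" using strict_mono_onD[OF t(2)] that by auto
      then show ?thesis using order_tendstoD(2)[OF add[of "t i"], of "t j"] by (auto elim: eventually_mono)
    qed simp
  qed auto
  have "eventually (\<lambda>\<epsilon>. weight n t * (\<integral>\<omega>. (\<Prod>i<n. f (t i) \<omega>) * (\<Prod>i<n. sgn (f (t i + \<epsilon>) \<omega>)) \<partial>M) =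
     (2 / pi) ^ n * pf_list (\<lambda>i j. kappa (i mod 2) (j mod 2) (x \<epsilon> i) (x \<epsilon> j)) [0..<2 * n]) (at_right 0)"
    using ev
  proof eventually_elim
    case (elim \<epsilon>)
    have mono: "strict_mono_on {..<2 * n} (x \<epsilon>)"
    proof (rule strict_mono_onI)
      fix i j assume ij: "i \<in> {..<2 * n}" "j \<in> {..<2 * n}" "i < j"
      show "x \<epsilon> i < x \<epsilon> j"
      proof (cases "i div 2 = j div 2")
        case True
        then have "even i" "odd j" using ij(3) by presburger+
        then show ?thesis using True elim by (simp add: x_def)
      next
        case False
        then have "i div 2 < j div 2" using ij(3) by (simp add: div_le_mono le_neq_trans)
        moreover have "i div 2 < n" "j div 2 < n" using ij by auto
        ultimately have "t (i div 2) + \<epsilon> < t (j div 2)" using elim by auto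
        moreover have "x \<epsilon> i \<le> t (i div 2) + \<epsilon>" "t (j div 2) \<le> x \<epsilon> j" using elim by (auto simp: x_def)
        ultimately show ?thesis by linarith
      qed
    qed
    have bound: "\<bar>x \<epsilon> i\<bar> < 1" if "i < 2 * n" for i
    proof -
      have "i div 2 < n" using that by auto
      then show ?thesis using elim t(1)[of "i div 2"] by (auto simp: x_def abs_less_iff)
    qed
    have "weight n (\<lambda>i. x \<epsilon> (2 * i)) * mixed_moment n n (x \<epsilon>) =
      (2 / pi) ^ n * pf_list (\<lambda>i j. kappa (kind n i) (kind n j) (x \<epsilon> i) (x \<epsilon> j)) [0..<2 * n]"
      by (rule mixed_moment_eq_pf[OF mono bound order_refl])
    moreover have "pf_list (\<lambda>i j. kappa (kind n i) (kind n j) (x \<epsilon> i) (x \<epsilon> j)) [0..<2 * n]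
       = pf_list (\<lambda>i j. kappa (i mod 2) (j mod 2) (x \<epsilon> i) (x \<epsilon> j)) [0..<2 * n]"
      by (rule pf_cong) (simp add: kind_full)
    moreover have "(\<lambda>i. x \<epsilon> (2 * i)) = t" by (simp add: x_def)
    moreover have "mixed_moment n n (x \<epsilon>) = (\<integral>\<omega>. (\<Prod>i<n. f (t i) \<omega>) * (\<Prod>i<n. sgn (f (t i + \<epsilon>) \<omega>)) \<partial>M)"
      unfolding mixed_moment_def sgn_indices_full by (subst prod.reindex) (auto simp: inj_on_def x_def)
    ultimately show ?case by simp
  qed
  moreover have "((\<lambda>\<epsilon>. weight n t * (\<integral>\<omega>. (\<Prod>i<n. f (t i) \<omega>) * (\<Prod>i<n. sgn (f (t i + \<epsilon>) \<omega>)) \<partial>M))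
     \<longlongrightarrow> weight n t * (\<integral>\<omega>. \<bar>\<Prod>i<n. f (t i) \<omega>\<bar> \<partial>M)) (at_right 0)"
    by (intro tendsto_mult tendsto_const mixed_moment_limit t(1) inj)
  ultimately have "((\<lambda>\<epsilon>. (2 / pi) ^ n * pf_list (\<lambda>i j. kappa (i mod 2) (j mod 2) (x \<epsilon> i) (x \<epsilon> j)) [0..<2 * n])
     \<longlongrightarrow> weight n t * (\<integral>\<omega>. \<bar>\<Prod>i<n. f (t i) \<omega>\<bar> \<partial>M)) (at_right 0)"
    by (rule Lim_transform_eventually[rotated])
  moreover have "((\<lambda>\<epsilon>. (2 / pi) ^ n * pf_list (\<lambda>i j. kappa (i mod 2) (j mod 2) (x \<epsilon> i) (x \<epsilon> j)) [0..<2 * n])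
     \<longlongrightarrow> (2 / pi) ^ n * pfaffian (K_mat n t)) (at_right 0)"
    unfolding K_mat_pfaffian
  proof (intro tendsto_mult tendsto_const tendsto_pf)
    fix i j assume ij: "i \<in> set [0..<2 * n]" "j \<in> set [0..<2 * n]" "i \<noteq> j"
    have lim: "((\<lambda>\<epsilon>. x \<epsilon> i) \<longlongrightarrow> t (i div 2)) (at_right 0)" for i
      using add[of "t (i div 2)"] by (cases "even i") (simp_all add: x_def)
    have n: "i div 2 < n" "j div 2 < n" using ij by auto
    \<comment> \<open>Distinct positions over the same point have different parity, so the merging
      pairs meet a mixed entry and never the jump of the arcsine entry.\<close>
    have "i mod 2 = 0 \<or> j mod 2 = 0 \<or> i div 2 \<noteq> j div 2" using ij(3) by presburger
    then have "i mod 2 = 0 \<or> j mod 2 = 0 \<or> t (i div 2) \<noteq> t (j div 2)"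
      using inj n by (auto dest: inj_onD)
    then show "((\<lambda>\<epsilon>. kappa (i mod 2) (j mod 2) (x \<epsilon> i) (x \<epsilon> j)) \<longlongrightarrow>
        kappa (i mod 2) (j mod 2) (t (i div 2)) (t (j div 2))) (at_right 0)"
      by (intro tendsto_kappa lim t(1) n)
  qed simp
  ultimately show ?thesis by (rule tendsto_unique[OF trivial_limit_at_right_real])
qed

text \<open>Expectation, determinant and Pfaffian are all unchanged when the points are sorted, so
  the increasing case gives the general one.\<close>

lemma abs_prod_moment_eq_pfaffian:
  assumes t: "\<And>i. i < n \<Longrightarrow> \<bar>t i\<bar> < 1" "inj_on t {..<n}"
  shows "(\<integral>\<omega>. \<bar>\<Prod>i<n. f (t i) \<omega>\<bar> \<partial>M) =
    (2 / pi) powr (real n / 2) * Determinant.det (Sigma_mat n t) powr (- 1 / 2) * pfaffian (K_mat n t)"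
proof -
  obtain p where p: "p permutes {0..<n}" "strict_mono_on {..<n} (t \<circ> p)"
    "map (t \<circ> p) [0..<n] = sort (map t [0..<n])"
    using ex_sorting_permutation[OF t(2)] by blast
  have p': "p permutes {..<n}" using p(1) by (simp add: atLeast0LessThan)
  have tp: "\<bar>(t \<circ> p) i\<bar> < 1" if "i < n" for i
    using t(1) permutes_in_image[OF p', of i] that by simp
  define d where "d = Determinant.det (Sigma_mat n t)"
  have d: "0 < d" "weight n (t \<circ> p) = sqrt ((2 / pi) ^ n * d)"
    using weight_det(1)[of n t] t weight_det(2)[of n "t \<circ> p"] tp strict_mono_on_imp_inj_on[OF p(2)]
      det_Sigma_mat_permute[OF p(1), of t] by (auto simp: d_def)
  have pfK: "pfaffian (K_mat n (t \<circ> p)) = pfaffian (K_mat n t)"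
    unfolding K_mat_pfaffian_blocks p(3)
    by (rule pf_blocks_sort[of _ "[]", unfolded append_Nil]) (rule kappa_skew)
  have E: "(\<integral>\<omega>. \<bar>\<Prod>i<n. f ((t \<circ> p) i) \<omega>\<bar> \<partial>M) = (\<integral>\<omega>. \<bar>\<Prod>i<n. f (t i) \<omega>\<bar> \<partial>M)"
  proof -
    have eq: "(\<Prod>i<n. f ((t \<circ> p) i) \<omega>) = (\<Prod>i<n. f (t i) \<omega>)" for \<omega>
      using prod.permute[OF p', of "\<lambda>i. f (t i) \<omega>", symmetric] unfolding o_def .
    show ?thesis unfolding eq ..
  qed
  \<comment> \<open>The weight is \<open>c * sqrt d\<close> and the right-hand side carries
    \<open>c * c\<close>; dividing leaves one \<open>c\<close>, the power \<open>n / 2\<close> of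
    \<open>2 / pi\<close>.\<close>
  define c where "c = sqrt ((2 / pi) ^ n)"
  define I where "I = (\<integral>\<omega>. \<bar>\<Prod>i<n. f (t i) \<omega>\<bar> \<partial>M)"
  have c: "0 < c" "(2 / pi) ^ n = c * c" by (simp_all add: c_def)
  have "sqrt ((2 / pi) ^ n * d) * I = (2 / pi) ^ n * pfaffian (K_mat n t)"
    using abs_prod_moment_sorted[of n "t \<circ> p", OF tp p(2)] unfolding E pfK d(2) I_def .
  then have "(c * sqrt d) * I = (2 / pi) ^ n * pfaffian (K_mat n t)"
    unfolding c_def real_sqrt_mult .
  then have "(c * sqrt d) * I = (c * c) * pfaffian (K_mat n t)" by (simp only: c(2))
  then have "I = c * (1 / sqrt d) * pfaffian (K_mat n t)"
    using c(1) d(1) by (simp add: field_simps)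
  also have "c = (2 / pi) powr (real n / 2)"
    by (simp add: c_def powr_half_sqrt[symmetric] powr_realpow[symmetric] powr_powr)
  also have "1 / sqrt d = d powr (- 1 / 2)"
    using d(1) powr_minus[of d "1/2"] by (simp add: powr_half_sqrt inverse_eq_divide)
  finally show ?thesis unfolding I_def d_def .
qed

end

theorem theorem2p5:
  fixes M :: "'w measure" and a :: "nat \<Rightarrow> 'w \<Rightarrow> real"
    and n :: nat and t :: "nat \<Rightarrow> real"
  assumes "prob_space M"
    and "prob_space.indep_vars M (\<lambda>_. borel) a UNIV"
    and "\<And>k. distributed M lborel (a k) std_normal_density"
    and "n \<ge> 1"
    and "\<And>i. i < n \<Longrightarrow> t i \<in> {-1<..<1}"
    and "inj_on t {..<n}"
  shows "integrable M (\<lambda>\<omega>. \<bar>\<Prod>i<n. random_power_series a (t i) \<omega>\<bar>) \<and>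
    (\<integral>\<omega>. \<bar>\<Prod>i<n. random_power_series a (t i) \<omega>\<bar> \<partial>M)
      = (2 / pi) powr (real n / 2) * Determinant.det (Sigma_mat n t) powr (- 1 / 2)
          * pfaffian (K_mat n t)"
proof -
  interpret gaussian_series M a
    using assms(1-3) by (simp add: gaussian_series_def gaussian_series_axioms_def)
  have "\<bar>t i\<bar> < 1" if "i < n" for i using assms(5)[OF that] by (simp add: abs_less_iff)
  then show ?thesis using integrable_abs_prod abs_prod_moment_eq_pfaffian assms(6) by blast
qed

end
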